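(* Let $\mathbf{k}\ge 1$, $\mathbf{l}\ge 0$ be integers and let $K(x,y)=b_{\mathbf{k}}x^{\mathbf{k}}+\cdots+b_1x+b_0+b_{-1}y+\cdots+b_{-\mathbf{l}}y^{\mathbf{l}}$ with complex constants $b_{\mathbf{k}},\dots,b_{-\mathbf{l}}$, $b_{\mathbf{k}}\neq 0$. The Hill equation $$f''(z)-K(e^{z},e^{-z})f(z)=0\qquad(\dagger)$$ has a nonzero non-oscillatory solution $f$ if and only if the equation $$x^{2}u''(x)-\Big[K(x,x^{-1})-\tfrac14\Big]u(x)=0\qquad(\ddagger)$$ has a nonzero Liouvillian solution $u$ in Kovacic's case (I) or (II). Moreover: in Kovacic's case (I), $\mathbf{k}$ and $\mathbf{l}$ are both even integers and $u$ has the form $$u(x)=x^{1/2}\,\psi(x^{1/\mathbf{p}})\,x^{c}\,e^{\chi(x^{1/\mathbf{p}})}\qquad( * )$$ with $\mathbf{p}=1$; in Kovacic's case (II), $\mathbf{k}$ is an odd integer, $b_{-1}=\cdots=b_{-\mathbf{l}}=0$, and $u$ has the form $( * )$ with $\mathbf{p}=2$. Here, in $( * )$, $c$ is a complex constant, $\psi$ is a polynomial with simple roots only, and $\chi$ is a Laurent polynomial.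
   Context: Every nonzero solution $f$ of $(\dagger)$ is an entire function. $\lambda(f)$ denotes the exponent of convergence of the zeros of $f$; a solution $f$ is called non-oscillatory if $\lambda(f)<\infty$. Kovacic's cases: dividing by $x^2$, equation $(\ddagger)$ is of the form $u''=ru$ with $r\in\mathbb{C}(x)$. For such an equation exactly one of the following four cases occurs: (I) there is a solution of the form $e^{\int\omega\,dx}$ with $\omega\in\mathbb{C}(x)$; (II) there is a solution of the form $e^{\int\omega\,dx}$ where $\omega$ is algebraic over $\mathbb{C}(x)$ of degree $2$, and case (I) does not occur; (III) all solutions are algebraic over $\mathbb{C}(x)$ and cases (I), (II) do not hold; (IV) there are no (nonzero) Liouvillian solutions. A "Liouvillian solution $u$ in Kovacic's case (I) (resp. (II))" means that case (I) (resp. (II)) occurs for the equation and $u$ is a nonzero solution of the form $e^{\int\omega\,dx}$ described there.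
   Formalization: In case (I), "l even" is proved for the largest j ≤ l with b_{-j} ≠ 0 (0 if none), which is l itself when l = 0 or b_{-l} ≠ 0; with b_{-l} = 0 allowed the claim fails, e.g. K = x²+x written with l = 1, b_{-1} = 0, f = exp(e^z). *)

theory Defs
  imports "HOL-Complex_Analysis.Complex_Analysis" "HOL-Computational_Algebra.Polynomial"
begin

section \<open>The two differential equations\<close>

text \<open>The coefficients are indexed by integers: \<open>b j\<close> for \<open>j \<ge> 0\<close> is the coefficient of
  \<open>x ^ j\<close>, and \<open>b (- j)\<close> for \<open>j \<ge> 1\<close> is the coefficient of \<open>y ^ j\<close>.\<close>

definition K :: "nat \<Rightarrow> nat \<Rightarrow> (int \<Rightarrow> complex) \<Rightarrow> complex \<Rightarrow> complex \<Rightarrow> complex" where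
  "K k l b x y = (\<Sum>j=0..k. b (int j) * x ^ j) + (\<Sum>j=1..l. b (- int j) * y ^ j)"

definition hill_solution :: "nat \<Rightarrow> nat \<Rightarrow> (int \<Rightarrow> complex) \<Rightarrow> (complex \<Rightarrow> complex) \<Rightarrow> bool" where
  "hill_solution k l b f \<longleftrightarrow>
     f holomorphic_on UNIV \<and>
     (\<forall>z. deriv (deriv f) z - K k l b (exp z) (exp (- z)) * f z = 0)"

definition rational_ode_solution ::
  "nat \<Rightarrow> nat \<Rightarrow> (int \<Rightarrow> complex) \<Rightarrow> complex set \<Rightarrow> (complex \<Rightarrow> complex) \<Rightarrow> bool" where
  "rational_ode_solution k l b D u \<longleftrightarrow>
     u holomorphic_on D \<and>
     (\<forall>x\<in>D. x\<^sup>2 * deriv (deriv u) x - (K k l b x (inverse x) - 1 / 4) * u x = 0)"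

text \<open>The number of negative powers effectively present.  It equals \<open>l\<close> when \<open>l = 0\<close> or
  \<open>b (- l) \<noteq> 0\<close>; trailing zero coefficients, which only pad the notation for \<^const>\<open>K\<close>,
  are discarded.  The parity of \<open>l\<close> itself is meaningless in the presence of such padding.\<close>

definition effective_l :: "nat \<Rightarrow> (int \<Rightarrow> complex) \<Rightarrow> nat" where
  "effective_l l b = Max {j. j \<le> l \<and> (j = 0 \<or> b (- int j) \<noteq> 0)}"


section \<open>Exponent of convergence of the zeros\<close>

text \<open>The infimum of all \<open>s > 0\<close> for which the sum of \<open>|z| ^ (- s)\<close> over the nonzero zeros,
  counted with multiplicity, converges; it is \<open>\<infinity>\<close> if there is no such \<open>s\<close>.\<close>

definition exponent_of_convergence :: "(complex \<Rightarrow> complex) \<Rightarrow> ereal" where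
  "exponent_of_convergence f =
     Inf {ereal s | s. s > 0 \<and>
        (\<lambda>z. real_of_int (zorder f z) / norm z powr s) summable_on {z. z \<noteq> 0 \<and> f z = 0}}"

definition non_oscillatory :: "(complex \<Rightarrow> complex) \<Rightarrow> bool" where
  "non_oscillatory f \<longleftrightarrow> exponent_of_convergence f < \<infinity>"


section \<open>Kovacic's cases\<close>

definition rational_on :: "complex set \<Rightarrow> (complex \<Rightarrow> complex) \<Rightarrow> bool" where
  "rational_on A w \<longleftrightarrow>
     (\<exists>p q. q \<noteq> 0 \<and> (\<forall>x\<in>A. poly q x \<noteq> 0 \<and> w x = poly p x / poly q x))"

text \<open>\<open>P\<close> is a polynomial in \<open>Y\<close> whose coefficients are polynomials in \<open>x\<close>, and
  \<open>poly (poly P [:y:]) x\<close> is its value at \<open>Y = y\<close>.  Since denominators can be cleared, the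
  degree of the minimal polynomial over the field of rational functions is the least degree of
  a nonzero \<open>P\<close> that annihilates \<open>w\<close>.\<close>

definition annihilates_on :: "complex set \<Rightarrow> complex poly poly \<Rightarrow> (complex \<Rightarrow> complex) \<Rightarrow> bool" where
  "annihilates_on A P w \<longleftrightarrow> (\<forall>x\<in>A. poly (poly P [:w x:]) x = 0)"

definition algebraic_of_degree_on :: "complex set \<Rightarrow> nat \<Rightarrow> (complex \<Rightarrow> complex) \<Rightarrow> bool" where
  "algebraic_of_degree_on A n w \<longleftrightarrow>
     (\<exists>P. P \<noteq> 0 \<and> degree P = n \<and> annihilates_on A P w) \<and>
     (\<forall>P. P \<noteq> 0 \<and> degree P < n \<longrightarrow> \<not> annihilates_on A P w)"

definition nonzero_locus :: "complex set \<Rightarrow> (complex \<Rightarrow> complex) \<Rightarrow> complex set" where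
  "nonzero_locus D u = {x \<in> D. u x \<noteq> 0}"

text \<open>A function \<open>u\<close> is of the form \<open>e\<^bsup>\<integral>\<omega>\<^esup>\<close> if it is not identically zero and has
  logarithmic derivative \<open>\<omega>\<close>.  The zeros of \<open>u\<close> are poles of \<open>\<omega>\<close>, so \<open>\<omega>\<close> is only
  considered away from them.\<close>

definition is_exp_integral_on :: "complex set \<Rightarrow> (complex \<Rightarrow> complex) \<Rightarrow> (complex \<Rightarrow> complex) \<Rightarrow> bool" where
  "is_exp_integral_on D w u \<longleftrightarrow>
     nonzero_locus D u \<noteq> {} \<and> (\<forall>x \<in> nonzero_locus D u. deriv u x = w x * u x)"

text \<open>In the following definitions \<open>E\<close> is the predicate of being a solution on \<open>D\<close> of the
  equation considered.\<close>

definition case_I_form ::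
  "complex set \<Rightarrow> ((complex \<Rightarrow> complex) \<Rightarrow> bool) \<Rightarrow> (complex \<Rightarrow> complex) \<Rightarrow> bool" where
  "case_I_form D E u \<longleftrightarrow>
     E u \<and> (\<exists>w. is_exp_integral_on D w u \<and> rational_on (nonzero_locus D u) w)"

definition case_II_form ::
  "complex set \<Rightarrow> ((complex \<Rightarrow> complex) \<Rightarrow> bool) \<Rightarrow> (complex \<Rightarrow> complex) \<Rightarrow> bool" where
  "case_II_form D E u \<longleftrightarrow>
     E u \<and> (\<exists>w. is_exp_integral_on D w u \<and> algebraic_of_degree_on (nonzero_locus D u) 2 w)"

definition kovacic_case_I :: "complex set \<Rightarrow> ((complex \<Rightarrow> complex) \<Rightarrow> bool) \<Rightarrow> bool" where
  "kovacic_case_I D E \<longleftrightarrow> (\<exists>u. case_I_form D E u)"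

definition kovacic_case_II :: "complex set \<Rightarrow> ((complex \<Rightarrow> complex) \<Rightarrow> bool) \<Rightarrow> bool" where
  "kovacic_case_II D E \<longleftrightarrow> (\<exists>u. case_II_form D E u) \<and> \<not> kovacic_case_I D E"

definition liouvillian_solution_I ::
  "complex set \<Rightarrow> ((complex \<Rightarrow> complex) \<Rightarrow> bool) \<Rightarrow> (complex \<Rightarrow> complex) \<Rightarrow> bool" where
  "liouvillian_solution_I D E u \<longleftrightarrow> kovacic_case_I D E \<and> case_I_form D E u"

definition liouvillian_solution_II ::
  "complex set \<Rightarrow> ((complex \<Rightarrow> complex) \<Rightarrow> bool) \<Rightarrow> (complex \<Rightarrow> complex) \<Rightarrow> bool" where
  "liouvillian_solution_II D E u \<longleftrightarrow> kovacic_case_II D E \<and> case_II_form D E u"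


section \<open>The explicit form of the solutions\<close>

definition laurent_polynomial :: "(complex \<Rightarrow> complex) \<Rightarrow> bool" where
  "laurent_polynomial h \<longleftrightarrow>
     (\<exists>(m::nat) (n::nat) (a::int \<Rightarrow> complex).
        \<forall>t. t \<noteq> 0 \<longrightarrow> h t = (\<Sum>j = - int m..int n. a j * t powi j))"

text \<open>\<open>L\<close> is a branch of the logarithm on \<open>D\<close>, which consistently determines all the powers:
  \<open>x\<^sup>s\<close> is \<open>exp (s * L x)\<close>.  Changing the branch only changes \<open>\<psi>\<close> and \<open>h\<close>.\<close>

definition has_explicit_form :: "complex set \<Rightarrow> nat \<Rightarrow> (complex \<Rightarrow> complex) \<Rightarrow> bool" where
  "has_explicit_form D p u \<longleftrightarrow>
     (\<exists>L c \<psi> h. L holomorphic_on D \<and> (\<forall>x\<in>D. exp (L x) = x) \<and>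
        rsquarefree \<psi> \<and> laurent_polynomial h \<and>
        (\<forall>x\<in>D. u x = exp (L x / 2) * poly \<psi> (exp (L x / of_nat p)) * exp (c * L x)
                      * exp (h (exp (L x / of_nat p)))))"

end

theory Submission
  imports Defs
begin

text \<open>
  A solution \<open>f\<close> of the Hill equation corresponds to \<open>u(x) = x\<^bsup>1/2\<^esup> f(log x)\<close>, and the
  Liouvillian forms of \<open>u\<close> say that \<open>f'/f\<close> is algebraic of degree at most \<open>2\<close> in \<open>e\<^sup>z\<close>.  In that
  case the zeros of \<open>f\<close>, which are simple, lie over finitely many values of \<open>e\<^sup>z\<close>, so \<open>f\<close> is
  non-oscillatory.

  Conversely, let \<open>f\<close> be non-oscillatory.  To the right the potential is asymptotic to \<open>g\<^sup>2\<close>, where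
  \<open>g\<close> is a multiple of \<open>e\<^bsup>kz/2\<^esup>\<close>, and at scale \<open>1/g\<close> the function \<open>f\<close> looks like a solution of
  \<open>w'' = w\<close>.  A zero far to the right therefore generates an infinite sequence of zeros
  whose moduli grow only logarithmically, which is excluded.  So \<open>f\<close> has no zeros far to
  the right, and there \<open>f'/f\<close> is close to \<open>g\<close> or to \<open>- g\<close>.  If \<open>g\<close> has the period \<open>2 \<pi> i p\<close>, then
  \<open>f\<close> and its translate by \<open>2 \<pi> i p\<close> decay along a common ray, hence have Wronskian zero and
  are proportional; this applies to \<open>p = 2\<close>, and to \<open>p = 1\<close> if \<open>k\<close> is even.  With the
  corresponding bounds to the left, \<open>f\<close> is a function of \<open>t = e\<^bsup>z/p\<^esup>\<close>, up to a factor \<open>e\<^bsup>cz\<^esup>\<close>, with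
  finitely many zeros and a logarithmic derivative of polynomial growth at \<open>0\<close> and \<open>\<infinity>\<close>;
  Liouville's theorem gives the explicit form.

  The parity statements follow by comparing the sign of \<open>g\<close> under translation by \<open>2 \<pi> i\<close> with
  the period of \<open>f'/f\<close> at both ends.
\<close>

section \<open>Second-order linear equations in the complex plane\<close>

text \<open>Precision 1/2 for \<open>f' / (f * g)\<close> is deliberately crude. It decides which
  exponential dominates, gives decay along a ray and bounds \<open>f'/f\<close> by a power of e^z;
  Liouville's theorem turns such bounds into exact rational data, so no asymptotic expansion is
  needed. All estimates near infinity are therefore made on discs of radius 6 in the rescaled
  variable, with explicit constants. The two equations live in different places: one has entire
  solutions, the other solutions on a domain \<open>D\<close> that may be small. A branch
  \<open>L\<close> of the logarithm links them, and a relation between \<open>f\<close>,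
  \<open>f'\<close> and e^z that holds on the image of \<open>D\<close> under \<open>L\<close>
  extends to the plane by the identity theorem. The right end never degenerates because b_k is
  nonzero. Without negative powers, however, the left end is a regular singular point and needs its
  own growth estimate. For odd \<open>k\<close>, an even positive \<open>l\<close> is excluded
  because the left end then forces a multiplier for the period 2 pi i; odd \<open>l\<close> is the
  hard case, since no end provides such a multiplier.\<close>

definition ode_sol :: "(complex \<Rightarrow> complex) \<Rightarrow> (complex \<Rightarrow> complex) \<Rightarrow> (complex \<Rightarrow> complex) \<Rightarrow> bool" where
  "ode_sol Q f f' \<longleftrightarrow>
     (\<forall>z. (f has_field_derivative f' z) (at z) \<and> (f' has_field_derivative Q z * f z) (at z))"

lemma ode_solD:
  assumes "ode_sol Q f f'"
  shows "(f has_field_derivative f' z) (at z)" "(f' has_field_derivative Q z * f z) (at z)"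
  using assms by (auto simp: ode_sol_def)

lemma ode_sol_holomorphic:
  assumes "ode_sol Q f f'"
  shows "f holomorphic_on S" "f' holomorphic_on S"
  using ode_solD[OF assms] by (auto simp: holomorphic_on_def field_differentiable_def
      intro: has_field_derivative_at_within)

lemma ode_sol_continuous:
  assumes "ode_sol Q f f'"
  shows "continuous_on S f" "continuous_on S f'"
  using ode_sol_holomorphic[OF assms] holomorphic_on_imp_continuous_on by auto

lemma ode_sol_shift:
  assumes "ode_sol Q f f'" "\<And>z. Q (z + w) = Q z"
  shows "ode_sol Q (\<lambda>z. f (z + w)) (\<lambda>z. f' (z + w))"
  unfolding ode_sol_def
proof (intro allI conjI)
  fix z :: complex
  have s: "((\<lambda>z. z + w) has_field_derivative 1) (at z)"
    by (auto intro!: derivative_eq_intros)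
  show "((\<lambda>z. f (z + w)) has_field_derivative f' (z + w)) (at z)"
    using DERIV_chain2[OF ode_solD(1)[OF assms(1)] s] by simp
  show "((\<lambda>z. f' (z + w)) has_field_derivative Q z * f (z + w)) (at z)"
    using DERIV_chain2[OF ode_solD(2)[OF assms(1)] s] assms(2) by simp
qed

lemma ode_sol_reflect:
  assumes "ode_sol Q f f'"
  shows "ode_sol (\<lambda>z. Q (- z)) (\<lambda>z. f (- z)) (\<lambda>z. - f' (- z))"
  unfolding ode_sol_def
proof (intro allI conjI)
  fix z :: complex
  have s: "((\<lambda>z. - z) has_field_derivative - 1) (at z)"
    by (auto intro!: derivative_eq_intros)
  show "((\<lambda>z. f (- z)) has_field_derivative - f' (- z)) (at z)"
    using DERIV_chain2[OF ode_solD(1)[OF assms] s] by simp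
  have "((\<lambda>z. f' (- z)) has_field_derivative - (Q (- z) * f (- z))) (at z)"
    using DERIV_chain2[OF ode_solD(2)[OF assms] s] by simp
  from DERIV_minus[OF this]
  show "((\<lambda>z. - f' (- z)) has_field_derivative Q (- z) * f (- z)) (at z)" by simp
qed

lemma has_real_derivative_inner_self:
  fixes F :: "real \<Rightarrow> 'a::real_inner"
  assumes "(F has_vector_derivative D) (at s)"
  shows "((\<lambda>s. F s \<bullet> F s) has_real_derivative 2 * (F s \<bullet> D)) (at s)"
  using bounded_bilinear.has_vector_derivative[OF bounded_bilinear_inner assms assms]
  by (simp add: has_real_derivative_iff_has_vector_derivative inner_commute)

text \<open>Gronwall's inequality for the energy |f|^2 + |f'|^2 along the segment: 2|f||f'| is at
  most the energy, so its growth rate is at most (1 + M)|z - a|. It yields uniqueness and, later,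
  polynomial growth at a regular singular point.\<close>

lemma ode_growth:
  assumes sol: "ode_sol Q f f'" and M: "\<And>s. s \<in> closed_segment a z \<Longrightarrow> norm (Q s) \<le> M"
  shows "(norm (f z))\<^sup>2 + (norm (f' z))\<^sup>2
          \<le> ((norm (f a))\<^sup>2 + (norm (f' a))\<^sup>2) * exp ((1 + M) * norm (z - a))"
proof -
  define d where "d = z - a"
  define F where "F s = f (a + of_real s * d)" for s :: real
  define G where "G s = f' (a + of_real s * d)" for s :: real
  define E where "E s = F s \<bullet> F s + G s \<bullet> G s" for s
  define C where "C = (1 + M) * norm d"
  define q where "q s = Q (a + of_real s * d)" for s :: real
  have p: "((\<lambda>s. a + of_real s * d) has_vector_derivative d) (at s)" for s :: real
    by (auto intro!: derivative_eq_intros)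
  have F': "(F has_vector_derivative d * G s) (at s)" for s
    using field_vector_diff_chain_at[OF p ode_solD(1)[OF sol]] unfolding F_def G_def o_def .
  have G': "(G has_vector_derivative d * (q s * F s)) (at s)" for s
    using field_vector_diff_chain_at[OF p ode_solD(2)[OF sol]] unfolding F_def G_def q_def o_def .
  have E': "(E has_real_derivative (2 * (F s \<bullet> (d * G s)) + 2 * (G s \<bullet> (d * (q s * F s))))) (at s)" for s
    unfolding E_def by (rule DERIV_add has_real_derivative_inner_self F' G')+
  have bound: "2 * (F s \<bullet> (d * G s)) + 2 * (G s \<bullet> (d * (q s * F s))) \<le> C * E s"
    if "0 \<le> s" "s \<le> 1" for s
  proof -
    have "a + of_real s * d \<in> closed_segment a z"
      unfolding closed_segment_def d_def using that
      by (auto intro!: exI[of _ s] simp: algebra_simps scaleR_conv_of_real)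
    then have q: "norm (q s) \<le> M" using M unfolding q_def by blast
    then have M0: "0 \<le> M" using norm_ge_zero order_trans by blast
    let ?x = "norm (F s)" and ?y = "norm (G s)"
    have 1: "F s \<bullet> (d * G s) \<le> norm d * (?x * ?y)"
      using norm_cauchy_schwarz[of "F s" "d * G s"] by (simp add: norm_mult mult_ac)
    have "G s \<bullet> (d * (q s * F s)) \<le> ?y * (norm d * (norm (q s) * ?x))"
      using norm_cauchy_schwarz[of "G s" "d * (q s * F s)"] by (simp add: norm_mult)
    also have "\<dots> \<le> ?y * (norm d * (M * ?x))"
      using q by (intro mult_left_mono mult_right_mono) auto
    finally have 2: "G s \<bullet> (d * (q s * F s)) \<le> M * norm d * (?x * ?y)" by (simp add: mult_ac)
    have 3: "2 * (?x * ?y) \<le> ?x\<^sup>2 + ?y\<^sup>2"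
      using sum_squares_bound[of ?x ?y] by simp
    have E: "E s = ?x\<^sup>2 + ?y\<^sup>2" unfolding E_def by (simp add: power2_norm_eq_inner)
    have "C * (2 * (?x * ?y)) \<le> C * E s"
      unfolding E by (rule mult_left_mono[OF 3]) (simp add: C_def M0)
    with 1 2 show ?thesis unfolding C_def by (simp add: algebra_simps)
  qed
  have "E 1 * exp (- C * 1) \<le> E 0 * exp (- C * 0)"
  proof (rule DERIV_nonpos_imp_nonincreasing[of 0 1 "\<lambda>s. E s * exp (- C * s)"])
    fix s :: real assume s: "0 \<le> s" "s \<le> 1"
    let ?D = "2 * (F s \<bullet> (d * G s)) + 2 * (G s \<bullet> (d * (q s * F s)))"
    have "((\<lambda>s. E s * exp (- C * s)) has_real_derivative (?D - C * E s) * exp (- C * s)) (at s)"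
      by (rule derivative_eq_intros E' refl | simp)+ (simp add: algebra_simps)
    moreover have "(?D - C * E s) * exp (- C * s) \<le> 0"
      using bound[OF s] by (intro mult_nonpos_nonneg) auto
    ultimately show "\<exists>y. ((\<lambda>s. E s * exp (- C * s)) has_real_derivative y) (at s) \<and> y \<le> 0" by blast
  qed simp
  then have "E 1 \<le> E 0 * exp C" by (simp add: exp_minus field_simps)
  then show ?thesis
    unfolding E_def F_def G_def C_def d_def by (simp add: power2_norm_eq_inner)
qed

lemma ode_unique:
  assumes sol: "ode_sol Q f f'" and Q: "continuous_on UNIV Q" and "f a = 0" "f' a = 0"
  shows "f z = 0"
proof -
  have "compact (Q ` closed_segment a z)"
    by (intro compact_continuous_image continuous_on_subset[OF Q]) auto
  then obtain M where "\<And>s. s \<in> closed_segment a z \<Longrightarrow> norm (Q s) \<le> M"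
    by (meson bounded_iff compact_imp_bounded imageI)
  from ode_growth[OF sol this, of a z] show ?thesis using assms(3,4)
    by (simp add: sum_power2_le_zero_iff)
qed

lemma wronskian_const:
  assumes "ode_sol Q f f'" "ode_sol Q g g'"
  shows "f z * g' z - f' z * g z = f 0 * g' 0 - f' 0 * g 0"
proof -
  have "((\<lambda>z. f z * g' z - f' z * g z) has_field_derivative 0) (at z)" for z
    by (rule derivative_eq_intros ode_solD[OF assms(1)] ode_solD[OF assms(2)] refl)+
       (simp add: algebra_simps)
  then show ?thesis
    using has_field_derivative_zero_constant[of UNIV "\<lambda>z. f z * g' z - f' z * g z"]
    by (metis UNIV_I convex_UNIV)
qed

lemma ode_sol_combine:
  assumes "ode_sol Q f f'" "ode_sol Q g g'"
  shows "ode_sol Q (\<lambda>z. g z - c * f z) (\<lambda>z. g' z - c * f' z)"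
  unfolding ode_sol_def
  by (intro allI conjI; (rule derivative_eq_intros ode_solD[OF assms(1)] ode_solD[OF assms(2)] refl)+)
     (simp_all add: algebra_simps)

text \<open>\<open>c\<close> is read off at a point \<open>b\<close> where \<open>f\<close> does not
  vanish; since the Wronskian is constant, \<open>g - c * f\<close> has zero Cauchy data at
  \<open>b\<close>.\<close>

lemma wronskian_zero_imp_multiple:
  assumes f: "ode_sol Q f f'" and g: "ode_sol Q g g'" and Q: "continuous_on UNIV Q"
    and W: "f a * g' a - f' a * g a = 0" and nz: "f b \<noteq> 0"
  obtains c where "\<And>z. g z = c * f z" "\<And>z. g' z = c * f' z"
proof -
  define c where "c = g b / f b"
  have "f b * g' b - f' b * g b = 0"
    using W wronskian_const[OF f g, of a] wronskian_const[OF f g, of b] by simp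
  then have "g' b - c * f' b = 0" "g b - c * f b = 0"
    using nz by (simp_all add: c_def field_simps)
  from ode_unique[OF ode_sol_combine[OF f g] Q this(2,1)]
  have eq: "g z = c * f z" for z by simp
  have "g' z = c * f' z" for z
  proof -
    have "(g has_field_derivative c * f' z) (at z)"
      unfolding eq[abs_def] by (rule DERIV_cmult ode_solD[OF f])+
    then show ?thesis using ode_solD(1)[OF g] DERIV_unique by blast
  qed
  with eq that show ?thesis by blast
qed

lemma norm_decreasing_along_ray:
  fixes F :: "real \<Rightarrow> complex"
  assumes "\<And>x. x \<ge> x0 \<Longrightarrow> (F has_vector_derivative \<mu> x * F x) (at x)"
    and "\<And>x. x \<ge> x0 \<Longrightarrow> Re (\<mu> x) \<le> 0" and "x0 \<le> x"
  shows "norm (F x) \<le> norm (F x0)"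
proof -
  have "F x \<bullet> F x \<le> F x0 \<bullet> F x0"
  proof (rule DERIV_nonpos_imp_nonincreasing[OF assms(3), of "\<lambda>x. F x \<bullet> F x"])
    fix s assume s: "x0 \<le> s" "s \<le> x"
    have "((\<lambda>s. F s \<bullet> F s) has_real_derivative 2 * (F s \<bullet> (\<mu> s * F s))) (at s)"
      by (rule has_real_derivative_inner_self assms(1)[OF s(1)])+
    moreover have "F s \<bullet> (\<mu> s * F s) = Re (\<mu> s) * (norm (F s))\<^sup>2"
      unfolding cmod_power2 by (simp add: inner_complex_def algebra_simps power2_eq_square)
    moreover have "Re (\<mu> s) * (norm (F s))\<^sup>2 \<le> 0"
      using assms(2)[OF s(1)] by (simp add: mult_nonpos_nonneg)
    ultimately show "\<exists>y. ((\<lambda>s. F s \<bullet> F s) has_real_derivative y) (at s) \<and> y \<le> 0"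
      by (metis mult_le_0_iff zero_le_numeral)
  qed
  then show ?thesis by (simp add: norm_eq_sqrt_inner)
qed

section \<open>Zeros and asymptotics in a half-plane\<close>

text \<open>The coefficients of \<open>w\<close> with respect to the solutions \<open>e\<^sup>t\<close>, \<open>e\<^bsup>-t\<^esup>\<close> of
  \<open>w'' = w\<close>, obtained by variation of constants, stay almost constant if \<open>q\<close> is close to \<open>1\<close>.\<close>

lemma exp_comparison:
  fixes w w' q :: "complex \<Rightarrow> complex" and R \<epsilon> :: real
  defines "\<alpha> \<equiv> (w 0 + w' 0) / 2" and "\<beta> \<equiv> (w 0 - w' 0) / 2"
  assumes w: "\<And>t. norm t \<le> R \<Longrightarrow> (w has_field_derivative w' t) (at t)"
    and w': "\<And>t. norm t \<le> R \<Longrightarrow> (w' has_field_derivative q t * w t) (at t)"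
    and q: "\<And>t. norm t \<le> R \<Longrightarrow> norm (q t - 1) \<le> \<epsilon>"
    and R: "0 \<le> R" and small: "R * \<epsilon> * exp (2 * R) \<le> 1 / 2" and t: "norm t \<le> R"
  shows "norm (w t - (\<alpha> * exp t + \<beta> * exp (- t))) \<le> 2 * R * \<epsilon> * exp (3 * R) * (norm \<alpha> + norm \<beta>)"
proof -
  have eps: "0 \<le> \<epsilon>" using q[of 0] R by (simp add: order_trans[OF norm_ge_zero])
  have "continuous_on (cball 0 R) (\<lambda>t. norm (w t))"
    by (intro continuous_on_norm DERIV_continuous_on[of _ w w'])
       (auto intro!: has_field_derivative_at_within w)
  then obtain t0 where t0: "norm t0 \<le> R" "\<And>t. norm t \<le> R \<Longrightarrow> norm (w t) \<le> norm (w t0)"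
    using continuous_attains_sup[of "cball 0 R" "\<lambda>t. norm (w t)"] R by auto
  define M where "M = norm (w t0)"
  define N where "N = norm \<alpha> + norm \<beta>"
  define A where "A t = (w t + w' t) * exp (- t) / 2" for t
  define B where "B t = (w t - w' t) * exp t / 2" for t
  have ex: "norm (exp t) \<le> exp R" "norm (exp (- t)) \<le> exp R" if "norm t \<le> R" for t :: complex
    using abs_Re_le_cmod[of t] that by (auto simp: norm_exp_eq_Re)
  have A': "(A has_field_derivative (q t - 1) * w t * exp (- t) / 2) (at t)" if "norm t \<le> R" for t
    unfolding A_def by (rule derivative_eq_intros w[OF that] w'[OF that] refl | simp)+
      (simp add: algebra_simps)
  have B': "(B has_field_derivative - ((q t - 1) * w t * exp t / 2)) (at t)" if "norm t \<le> R" for t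
    unfolding B_def by (rule derivative_eq_intros w[OF that] w'[OF that] refl | simp)+
      (simp add: algebra_simps)
  define K where "K = \<epsilon> * M * exp R / 2"
  have K0: "0 \<le> K" unfolding K_def M_def using eps by simp
  have bnd: "norm ((q t - 1) * w t * e / 2) \<le> K" if "norm t \<le> R" "norm e \<le> exp R" for t e
  proof -
    have "norm ((q t - 1) * w t * e) \<le> \<epsilon> * M * exp R"
      unfolding norm_mult using q[OF that(1)] t0(2)[OF that(1)] that(2) eps
      by (intro mult_mono) (auto simp: M_def)
    then show ?thesis by (simp add: K_def norm_divide)
  qed
  have A: "norm (A t - \<alpha>) \<le> K * R" if "norm t \<le> R" for t
  proof -
    have "norm (A t - A 0) \<le> K * norm (t - 0)"
    proof (rule field_differentiable_bound[of "cball 0 R" A "\<lambda>t. (q t - 1) * w t * exp (- t) / 2"])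
      show "(A has_field_derivative (q t - 1) * w t * exp (- t) / 2) (at t within cball 0 R)" if "t \<in> cball 0 R" for t
        by (rule has_field_derivative_at_within, rule A') (use that in simp)
      show "norm ((q t - 1) * w t * exp (- t) / 2) \<le> K" if "t \<in> cball 0 R" for t
        using that bnd[of t "exp (- t)"] ex[of t] by simp
    qed (use that R in auto)
    also have "\<dots> \<le> K * R" using that K0 by (auto intro: mult_left_mono)
    finally show ?thesis by (simp add: A_def \<alpha>_def)
  qed
  have B: "norm (B t - \<beta>) \<le> K * R" if "norm t \<le> R" for t
  proof -
    have "norm (B t - B 0) \<le> K * norm (t - 0)"
    proof (rule field_differentiable_bound[of "cball 0 R" B "\<lambda>t. - ((q t - 1) * w t * exp t / 2)"])
      show "(B has_field_derivative - ((q t - 1) * w t * exp t / 2)) (at t within cball 0 R)" if "t \<in> cball 0 R" for t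
        by (rule has_field_derivative_at_within, rule B') (use that in simp)
      show "norm (- ((q t - 1) * w t * exp t / 2)) \<le> K" if "t \<in> cball 0 R" for t
        using that bnd[of t "exp t"] ex[of t] by simp
    qed (use that R in auto)
    also have "\<dots> \<le> K * R" using that K0 by (auto intro: mult_left_mono)
    finally show ?thesis by (simp add: B_def \<beta>_def)
  qed
  have diff: "norm (w t - (\<alpha> * exp t + \<beta> * exp (- t))) \<le> R * \<epsilon> * M * exp (2 * R)"
    if "norm t \<le> R" for t
  proof -
    have "w t - (\<alpha> * exp t + \<beta> * exp (- t)) = (A t - \<alpha>) * exp t + (B t - \<beta>) * exp (- t)"
      unfolding A_def B_def by (simp add: exp_minus field_simps)
    also have "norm \<dots> \<le> (K * R) * exp R + (K * R) * exp R"
      using A[OF that] B[OF that] ex[OF that] K0 R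
      by (intro order_trans[OF norm_triangle_ineq] add_mono) (auto simp: norm_mult intro!: mult_mono)
    also have "\<dots> = R * \<epsilon> * M * exp (2 * R)"
      unfolding K_def by (simp add: exp_double power2_eq_square)
    finally show ?thesis .
  qed
  \<comment> \<open>The maximum \<open>M\<close> of |w| is estimated by itself: the smallness
    hypothesis lets the error count for at most \<open>M / 2\<close>, which is absorbed on the
    left.\<close>
  have "M \<le> norm (\<alpha> * exp t0 + \<beta> * exp (- t0)) + R * \<epsilon> * M * exp (2 * R)"
    unfolding M_def using norm_triangle_sub[of "w t0" "\<alpha> * exp t0 + \<beta> * exp (- t0)"] diff[OF t0(1)]
    unfolding M_def by linarith
  also have "norm (\<alpha> * exp t0 + \<beta> * exp (- t0)) \<le> norm \<alpha> * exp R + norm \<beta> * exp R"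
    using ex[OF t0(1)]
    by (intro order_trans[OF norm_triangle_ineq] add_mono) (auto simp: norm_mult intro!: mult_mono)
  also have "R * \<epsilon> * M * exp (2 * R) \<le> M / 2"
    using mult_right_mono[OF small, of M] by (simp add: M_def mult_ac)
  finally have "M \<le> 2 * (N * exp R)" unfolding N_def by (simp add: algebra_simps)
  then have "R * \<epsilon> * exp (2 * R) * M \<le> R * \<epsilon> * exp (2 * R) * (2 * (N * exp R))"
    using R eps by (intro mult_left_mono) auto
  with diff[OF t] have "norm (w t - (\<alpha> * exp t + \<beta> * exp (- t)))
      \<le> 2 * R * \<epsilon> * (exp (2 * R) * exp R) * N" by (simp add: mult_ac)
  also have "exp (2 * R) * exp R = exp (3 * R)" by (simp add: mult_exp_exp)
  finally show ?thesis unfolding N_def .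
qed

text \<open>The constants are not optimised; the radius \<open>5\<close> is large enough to contain \<open>\<plusminus> i \<pi>\<close> and
  the logarithms occurring in \<open>wkb_asymptotics\<close>.\<close>

lemma perturbed_exp_zero:
  fixes w w' q :: "complex \<Rightarrow> complex"
  defines "\<alpha> \<equiv> (w 0 + w' 0) / 2" and "\<beta> \<equiv> (w 0 - w' 0) / 2"
  assumes w: "\<And>t. norm t \<le> 6 \<Longrightarrow> (w has_field_derivative w' t) (at t)"
    and w': "\<And>t. norm t \<le> 6 \<Longrightarrow> (w' has_field_derivative q t * w t) (at t)"
    and q: "\<And>t. norm t \<le> 6 \<Longrightarrow> norm (q t - 1) \<le> exp (- 40)"
    and nz: "w 0 \<noteq> 0 \<or> w' 0 \<noteq> 0"
    and s: "norm s \<le> 5" "\<alpha> * exp s + \<beta> * exp (- s) = 0"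
  obtains t where "norm (t - s) < 1 / 4" "w t = 0"
proof -
  define N where "N = norm \<alpha> + norm \<beta>"
  have N: "N > 0"
  proof -
    have "\<alpha> \<noteq> 0 \<or> \<beta> \<noteq> 0"
    proof -
      have "\<alpha> + \<beta> = w 0" "\<alpha> - \<beta> = w' 0" unfolding \<alpha>_def \<beta>_def by (simp_all add: field_simps)
      then show ?thesis using nz by auto
    qed
    then show ?thesis unfolding N_def by (auto simp: add_pos_nonneg add_nonneg_pos)
  qed
  define w0 where "w0 t = \<alpha> * exp t + \<beta> * exp (- t)" for t
  have e2: "(2::real) ^ n \<le> exp (real n)" for n
    using exp_ge_add_one_self[of 1] power_mono[of 2 "exp 1 :: real" n]
    by (simp add: exp_of_nat_mult[symmetric])
  have err: "norm (w t - w0 t) \<le> 12 * exp (- 22) * N" if "norm t \<le> 6" for t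
  proof -
    have "6 * exp (- 40) * exp (2 * 6) = 6 * exp (- 28 :: real)" by (simp add: exp_add[symmetric])
    also have "\<dots> \<le> 6 * (1 / 2 ^ 28)"
    proof -
      have "exp (- 28 :: real) \<le> 1 / 2 ^ 28"
        using e2[of 28] by (subst exp_minus) (simp add: field_simps)
      then show ?thesis by simp
    qed
    also have "\<dots> \<le> 1 / 2" by simp
    finally have small: "6 * exp (- 40) * exp (2 * 6) \<le> (1 / 2 :: real)" .
    have "norm (w t - w0 t) \<le> 2 * 6 * exp (- 40) * exp (3 * 6) * N"
      unfolding w0_def N_def \<alpha>_def \<beta>_def
      by (rule exp_comparison[OF w w' q _ small that]) auto
    then show ?thesis by (simp add: exp_add[symmetric] mult_ac)
  qed
  \<comment> \<open>At a zero \<open>s\<close> of the model its two terms cancel, so at s + u it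
    equals \<alpha> e^s e^{-u} (e^{2u} - 1). On |u| = 1/4 the three moduli are at least N e^{-5} /
    2, e^{-1} and 1/2 - 42/100 = 2/25.\<close>
  have big: "norm (w0 t) \<ge> N * exp (- 6) / 25" if "norm (t - s) = 1 / 4" for t
  proof -
    define u where "u = t - s"
    have u: "norm u = 1 / 4" and t: "t = s + u" using that unfolding u_def by auto
    have "w0 t = \<alpha> * exp s * exp u + \<beta> * exp (- s) * exp (- u)"
      unfolding w0_def t by (simp add: exp_add exp_diff exp_minus field_simps)
    also have "\<beta> * exp (- s) = - (\<alpha> * exp s)" using s(2) by (simp add: add_eq_0_iff)
    also have "\<alpha> * exp s * exp u + - (\<alpha> * exp s) * exp (- u) = \<alpha> * exp s * (exp (- u) * (exp (2 * u) - 1))"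
      by (simp add: algebra_simps mult_exp_exp)
    finally have w0: "norm (w0 t) = norm (\<alpha> * exp s) * (norm (exp (- u)) * norm (exp (2 * u) - 1))"
      by (simp add: norm_mult)
    have eq: "norm (\<alpha> * exp s) = norm (\<beta> * exp (- s))"
      using s(2) by (metis add_eq_0_iff norm_minus_cancel)
    have e5: "exp (- 5) \<le> norm (exp s)" "exp (- 5) \<le> norm (exp (- s))"
      using s(1) abs_Re_le_cmod[of s] by (auto simp: norm_exp_eq_Re)
    have "norm \<alpha> * exp (- 5) \<le> norm (\<alpha> * exp s)" "norm \<beta> * exp (- 5) \<le> norm (\<beta> * exp (- s))"
      unfolding norm_mult using e5 by (intro mult_left_mono; simp)+
    then have 1: "N * exp (- 5) / 2 \<le> norm (\<alpha> * exp s)" unfolding N_def using eq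
      by (simp add: algebra_simps)
    have 2: "exp (- 1) \<le> norm (exp (- u))"
      using u abs_Re_le_cmod[of u] by (simp add: norm_exp_eq_Re)
    have "norm (exp (2 * u) - (\<Sum>k\<le>1. (2 * u) ^ k / fact k))
            \<le> exp \<bar>Re (2 * u)\<bar> * norm (2 * u) ^ Suc 1 / fact 1"
      by (rule Taylor_exp)
    then have "norm (exp (2 * u) - 1 - 2 * u) \<le> exp \<bar>Re (2 * u)\<bar> / 4"
      using u by (simp add: norm_mult power2_eq_square diff_diff_eq)
    also have "exp \<bar>Re (2 * u)\<bar> \<le> exp (1 / 2)" using u abs_Re_le_cmod[of u] by simp
    also have "exp (1 / 2 :: real) \<le> 42 / 25"
    proof -
      have "(exp (1 / 2 :: real))\<^sup>2 = exp 1" by (simp add: exp_double[symmetric])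
      also have "\<dots> \<le> (42 / 25)\<^sup>2" using e_less_272 by (simp add: power2_eq_square)
      finally show ?thesis by (rule power2_le_imp_le) simp
    qed
    finally have "norm (exp (2 * u) - 1 - 2 * u) \<le> 42 / 100" by simp
    moreover have "norm (2 * u) = 1 / 2" using u by (simp add: norm_mult)
    ultimately have 3: "2 / 25 \<le> norm (exp (2 * u) - 1)"
      using norm_triangle_sub[of "2 * u" "exp (2 * u) - 1"]
      by (simp add: norm_minus_commute)
    have "N * exp (- 5) / 2 * (exp (- 1) * (2 / 25)) \<le> norm (w0 t)"
      unfolding w0 using 1 2 3 N by (intro mult_mono) auto
    then show ?thesis by (simp add: mult_exp_exp)
  qed
  have w0s: "w0 s = 0" using s(2) unfolding w0_def .
  \<comment> \<open>The tolerance \<open>exp (- 40)\<close> is made for this comparison: the error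
    12 e^{-22} occurs once at the centre and once on the circle, and e^16 > 600 keeps the total
    below the bound on the circle.\<close>
  have cmp: "24 * exp (- 22) * N < N * exp (- 6) / 25"
  proof -
    have "(600::real) < 2 ^ 16" by simp
    also have "\<dots> \<le> exp 16" using e2[of 16] by simp
    finally have "600 * exp (- 22) < exp 16 * exp (- 22 :: real)" by simp
    then have "600 * exp (- 22) < exp (- 6 :: real)" by (simp add: mult_exp_exp)
    then show ?thesis using N by (simp add: field_simps)
  qed
  have n6: "norm t \<le> 6" if "norm (t - s) \<le> 1 / 4" for t
    using norm_triangle_sub[of t s] that s(1) by linarith
  have cont: "continuous_on (cball s (1 / 4)) w"
    by (rule DERIV_continuous_on[of _ w w'], rule has_field_derivative_at_within, rule w, rule n6)
       (simp add: dist_norm norm_minus_commute)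
  have hol: "w holomorphic_on ball s (1 / 4)"
    unfolding holomorphic_on_def field_differentiable_def
    by (intro ballI exI, rule has_field_derivative_at_within, rule w, rule n6)
       (auto simp: dist_norm norm_minus_commute)
  \<comment> \<open>Minimum modulus principle: a holomorphic function that is smaller at the centre
    than everywhere on the circle vanishes inside.\<close>
  obtain t where "t \<in> ball s (1 / 4)" "w t = 0"
  proof (rule holomorphic_contract_to_zero[OF cont hol])
    fix t assume "norm (s - t) = 1 / 4"
    then have t: "norm (t - s) = 1 / 4" by (simp add: norm_minus_commute)
    have "norm (w s) \<le> 12 * exp (- 22) * N" using err[of s] w0s s by simp
    moreover have "norm (w0 t) - 12 * exp (- 22) * N \<le> norm (w t)"
      using err[OF n6, of t] t norm_triangle_ineq2[of "w0 t" "w t"]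
      by (simp add: norm_minus_commute)
    ultimately show "norm (w s) < norm (w t)" using big[OF t] cmp by linarith
  qed auto
  then show ?thesis using that by (simp add: dist_norm norm_minus_commute)
qed

section \<open>Local comparison at the scale 1/g\<close>

lemma exp_bounds:
  fixes y :: complex assumes "norm y \<le> 1"
  shows "norm (exp y - 1) \<le> 3 * norm y" "norm (exp y - 1 - y) \<le> 3 * (norm y)\<^sup>2" "norm (exp y) \<le> 3"
proof -
  have e: "exp \<bar>Re y\<bar> \<le> 3"
    using abs_Re_le_cmod[of y] assms exp_le by (meson exp_le_cancel_iff order_trans)
  then have b: "exp \<bar>Re y\<bar> * norm y ^ n \<le> 3 * norm y ^ n" for n by (intro mult_right_mono) auto
  show "norm (exp y - 1) \<le> 3 * norm y"
    using Taylor_exp[of y 0] b[of 1] by simp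
  show "norm (exp y - 1 - y) \<le> 3 * (norm y)\<^sup>2"
    using Taylor_exp[of y 1] b[of 2] by (simp add: diff_diff_eq power2_eq_square)
  have "exp (Re y) \<le> exp \<bar>Re y\<bar>" by simp
  then show "norm (exp y) \<le> 3" using e unfolding norm_exp_eq_Re by linarith
qed

text \<open>The asymptotics are uniform in \<open>Im z\<close>, so zeros may be followed in vertical
  directions. The locale serves the right end of the Hill equation and, after reflection, the left
  end with \<open>l\<close> in the role of \<open>\<kappa>\<close>.\<close>

locale wkb =
  fixes Q f f' :: "complex \<Rightarrow> complex" and a :: complex and \<kappa> :: real
  assumes sol: "ode_sol Q f f'" and Q_cont: "continuous_on UNIV Q" and nontriv: "\<exists>z. f z \<noteq> 0"
    and a_nz: "a \<noteq> 0" and \<kappa>_pos: "\<kappa> > 0"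
    and asym: "\<And>\<epsilon>. \<epsilon> > 0 \<Longrightarrow>
      \<exists>r. \<forall>z. Re z \<ge> r \<longrightarrow> norm (Q z / (a * exp (of_real (\<kappa> / 2) * z))\<^sup>2 - 1) \<le> \<epsilon>"
begin

definition g :: "complex \<Rightarrow> complex" where "g z = a * exp (of_real (\<kappa> / 2) * z)"

lemma g_nz [simp]: "g z \<noteq> 0" by (simp add: g_def a_nz)

lemma norm_g: "norm (g z) = norm a * exp (\<kappa> / 2 * Re z)"
  by (simp add: g_def norm_mult norm_exp_eq_Re)

lemma g_add: "g (z + w) = g z * exp (of_real (\<kappa> / 2) * w)"
  by (simp add: g_def exp_add ring_distribs)

lemma norm_g_ge_iff: "norm (g z) \<ge> norm a * exp (\<kappa> / 2 * r) \<longleftrightarrow> Re z \<ge> r"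
  using a_nz \<kappa>_pos by (simp add: norm_g)

lemma g_large: "\<exists>r. \<forall>z. Re z \<ge> r \<longrightarrow> norm (g z) \<ge> C"
proof (intro exI allI impI)
  fix z assume z: "Re z \<ge> 2 / \<kappa> * (\<bar>C\<bar> / norm a)"
  have "C \<le> norm a * (\<bar>C\<bar> / norm a)" using a_nz by simp
  also have "\<dots> \<le> norm a * exp (\<bar>C\<bar> / norm a)"
  proof (rule mult_left_mono)
    show "\<bar>C\<bar> / norm a \<le> exp (\<bar>C\<bar> / norm a)"
      using exp_ge_add_one_self[of "\<bar>C\<bar> / norm a"] by linarith
  qed auto
  also have "\<dots> \<le> norm a * exp (\<kappa> / 2 * Re z)"
    using z \<kappa>_pos a_nz by (auto intro!: mult_left_mono simp: field_simps)
  finally show "C \<le> norm (g z)" by (simp add: norm_g)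
qed

lemma f_or_f'_nz: "f z \<noteq> 0 \<or> f' z \<noteq> 0"
  using ode_unique[OF sol Q_cont] nontriv by blast

text \<open>The variable \<open>t = g z \<cdot> (w - z)\<close> turns the equation near \<open>z\<close> into a small
  perturbation of \<open>w'' = w\<close>; moreover \<open>2/\<kappa> \<cdot> g\<close> is a primitive of \<open>g\<close>, so it increases by about
  \<open>t\<close>.\<close>

lemma rescaling:
  "\<exists>r. \<forall>z t. Re z \<ge> r \<and> norm t \<le> 6 \<longrightarrow>
     norm (Q (z + t / g z) / (g z)\<^sup>2 - 1) \<le> exp (- 40) \<and>
     norm (t / g z) \<le> 1 \<and> norm (2 / \<kappa> * g (z + t / g z) - 2 / \<kappa> * g z - t) \<le> 1 / 4
     \<and> norm (g z) \<ge> \<kappa>"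
proof -
  define \<delta> :: real where "\<delta> = exp (- 40) / 6"
  have \<delta>: "\<delta> > 0" "\<delta> \<le> 1 / 6" unfolding \<delta>_def by auto
  obtain r1 where r1: "\<And>z. Re z \<ge> r1 \<Longrightarrow> norm (Q z / (g z)\<^sup>2 - 1) \<le> \<delta>"
    using asym[OF \<delta>(1)] unfolding g_def by blast
  obtain r2 where r2: "\<And>z. Re z \<ge> r2 \<Longrightarrow> norm (g z) \<ge> 216 * \<kappa> / \<delta> + 6"
    using g_large by blast
  show ?thesis
  proof (intro exI allI impI)
    fix z t :: complex assume *: "max (r1 + 1) r2 \<le> Re z \<and> norm t \<le> 6"
    have g: "norm (g z) \<ge> 216 * \<kappa> / \<delta> + 6" using r2 * by auto
    have gpos: "norm (g z) > 0" by simp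
    have "216 * \<kappa> \<le> 216 * \<kappa> / \<delta>" using \<delta> \<kappa>_pos by (simp add: pos_le_divide_eq)
    then have g1: "norm (g z) \<ge> 216 * \<kappa>" "norm (g z) \<ge> 6" using g \<kappa>_pos by auto
    have "0 < 216 * \<kappa> / \<delta>" using \<kappa>_pos \<delta> by simp
    then have g6: "norm (g z) \<ge> 6" using g by linarith
    have t1: "norm (t / g z) \<le> 1" using * g6 gpos by (simp add: norm_divide divide_le_eq)
    have re: "Re (z + t / g z) \<ge> r1" using * t1 abs_Re_le_cmod[of "t / g z"] by auto
    define y where "y = of_real (\<kappa> / 2) * (t / g z)"
    have ny: "norm y = \<kappa> / 2 * norm t / norm (g z)"
      using \<kappa>_pos by (simp add: y_def norm_mult norm_divide)
    have ny1: "norm y \<le> 3 * \<kappa> / norm (g z)"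
      unfolding ny using * \<kappa>_pos by (intro divide_right_mono) auto
    have "3 * \<kappa> / norm (g z) \<le> \<delta> / 72"
      using g gpos \<delta> \<kappa>_pos by (simp add: field_simps) 
    then have ny2: "norm y \<le> \<delta> / 72" using ny1 by linarith
    then have y1: "norm y \<le> 1" "norm (2 * y) \<le> 1" using \<delta> by (auto simp: norm_mult)
    have gy: "g (z + t / g z) = g z * exp y" by (simp add: g_add y_def)
    define \<eta> where "\<eta> = Q (z + t / g z) / (g (z + t / g z))\<^sup>2 - 1"
    have \<eta>: "norm \<eta> \<le> \<delta>" using r1[OF re] unfolding \<eta>_def .
    have "Q (z + t / g z) = (1 + \<eta>) * (g (z + t / g z))\<^sup>2" unfolding \<eta>_def by simp
    then have "Q (z + t / g z) = ((1 + \<eta>) * exp (2 * y)) * (g z)\<^sup>2"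
      by (simp add: gy power_mult_distrib exp_double)
    then have "Q (z + t / g z) / (g z)\<^sup>2 = (1 + \<eta>) * exp (2 * y)" by simp
    then have "Q (z + t / g z) / (g z)\<^sup>2 - 1 = (exp (2 * y) - 1) + \<eta> * exp (2 * y)"
      by (simp add: algebra_simps)
    also have "norm \<dots> \<le> 3 * norm (2 * y) + \<delta> * 3"
      using exp_bounds[OF y1(2)] \<eta> \<delta>
      by (intro order_trans[OF norm_triangle_ineq] add_mono) (auto simp: norm_mult intro!: mult_mono)
    also have "\<dots> \<le> \<delta> * 6" using ny2 \<delta>(1) unfolding norm_mult by simp
    also have "\<dots> = exp (- 40)" by (simp add: \<delta>_def)
    finally have A: "norm (Q (z + t / g z) / (g z)\<^sup>2 - 1) \<le> exp (- 40)" .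
    have "2 / \<kappa> * g z * y = t" using \<kappa>_pos by (simp add: y_def)
    moreover have "c * (g z * exp y) - c * g z - c * g z * y = c * g z * (exp y - 1 - y)" for c
      by (simp add: algebra_simps)
    ultimately have "2 / \<kappa> * g (z + t / g z) - 2 / \<kappa> * g z - t = 2 / \<kappa> * g z * (exp y - 1 - y)"
      unfolding gy by metis
    also have "norm \<dots> = 2 / \<kappa> * norm (g z) * norm (exp y - 1 - y)"
      using \<kappa>_pos by (simp add: norm_mult norm_divide)
    also have "\<dots> \<le> 2 / \<kappa> * norm (g z) * (3 * (norm y)\<^sup>2)"
      using exp_bounds(2)[OF y1(1)] \<kappa>_pos by (intro mult_left_mono) auto
    also have "\<dots> \<le> 2 / \<kappa> * norm (g z) * (3 * (3 * \<kappa> / norm (g z))\<^sup>2)"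
      using ny1 \<kappa>_pos by (intro mult_left_mono power_mono) auto
    also have "\<dots> = 54 * \<kappa> / norm (g z)" using \<kappa>_pos by (simp add: power2_eq_square field_simps)
    also have "\<dots> \<le> 1 / 4" using g1 gpos by (simp add: field_simps)
    finally have B: "norm (2 / \<kappa> * g (z + t / g z) - 2 / \<kappa> * g z - t) \<le> 1 / 4" .
    from A B t1 g1 \<kappa>_pos show "norm (Q (z + t / g z) / (g z)\<^sup>2 - 1) \<le> exp (- 40) \<and>
     norm (t / g z) \<le> 1 \<and> norm (2 / \<kappa> * g (z + t / g z) - 2 / \<kappa> * g z - t) \<le> 1 / 4
     \<and> norm (g z) \<ge> \<kappa>" by auto
  qed
qed

text \<open>One threshold is fixed for the whole locale, because the chain of zeros applies the
  rescaling infinitely often with the same bound.\<close>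

definition r0 :: real where
  "r0 = (SOME r. \<forall>z t. Re z \<ge> r \<and> norm t \<le> 6 \<longrightarrow>
     norm (Q (z + t / g z) / (g z)\<^sup>2 - 1) \<le> exp (- 40) \<and>
     norm (t / g z) \<le> 1 \<and> norm (2 / \<kappa> * g (z + t / g z) - 2 / \<kappa> * g z - t) \<le> 1 / 4
     \<and> norm (g z) \<ge> \<kappa>)"

lemma r0:
  assumes "Re z \<ge> r0" "norm t \<le> 6"
  shows "norm (Q (z + t / g z) / (g z)\<^sup>2 - 1) \<le> exp (- 40)" "norm (t / g z) \<le> 1"
    "norm (2 / \<kappa> * g (z + t / g z) - 2 / \<kappa> * g z - t) \<le> 1 / 4" "norm (g z) \<ge> \<kappa>"
  using someI_ex[OF rescaling] assms unfolding r0_def[symmetric] by blast+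

text \<open>In the variable t, the model solution with the Cauchy data of \<open>f\<close> at
  \<open>z\<close> is half of (f + f'/g) e^t + (f - f'/g) e^{-t}. Its zeros within radius 5 persist
  up to a displacement of 1/4.\<close>

lemma nearby_zero:
  assumes z: "Re z \<ge> r0" and s: "norm s \<le> 5"
    and eq: "(f z + f' z / g z) * exp s + (f z - f' z / g z) * exp (- s) = 0"
  obtains t where "norm (t - s) < 1 / 4" "f (z + t / g z) = 0"
proof -
  define w where "w t = f (z + t / g z)" for t
  define w' where "w' t = f' (z + t / g z) / g z" for t
  define q where "q t = Q (z + t / g z) / (g z)\<^sup>2" for t
  have d: "((\<lambda>t. z + t / g z) has_field_derivative 1 / g z) (at t)" for t
    by (auto intro!: derivative_eq_intros)
  have 1: "(w has_field_derivative w' t) (at t)" for t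
    unfolding w_def w'_def using DERIV_chain2[OF ode_solD(1)[OF sol] d] by simp
  have 2: "(w' has_field_derivative q t * w t) (at t)" for t
    unfolding w_def w'_def q_def
    by (rule DERIV_cong, rule DERIV_cdivide, rule DERIV_chain2[OF ode_solD(2)[OF sol] d])
       (simp add: power2_eq_square mult_ac)
  have 3: "norm (q t - 1) \<le> exp (- 40)" if "norm t \<le> 6" for t
    unfolding q_def by (rule r0(1)[OF z that])
  have 4: "w 0 \<noteq> 0 \<or> w' 0 \<noteq> 0" unfolding w_def w'_def using f_or_f'_nz by auto
  have 5: "(w 0 + w' 0) / 2 * exp s + (w 0 - w' 0) / 2 * exp (- s) = 0"
    using eq unfolding w_def w'_def by (simp add: add_divide_distrib[symmetric])
  obtain t where "norm (t - s) < 1 / 4" "w t = 0"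
    by (rule perturbed_exp_zero[OF 1 2 3 4 s 5])
  then show ?thesis using that unfolding w_def by blast
qed

text \<open>At a zero of \<open>f\<close> the model is a multiple of sinh, whose neighbouring zeros
  are i pi and - i pi. The error 1/2 adds the displacement of the zero and the nonlinearity of the
  primitive, 1/4 each; the 5 leaves room for pi + 1/4.\<close>

lemma next_zero:
  assumes z: "Re z \<ge> r0" "f z = 0" and \<tau>: "\<tau> = 1 \<or> \<tau> = (- 1 :: real)"
  obtains z' where "f z' = 0" "norm (z' - z) \<le> 5 / norm (g z)"
    "norm (2 / \<kappa> * g z' - 2 / \<kappa> * g z - \<i> * of_real (\<tau> * pi)) \<le> 1 / 2"
proof -
  define s where "s = \<i> * of_real (\<tau> * pi)"
  have "exp s = - 1" "exp (- s) = - 1"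
    using \<tau> by (auto simp: s_def exp_minus)
  then have eq: "(f z + f' z / g z) * exp s + (f z - f' z / g z) * exp (- s) = 0"
    using z by simp
  have ns: "norm s = pi" using \<tau> by (auto simp: s_def norm_mult)
  have s: "norm s \<le> 5" unfolding ns using pi_less_4 by simp
  obtain t where t: "norm (t - s) < 1 / 4" "f (z + t / g z) = 0"
    by (rule nearby_zero[OF z(1) s eq])
  have nt: "norm t \<le> 5" using norm_triangle_sub[of t s] t(1) ns pi_less_4 by linarith
  show ?thesis
  proof (rule that[OF t(2)])
    show "norm (z + t / g z - z) \<le> 5 / norm (g z)"
      using nt by (simp add: norm_divide divide_right_mono)
    have "norm (2 / \<kappa> * g (z + t / g z) - 2 / \<kappa> * g z - t) \<le> 1 / 4" using r0(3)[OF z(1)] nt by simp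
    then have "norm ((2 / \<kappa> * g (z + t / g z) - 2 / \<kappa> * g z - t) + (t - s)) \<le> 1 / 4 + 1 / 4"
      using t(1) by (intro order_trans[OF norm_triangle_ineq] add_mono) auto
    moreover have "(2 / \<kappa> * g (z + t / g z) - 2 / \<kappa> * g z - t) + (t - s) = 2 / \<kappa> * g (z + t / g z) - 2 / \<kappa> * g z - s"
      by simp
    ultimately have "norm (2 / \<kappa> * g (z + t / g z) - 2 / \<kappa> * g z - s) \<le> 1 / 4 + 1 / 4"
      by metis
    then show "norm (2 / \<kappa> * g (z + t / g z) - 2 / \<kappa> * g z - \<i> * of_real (\<tau> * pi)) \<le> 1 / 2"
      unfolding s_def[symmetric] by simp
  qed
qed

text \<open>By \<open>next_zero\<close>, each zero far to the right has a neighbour at which the primitive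
  \<open>S\<close> of \<open>g\<close> is larger by about \<open>i \<pi>\<close> or, if \<open>\<tau> = - 1\<close>, by about \<open>- i \<pi>\<close>.  The sign is the one
  for which \<open>|Re S| + |Im S|\<close> grows, so the chain of neighbours stays to the right, and since \<open>S\<close> is
  exponential the zeros run off to infinity only logarithmically.\<close>

lemma zero_chain:
  assumes z: "Re z \<ge> r0 + 2" "norm (g z) \<ge> 2 * norm a * exp (\<kappa> / 2 * r0)" "f z = 0"
  obtains c where "\<And>n. f (c n) = 0" "inj c" "\<And>n. norm (c n) \<le> norm z + 40 / \<kappa> * ln (real n + 1)"
proof -
  define S where "S w = 2 / \<kappa> * g w" for w
  define \<tau> :: real where "\<tau> = (if Im (S z) \<ge> 0 then 1 else - 1)"
  have \<tau>: "\<tau> = 1 \<or> \<tau> = - 1" unfolding \<tau>_def by auto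
  define N where "N w = \<bar>Re (S w)\<bar> + \<tau> * Im (S w)" for w
  define P where "P n w \<longleftrightarrow> f w = 0 \<and> \<tau> * Im (S w) \<ge> 0 \<and> N w \<ge> N z + real n" for n :: nat and w
  define R where "R w w' \<longleftrightarrow> \<tau> * Im (S w') \<ge> \<tau> * Im (S w) + 2 \<and> norm (w' - w) \<le> 5 / norm (g w)" for w w'
  have gS: "norm (g w) = \<kappa> / 2 * norm (S w)" for w
    using \<kappa>_pos by (simp add: S_def norm_mult norm_divide)
  have NS: "N w \<le> 2 * norm (S w)" for w
    using abs_Re_le_cmod[of "S w"] abs_Im_le_cmod[of "S w"] \<tau> unfolding N_def by auto
  have SN: "norm (S z) \<le> N z"
    using cmod_le[of "S z"] unfolding N_def \<tau>_def by (auto split: if_splits)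
  have "norm (g z) \<ge> \<kappa>" by (rule r0(4)[of _ 0]) (use z in auto)
  then have "norm (S z) \<ge> 1" using \<kappa>_pos unfolding gS by (simp add: field_simps)
  then have N1: "N z \<ge> 1" using SN by linarith
  have P_g: "norm (g w) \<ge> \<kappa> / 4 * (N z + real n)" if "P n w" for n w
    using that NS[of w] \<kappa>_pos unfolding P_def gS by simp
  \<comment> \<open>Since |S| \<le> N at \<open>z\<close> but only N \<le> 2|S| at \<open>w\<close>,
    the modulus of \<open>g\<close> may drop to half its value at \<open>z\<close>; the factor 2 in
    the hypothesis on \<open>g z\<close> compensates for this.\<close>
  have P_Re: "Re w \<ge> r0" if "P n w" for n w
  proof -
    have "2 * norm (g w) \<ge> \<kappa> / 2 * N z"
      using P_g[OF that] \<kappa>_pos by (simp add: algebra_simps) (smt (verit) mult_nonneg_nonneg of_nat_0_le_iff)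
    also have "\<kappa> / 2 * N z \<ge> norm (g z)" unfolding gS using SN \<kappa>_pos by simp
    finally have "norm (g w) \<ge> norm a * exp (\<kappa> / 2 * r0)" using z(2) by simp
    then show ?thesis by (simp only: norm_g_ge_iff)
  qed
  have step: "\<exists>w'. P (Suc n) w' \<and> R w w'" if P: "P n w" for n w
  proof -
    obtain w' where w': "f w' = 0" "norm (w' - w) \<le> 5 / norm (g w)"
      "norm (S w' - S w - \<i> * of_real (\<tau> * pi)) \<le> 1 / 2"
      unfolding S_def using next_zero[OF P_Re[OF P] _ \<tau>] P unfolding P_def by blast
    have "\<bar>Re (S w') - Re (S w)\<bar> \<le> 1 / 2" "\<bar>Im (S w') - Im (S w) - \<tau> * pi\<bar> \<le> 1 / 2"
      using w'(3) abs_Re_le_cmod[of "S w' - S w - \<i> * of_real (\<tau> * pi)"]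
        abs_Im_le_cmod[of "S w' - S w - \<i> * of_real (\<tau> * pi)"] by auto
    moreover have "\<tau> * Im (S w') \<ge> \<tau> * Im (S w) + pi - 1 / 2"
    proof -
      have "Im (S w') - Im (S w) - \<tau> * pi \<le> 1 / 2" "- (Im (S w') - Im (S w) - \<tau> * pi) \<le> 1 / 2"
        using calculation(2) by linarith+
      then show ?thesis using \<tau> by auto
    qed
    \<comment> \<open>The imaginary part gains at least pi - 1/2 in the direction of
      \<open>\<tau>\<close>, while |Re S| loses at most 1/2.\<close>
    ultimately have "\<tau> * Im (S w') \<ge> \<tau> * Im (S w) + 2" "N w' \<ge> N w + 1"
      using pi_gt3 unfolding N_def by linarith+
    then show ?thesis using w' P unfolding P_def R_def by (auto intro!: exI[of _ w'])
  qed
  have "P 0 z" unfolding P_def using z by (auto simp: \<tau>_def)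
  with step obtain c where c: "\<And>n. P n (c n)" "\<And>n. R (c n) (c (Suc n))" "c 0 = z"
    using dependent_nat_choice[of "\<lambda>n w. P n w \<and> (n = 0 \<longrightarrow> w = z)" "\<lambda>n. R"] by (metis nat.distinct(1))
  show ?thesis
  proof (rule that)
    show "f (c n) = 0" for n using c(1) unfolding P_def by blast
    have "strict_mono (\<lambda>n. \<tau> * Im (S (c n)))"
      unfolding strict_mono_Suc_iff using c(2) unfolding R_def by (smt (verit))
    then show "inj c"
      by (metis (mono_tags, lifting) injI strict_mono_eq)
    show "norm (c n) \<le> norm z + 40 / \<kappa> * ln (real n + 1)" for n
    proof (induction n)
      case 0 then show ?case using c(3) by simp
    next
      case (Suc n)
      have "\<kappa> / 4 * (real n + 1) \<le> \<kappa> / 4 * (N z + real n)" using N1 \<kappa>_pos by simp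
      then have "norm (g (c n)) \<ge> \<kappa> / 4 * (real n + 1)" using P_g[OF c(1), of n] by linarith
      then have "5 / norm (g (c n)) \<le> 5 / (\<kappa> / 4 * (real n + 1))"
        using \<kappa>_pos by (intro divide_left_mono) auto
      also have "\<dots> = 20 / \<kappa> * (1 / (real n + 1))" using \<kappa>_pos by (simp add: field_simps)
      \<comment> \<open>The n-th step has length of order 1/(n + 1); a bound by a difference of
        logarithms makes the steps telescope.\<close>
      also have "\<dots> \<le> 20 / \<kappa> * (2 * (ln (real n + 2) - ln (real n + 1)))"
      proof (rule mult_left_mono)
        have "1 / (real n + 1) \<le> 2 * (1 / (real n + 2))" by (simp add: field_simps)
        also have "1 / (real n + 2) \<le> ln (real n + 2) - ln (real n + 1)"
          using ln_diff_le[of "real n + 1" "real n + 2"] by (simp add: field_simps)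
        finally show "1 / (real n + 1) \<le> 2 * (ln (real n + 2) - ln (real n + 1))" by simp
      qed (use \<kappa>_pos in simp)
      finally have "norm (c (Suc n) - c n) \<le> 20 / \<kappa> * (2 * (ln (real n + 2) - ln (real n + 1)))"
        using c(2)[of n] unfolding R_def by linarith
      then have "norm (c (Suc n)) \<le> norm (c n) + 40 / \<kappa> * (ln (real n + 2) - ln (real n + 1))"
        using norm_triangle_sub[of "c (Suc n)" "c n"] by simp
      with Suc show ?case by (simp add: algebra_simps)
    qed
  qed
qed

text \<open>Along a chain whose moduli grow like log n, every sum of |c n|^{-s} diverges: log(n + 1)
  is at most s (n + 1)^{1/s}, so the terms dominate a multiple of the harmonic series.\<close>

lemma no_zeros_far_right:
  assumes s: "s > 0" and summ: "(\<lambda>z. 1 / norm z powr s) summable_on {z. z \<noteq> 0 \<and> f z = 0}"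
  shows "\<exists>r. \<forall>z. Re z \<ge> r \<longrightarrow> f z \<noteq> 0"
proof (rule ccontr)
  assume neg: "\<not> ?thesis"
  obtain r where r: "\<And>z. Re z \<ge> r \<Longrightarrow> norm (g z) \<ge> 2 * norm a * exp (\<kappa> / 2 * r0)"
    using g_large by blast
  obtain z where z: "Re z \<ge> max r (r0 + 2)" "f z = 0"
    using neg by blast
  obtain c where c: "\<And>n. f (c n) = 0" "inj c" "\<And>n. norm (c n) \<le> norm z + 40 / \<kappa> * ln (real n + 1)"
    by (rule zero_chain[of z]) (use z r in auto)
  define A where "A = norm z + 40 / \<kappa> * s"
  have A: "A > 0" unfolding A_def using s \<kappa>_pos by (auto intro!: add_nonneg_pos)
  have bound: "norm (c n) powr s \<le> A powr s * (real n + 1)" for n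
  proof -
    have "ln (real n + 1) \<le> (real n + 1) powr (1 / s) / (1 / s)"
      using s by (intro ln_powr_bound) auto
    then have "40 / \<kappa> * ln (real n + 1) \<le> 40 / \<kappa> * (s * (real n + 1) powr (1 / s))"
      using \<kappa>_pos by (intro mult_left_mono) (auto simp: mult_ac)
    moreover have "norm z \<le> norm z * (real n + 1) powr (1 / s)"
      using s mult_left_mono[of 1 "(real n + 1) powr (1 / s)" "norm z"] by (simp add: ge_one_powr_ge_zero)
    ultimately have "norm (c n) \<le> A * (real n + 1) powr (1 / s)"
      using c(3)[of n] unfolding A_def by (simp add: algebra_simps)
    then have "norm (c n) powr s \<le> (A * (real n + 1) powr (1 / s)) powr s"
      using s by (intro powr_mono2) auto
    also have "\<dots> = A powr s * (real n + 1)"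
      using A s by (simp add: powr_mult powr_powr)
    finally show ?thesis .
  qed
  have sub: "(\<lambda>n. 1 / norm (c n) powr s) summable_on {n. c n \<noteq> 0}"
  proof -
    have "(\<lambda>z. 1 / norm z powr s) summable_on c ` {n. c n \<noteq> 0}"
      by (rule summable_on_subset_banach[OF summ]) (use c in auto)
    then show ?thesis
      by (subst (asm) summable_on_reindex) (use c(2) in \<open>auto simp: o_def inj_on_def\<close>)
  qed
  have fin: "finite {n. c n = 0}"
  proof (rule ccontr)
    assume "infinite {n. c n = 0}"
    then obtain m n where "m \<noteq> n" "c m = 0" "c n = 0"
      by (metis (mono_tags, lifting) finite.emptyI finite_insert infinite_imp_nonempty mem_Collect_eq rev_finite_subset singletonI subsetI)
    then show False using c(2) by (metis injD)
  qed
  have "(\<lambda>n. 1 / norm (c n) powr s) summable_on {n. c n \<noteq> 0} \<union> {n. c n = 0}"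
    by (rule summable_on_Un_disjoint[OF sub summable_on_finite[OF fin]]) auto
  moreover have "{n. c n \<noteq> 0} \<union> {n. c n = 0} = UNIV" by auto
  ultimately have "summable (\<lambda>n. 1 / norm (c n) powr s)"
    by (metis summable_on_UNIV_nonneg_real_iff divide_nonneg_nonneg powr_ge_zero zero_le_one)
  then have "summable (\<lambda>n. A powr s * (1 / norm (c n) powr s))" by (rule summable_mult)
  then have "summable (\<lambda>n. inverse (real (Suc n)))"
  proof (rule summable_comparison_test_ev[rotated])
    have "eventually (\<lambda>n. c n \<noteq> 0) sequentially"
      using fin by (simp add: cofinite_eq_sequentially[symmetric] eventually_cofinite)
    then show "\<forall>\<^sub>F n in sequentially. norm (inverse (real (Suc n))) \<le> A powr s * (1 / norm (c n) powr s)"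
    proof eventually_elim
      case (elim n)
      then show ?case using bound[of n] by (simp add: field_simps)
    qed
  qed
  then have "summable (\<lambda>n. inverse (real n))" by (subst (asm) summable_Suc_iff)
  then show False using not_summable_harmonic by blast
qed

text \<open>With A = f + f'/g and B = f - f'/g the quotient is (A - B)/(A + B). If A and B were
  within a factor e^6 of each other, the model would vanish at s = Ln(-B/A)/2, where |Re s| \<le> 3
  and |Im s| \<le> 2, and \<open>f\<close> would have a zero nearby. So one of them dominates, and
  connectedness of the half-plane makes the sign global.\<close>

lemma wkb_asymptotics:
  assumes s: "s > 0" and summ: "(\<lambda>z. 1 / norm z powr s) summable_on {z. z \<noteq> 0 \<and> f z = 0}"
  obtains r \<sigma> where "\<sigma> = 1 \<or> \<sigma> = - 1" "\<And>z. Re z \<ge> r \<Longrightarrow> f z \<noteq> 0"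
    "\<And>z. Re z \<ge> r \<Longrightarrow> norm (f' z / (f z * g z) - \<sigma>) < 1 / 2"
proof -
  obtain r1 where r1: "\<And>z. Re z \<ge> r1 \<Longrightarrow> f z \<noteq> 0"
    using no_zeros_far_right[OF assms] by blast
  define r where "r = max r0 (r1 + 1)"
  define \<phi> where "\<phi> z = f' z / (f z * g z)" for z
  have near: "\<phi> z \<in> ball 1 (1 / 2) \<union> ball (- 1) (1 / 2)" if z: "Re z \<ge> r" for z
  proof -
    define A where "A = f z + f' z / g z"
    define B where "B = f z - f' z / g z"
    have fz: "f z \<noteq> 0" using r1 z unfolding r_def by auto
    have AB: "A + B \<noteq> 0" using fz unfolding A_def B_def by simp
    have \<phi>: "\<phi> z = (A - B) / (A + B)" unfolding A_def B_def \<phi>_def using fz by (simp add: field_simps)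
    have alt: "norm B \<le> exp (- 6) * norm A \<or> norm A \<le> exp (- 6) * norm B"
    proof (rule ccontr)
      assume neg: "\<not> ?thesis"
      have "exp (- 6) * norm A \<ge> 0" "exp (- 6) * norm B \<ge> 0" by simp_all
      then have pos: "norm A > 0" "norm B > 0" using neg by linarith+
      then have ABnz: "A \<noteq> 0" "B \<noteq> 0" by auto
      define s where "s = Ln (- B / A) / 2"
      have ex: "exp (2 * s) = - B / A" unfolding s_def using ABnz by simp
      have "Re (2 * s) = ln (norm B / norm A)" unfolding s_def using ABnz by (simp add: Re_Ln norm_divide)
      also have "\<dots> = ln (norm B) - ln (norm A)" using pos by (simp add: ln_div)
      finally have re: "Re (2 * s) = ln (norm B) - ln (norm A)" .
      have "ln (exp (- 6) * norm A) < ln (norm B)" "ln (exp (- 6) * norm B) < ln (norm A)"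
        using neg pos by (subst ln_less_cancel_iff; simp add: not_le)+
      then have "\<bar>Re s\<bar> \<le> 3" using re pos by (simp add: ln_mult)
      moreover have "\<bar>Im s\<bar> \<le> 2"
        using Im_Ln_le_pi[of "- B / A"] mpi_less_Im_Ln[of "- B / A"] ABnz pi_less_4
        unfolding s_def by (simp add: abs_le_iff)
      ultimately have ns: "norm s \<le> 5" using cmod_le[of s] by linarith
      have "A * exp s + B * exp (- s) = exp (- s) * (A * exp (2 * s) + B)"
        by (simp add: algebra_simps mult_exp_exp)
      also have "\<dots> = 0" unfolding ex using ABnz by simp
      finally have eq: "A * exp s + B * exp (- s) = 0" .
      obtain t where t: "norm (t - s) < 1 / 4" "f (z + t / g z) = 0"
        by (rule nearby_zero[of z s]) (use z ns eq in \<open>auto simp: r_def A_def B_def\<close>)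
      have "norm t \<le> 6" using norm_triangle_sub[of t s] t ns by linarith
      from r0(2)[OF _ this, of z] have "Re (z + t / g z) \<ge> r1"
        using z abs_Re_le_cmod[of "t / g z"] unfolding r_def by auto
      then show False using r1 t by blast
    qed
    have e6: "exp (- 6 :: real) \<le> 1 / 64"
    proof -
      have "(2::real) ^ 6 \<le> exp 1 ^ 6" using exp_ge_add_one_self[of 1] by (intro power_mono) auto
      then have "64 \<le> exp (6 :: real)" by (simp add: exp_of_nat_mult[symmetric])
      then show ?thesis by (subst exp_minus) (simp add: field_simps)
    qed
    have *: "norm ((X - Y) / (X + Y) - 1) < 1 / 2"
      if "norm Y \<le> exp (- 6) * norm X" "X + Y \<noteq> 0" for X Y :: complex
    proof -
      have "exp (- 6) * norm X \<le> 1 / 64 * norm X" by (rule mult_right_mono[OF e6]) simp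
      then have Y: "64 * norm Y \<le> norm X" using that by simp
      have X: "norm X \<le> norm (X + Y) + norm Y" using norm_triangle_ineq2[of X "- Y"] by simp
      have pos: "norm (X + Y) > 0" using that by simp
      have "(X - Y) / (X + Y) - 1 = - 2 * Y / (X + Y)" using that by (simp add: field_simps)
      then have "norm ((X - Y) / (X + Y) - 1) = 2 * norm Y / norm (X + Y)"
        by (simp add: norm_mult norm_divide)
      also have "\<dots> < 1 / 2"
      proof -
        have "4 * norm Y < norm (X + Y)" using X Y pos norm_ge_zero[of Y] by linarith
        then show ?thesis using pos by (simp add: divide_less_eq)
      qed
      finally show ?thesis .
    qed
    from alt show ?thesis
    proof
      assume "norm B \<le> exp (- 6) * norm A"
      from *[OF this AB] show ?thesis unfolding \<phi> by (simp add: dist_norm norm_minus_commute)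
    next
      assume "norm A \<le> exp (- 6) * norm B"
      from *[OF this] AB have "norm ((B - A) / (A + B) - 1) < 1 / 2" by (simp add: add.commute)
      moreover have "(B - A) / (A + B) - 1 = - (\<phi> z - (- 1))" unfolding \<phi> by (simp add: diff_divide_distrib)
      ultimately have "norm (\<phi> z - (- 1)) < 1 / 2" by (metis norm_minus_cancel)
      then have "dist (- 1) (\<phi> z) < 1 / 2" by (metis dist_norm dist_commute)
      then show ?thesis by simp
    qed
  qed
  define H where "H = {z. Re z \<ge> r}"
  have "continuous_on H g" unfolding g_def[abs_def] by (intro continuous_intros)
  then have "continuous_on H \<phi>"
    unfolding \<phi>_def using r1
    by (intro continuous_intros ode_sol_continuous[OF sol]) (auto simp: H_def r_def)
  moreover have "connected H"
    unfolding H_def by (intro convex_connected convex_halfspace_Re_ge)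
  ultimately have "connected (\<phi> ` H)" by (rule connected_continuous_image)
  moreover have "\<phi> ` H \<subseteq> ball 1 (1 / 2) \<union> ball (- 1) (1 / 2)" using near unfolding H_def by blast
  moreover have "ball 1 (1 / 2) \<inter> ball (- 1) (1 / 2) = ({} :: complex set)"
  proof -
    have "False" if "dist 1 x < 1 / 2" "dist (- 1) x < 1 / 2" for x :: complex
      using dist_triangle_le[of 1 x "- 1" 1] that by (simp add: dist_norm dist_commute)
    then show ?thesis by auto
  qed
  ultimately have "ball 1 (1 / 2) \<inter> \<phi> ` H = {} \<or> ball (- 1) (1 / 2) \<inter> \<phi> ` H = {}"
    by (intro connectedD) auto
  then consider "\<phi> ` H \<subseteq> ball 1 (1 / 2)" | "\<phi> ` H \<subseteq> ball (- 1) (1 / 2)"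
    using \<open>\<phi> ` H \<subseteq> _\<close> by blast
  then obtain \<sigma> where \<sigma>: "\<sigma> = 1 \<or> \<sigma> = - 1" "\<phi> ` H \<subseteq> ball \<sigma> (1 / 2)" by metis
  show ?thesis
  proof (rule that[OF \<sigma>(1)])
    show "f z \<noteq> 0" if "Re z \<ge> r" for z using r1 that by (simp add: r_def)
    show "norm (f' z / (f z * g z) - \<sigma>) < 1 / 2" if "Re z \<ge> r" for z
    proof -
      have "\<phi> z \<in> ball \<sigma> (1 / 2)" using \<sigma>(2) that by (auto simp: H_def)
      then show ?thesis by (simp add: \<phi>_def dist_norm norm_minus_commute)
    qed
  qed
qed

text \<open>Both \<open>f\<close> and its translate decay rapidly along a horizontal ray on which \<open>\<sigma> g\<close> is
  negative, so their constant Wronskian vanishes.\<close>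

lemma translate_multiple:
  assumes \<sigma>: "\<sigma> = 1 \<or> \<sigma> = - 1" and f_nz: "\<And>z. Re z \<ge> r \<Longrightarrow> f z \<noteq> 0"
    and asy: "\<And>z. Re z \<ge> r \<Longrightarrow> norm (f' z / (f z * g z) - \<sigma>) < 1 / 2"
    and Qp: "\<And>z. Q (z + w) = Q z" and gp: "\<And>z. g (z + w) = g z" and w: "Re w = 0"
  obtains c where "\<And>z. f (z + w) = c * f z" "\<And>z. f' (z + w) = c * f' z"
proof -
  \<comment> \<open>The height \<open>\<theta>\<close> is chosen so that \<sigma> a exp(i \<kappa>
    \<theta> / 2) = -|a|; on the line Im z = \<theta> this makes \<open>\<sigma> * g\<close> real
    and negative.\<close>
  define u where "u = - of_real (norm a) / (\<sigma> * a)"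
  define \<theta> where "\<theta> = 2 / \<kappa> * Im (Ln u)"
  have nu: "norm u = 1" "u \<noteq> 0" using \<sigma> a_nz by (auto simp: u_def norm_mult norm_divide)
  have "Ln u = \<i> * of_real (Im (Ln u))"
    using Re_Ln[OF nu(2)] nu(1) by (simp add: complex_eq_iff)
  then have expu: "exp (\<i> * of_real (Im (Ln u))) = u" using exp_Ln[OF nu(2)] by metis
  define G where "G x = norm a * exp (\<kappa> / 2 * x)" for x
  define p where "p x = of_real x + \<i> * of_real \<theta>" for x
  have Re_p: "Re (p x) = x" for x by (simp add: p_def)
  have gp': "\<sigma> * g (p x) = - of_real (G x)" for x
  proof -
    have *: "of_real (\<kappa> / 2) * p x = of_real (\<kappa> / 2 * x) + \<i> * of_real (Im (Ln u))"
      using \<kappa>_pos by (simp add: p_def \<theta>_def algebra_simps)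
    define e where "e = exp (\<kappa> / 2 * x)"
    from * have "g (p x) = a * (of_real e * u)"
      unfolding g_def e_def by (simp only: exp_add expu exp_of_real)
    then show ?thesis using \<sigma> a_nz unfolding G_def e_def[symmetric] by (auto simp: u_def)
  qed
  \<comment> \<open>At least half of |g| is available for decay, so 2 \<kappa> is what outweighs the
    factor e^{\<kappa> z} introduced below.\<close>
  obtain x1 where x1: "\<And>z. Re z \<ge> x1 \<Longrightarrow> norm (g z) \<ge> 2 * \<kappa>" using g_large by blast
  define x0 where "x0 = max 0 (max r x1)"
  have p': "(p has_vector_derivative 1) (at x)" for x
    unfolding p_def[abs_def] by (auto intro!: derivative_eq_intros)
  have decay: "\<exists>C. \<forall>x\<ge>x0. norm (h (p x)) \<le> C * exp (- \<kappa> * x)"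
    if h: "ode_sol Q h h'" and h_nz: "\<And>z. Re z \<ge> r \<Longrightarrow> h z \<noteq> 0"
      and ah: "\<And>z. Re z \<ge> r \<Longrightarrow> norm (h' z / (h z * g z) - \<sigma>) < 1 / 2" for h h'
  proof -
    \<comment> \<open>Multiplication by e^{\<kappa> z} turns decay at rate \<open>\<kappa>\<close>
      into monotonicity. This rate is enough: in the Wronskian two such factors meet one
      \<open>g\<close> of size e^{\<kappa> x / 2}.\<close>
    define F where "F x = h (p x) * exp (of_real \<kappa> * p x)" for x
    define \<mu> where "\<mu> x = h' (p x) / h (p x) + of_real \<kappa>" for x
    have F': "(F has_vector_derivative \<mu> x * F x) (at x)" if "x \<ge> x0" for x
    proof -
      have "h (p x) \<noteq> 0" using h_nz[of "p x"] that Re_p by (auto simp: x0_def)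
      have "((\<lambda>z. h z * exp (of_real \<kappa> * z)) has_field_derivative
              (h' z + of_real \<kappa> * h z) * exp (of_real \<kappa> * z)) (at z)" for z
        by (rule derivative_eq_intros ode_solD[OF h] refl | simp)+ (simp add: algebra_simps)
      from field_vector_diff_chain_at[OF p' this, of x] \<open>h (p x) \<noteq> 0\<close>
      show ?thesis
        unfolding F_def[abs_def] \<mu>_def o_def by (simp add: algebra_simps)
    qed
    have Re_\<mu>: "Re (\<mu> x) \<le> 0" if "x \<ge> x0" for x
    proof -
      have x: "Re (p x) \<ge> r" "Re (p x) \<ge> x1" using that Re_p by (auto simp: x0_def)
      define \<eta> where "\<eta> = h' (p x) / (h (p x) * g (p x)) - \<sigma>"
      have \<eta>: "norm \<eta> < 1 / 2" using ah[OF x(1)] unfolding \<eta>_def .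
      have "h' (p x) / h (p x) = (\<eta> + \<sigma>) * g (p x)" unfolding \<eta>_def using h_nz[OF x(1)] by simp
      also have "\<dots> = (\<sigma> * \<eta> + 1) * (\<sigma> * g (p x))"
        using \<sigma> by (auto simp: algebra_simps)
      also have "\<dots> = - (of_real (G x) * (1 + \<sigma> * \<eta>))" unfolding gp' by (simp add: algebra_simps)
      finally have "Re (h' (p x) / h (p x)) = - (G x * (1 + Re (\<sigma> * \<eta>)))" by simp
      moreover have "norm (\<sigma> * \<eta>) < 1 / 2" using \<eta> \<sigma> by (auto simp: norm_mult)
      then have "1 + Re (\<sigma> * \<eta>) \<ge> 1 / 2" using abs_Re_le_cmod[of "\<sigma> * \<eta>"] by linarith
      moreover have "norm (g (p x)) = G x" unfolding norm_g Re_p G_def ..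
      then have "G x \<ge> 2 * \<kappa>" using x1[OF x(2)] by simp
      ultimately show ?thesis
        using mult_mono[of "2 * \<kappa>" "G x" "1 / 2" "1 + Re (\<sigma> * \<eta>)"] \<kappa>_pos unfolding \<mu>_def by simp
    qed
    show ?thesis
    proof (intro exI allI impI)
      fix x assume "x0 \<le> x"
      from norm_decreasing_along_ray[OF F' Re_\<mu> this]
      show "norm (h (p x)) \<le> norm (F x0) * exp (- \<kappa> * x)"
        by (simp add: F_def norm_mult norm_exp_eq_Re Re_p exp_minus field_simps)
    qed
  qed
  define f2 where "f2 z = f (z + w)" for z
  define f2' where "f2' z = f' (z + w)" for z
  have sol2: "ode_sol Q f2 f2'" unfolding f2_def[abs_def] f2'_def[abs_def]
    by (rule ode_sol_shift[OF sol Qp])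
  have f2_nz: "f2 z \<noteq> 0" if "Re z \<ge> r" for z using f_nz[of "z + w"] that w by (simp add: f2_def)
  have asy2: "norm (f2' z / (f2 z * g z) - \<sigma>) < 1 / 2" if "Re z \<ge> r" for z
    using asy[of "z + w"] that w gp by (simp add: f2_def f2'_def)
  obtain C1 where C1: "\<And>x. x \<ge> x0 \<Longrightarrow> norm (f (p x)) \<le> C1 * exp (- \<kappa> * x)"
    using decay[OF sol f_nz asy] by blast
  obtain C2 where C2: "\<And>x. x \<ge> x0 \<Longrightarrow> norm (f2 (p x)) \<le> C2 * exp (- \<kappa> * x)"
    using decay[OF sol2 f2_nz asy2] by blast
  define W where "W = f 0 * f2' 0 - f' 0 * f2 0"
  have bound: "norm W \<le> C1 * C2 * norm a * exp (- \<kappa>) ^ n" if n: "real n \<ge> x0" for n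
  proof -
    define x where "x = real n"
    have x: "Re (p x) \<ge> r" "x \<ge> x0" "x \<ge> 0" using n Re_p by (auto simp: x0_def x_def)
    define \<phi> where "\<phi> = f' (p x) / (f (p x) * g (p x))"
    define \<phi>2 where "\<phi>2 = f2' (p x) / (f2 (p x) * g (p x))"
    have "norm (\<phi>2 - \<phi>) \<le> norm (\<phi>2 - \<sigma>) + norm (\<phi> - \<sigma>)"
      using norm_triangle_ineq4[of "\<phi>2 - \<sigma>" "\<phi> - \<sigma>"] by simp
    also have "\<dots> \<le> 1" using asy[OF x(1)] asy2[OF x(1)] unfolding \<phi>_def \<phi>2_def by simp
    finally have d: "norm (\<phi>2 - \<phi>) \<le> 1" .
    have C0: "C1 \<ge> 0" "C2 \<ge> 0"
      using order_trans[OF norm_ge_zero C1[OF x(2)]] order_trans[OF norm_ge_zero C2[OF x(2)]]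
      by (auto simp: zero_le_mult_iff)
    have "W = f (p x) * f2' (p x) - f' (p x) * f2 (p x)"
      unfolding W_def by (rule wronskian_const[OF sol sol2, symmetric])
    also have "\<dots> = f (p x) * f2 (p x) * (g (p x) * (\<phi>2 - \<phi>))"
      unfolding \<phi>_def \<phi>2_def using f_nz[OF x(1)] f2_nz[OF x(1)] by (simp add: field_simps)
    also have "norm \<dots> \<le> (C1 * exp (- \<kappa> * x)) * (C2 * exp (- \<kappa> * x)) * (G x * 1)"
      unfolding norm_mult
      using C1[OF x(2)] C2[OF x(2)] d C0 Re_p
      by (intro mult_mono mult_nonneg_nonneg) (auto simp: norm_g G_def)
    also have "\<dots> = C1 * C2 * norm a * exp (- \<kappa> * x + - \<kappa> * x + \<kappa> / 2 * x)"
      unfolding G_def exp_add by simp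
    also have "\<dots> \<le> C1 * C2 * norm a * exp (- \<kappa> * x)"
    proof (rule mult_left_mono)
      have "0 \<le> \<kappa> * x" using \<kappa>_pos x(3) by simp
      then show "exp (- \<kappa> * x + - \<kappa> * x + \<kappa> / 2 * x) \<le> exp (- \<kappa> * x)" by (simp add: field_simps)
      show "0 \<le> C1 * C2 * norm a" using C0 by simp
    qed
    also have "exp (- \<kappa> * x) = exp (- \<kappa>) ^ n" by (simp add: exp_of_nat_mult[symmetric] x_def mult_ac)
    finally show ?thesis .
  qed
  have "(\<lambda>n. C1 * C2 * norm a * exp (- \<kappa>) ^ n) \<longlonglongrightarrow> C1 * C2 * norm a * 0"
    using \<kappa>_pos by (intro tendsto_mult tendsto_const LIMSEQ_power_zero) auto
  then have "norm W \<le> C1 * C2 * norm a * 0"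
  proof (rule LIMSEQ_le_const)
    obtain N where "real N \<ge> x0" using real_arch_simple by blast
    then show "\<exists>N. \<forall>n\<ge>N. norm W \<le> C1 * C2 * norm a * exp (- \<kappa>) ^ n"
      using bound by (meson of_nat_mono order_trans)
  qed
  then have W0: "W = 0" by simp
  obtain b where "f b \<noteq> 0" using nontriv by blast
  from wronskian_zero_imp_multiple[OF sol sol2 Q_cont W0[unfolded W_def] this]
  show ?thesis using that unfolding f2_def f2'_def by blast
qed

end

section \<open>Multiplicatively periodic solutions\<close>

text \<open>By periodicity, \<open>F t = E (p * Ln t)\<close> does not depend on the branch of the
  logarithm. Near any \<open>t0\<close> the branch \<open>Ln (t / t0) + Ln t0\<close> is
  holomorphic, so the cut of \<open>Ln\<close> leaves no trace.\<close>

lemma periodic_factor: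
  fixes E :: "complex \<Rightarrow> complex" and p :: nat
  assumes E: "E holomorphic_on UNIV" and per: "\<And>z. E (z + 2 * pi * \<i> * p) = E z" and p: "p > 0"
  obtains F where "F holomorphic_on - {0}" "\<And>z. E z = F (exp (z / of_nat p))"
proof -
  have per_nat: "E (z + 2 * pi * \<i> * p * of_nat n) = E z" for z n
  proof (induction n)
    case (Suc n)
    then show ?case using per[of "z + 2 * pi * \<i> * p * of_nat n"] by (simp add: algebra_simps)
  qed simp
  have per_int: "E (z + 2 * pi * \<i> * p * of_int n) = E z" for z n
  proof (cases "n \<ge> 0")
    case True
    then show ?thesis using per_nat[of z "nat n"] by simp
  next
    case False
    then show ?thesis using per_nat[of "z + 2 * pi * \<i> * p * of_int n" "nat (- n)"] by (simp add: algebra_simps)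
  qed
  have eq: "E (p * w) = E (p * w')" if "exp w = exp w'" for w w' :: complex
  proof -
    obtain n :: int where "w = w' + (of_int (2 * n) * pi) * \<i>" using \<open>exp w = exp w'\<close> unfolding exp_eq by blast
    then have "p * w = p * w' + 2 * pi * \<i> * p * of_int n" by (simp add: algebra_simps)
    then show ?thesis using per_int by metis
  qed
  define F where "F t = E (p * Ln t)" for t
  show ?thesis
  proof (rule that)
    show "E z = F (exp (z / p))" for z
      unfolding F_def using eq[of "Ln (exp (z / p))" "z / p"] p by simp
    show "F holomorphic_on - {0}"
      unfolding holomorphic_on_def
    proof
      fix t0 :: complex assume "t0 \<in> - {0}"
      then have t0: "t0 \<noteq> 0" by simp
      have ne: "t / t0 \<notin> \<real>\<^sub>\<le>\<^sub>0 \<and> t \<noteq> 0" if "t \<in> ball t0 (norm t0)" for t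
      proof -
        have "norm (t / t0 - 1) < 1"
        proof -
          have "t / t0 - 1 = (t - t0) / t0" using t0 by (simp add: field_simps)
          then show ?thesis using that t0 by (simp add: norm_divide dist_norm norm_minus_commute)
        qed
        then have "Re (t / t0) > 0"
          using abs_Re_le_cmod[of "t / t0 - 1"] by simp
        then show ?thesis by (auto simp: complex_nonpos_Reals_iff)
      qed
      have "(\<lambda>t. E (p * (Ln (t / t0) + Ln t0))) holomorphic_on ball t0 (norm t0)"
        using ne t0 by (intro holomorphic_on_compose_gen[OF _ E, unfolded o_def] holomorphic_intros) auto
      moreover have "E (p * (Ln (t / t0) + Ln t0)) = F t" if "t \<in> ball t0 (norm t0)" for t
        unfolding F_def using ne[OF that] t0 by (intro eq) (simp add: exp_add)
      ultimately have "F holomorphic_on ball t0 (norm t0)" by (rule holomorphic_transform)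
      then have "F field_differentiable at t0"
        using t0 by (intro holomorphic_on_imp_differentiable_at[of _ "ball t0 (norm t0)"]) auto
      then show "F field_differentiable at t0 within - {0}"
        by (rule field_differentiable_at_within)
    qed
  qed
qed

section \<open>Zeros, polynomial growth and Laurent polynomials\<close>

lemma divide_out_simple_zeros:
  fixes F :: "complex \<Rightarrow> complex"
  assumes "finite Z" "open S" "Z \<subseteq> S" "F holomorphic_on S"
    and "\<And>a. a \<in> Z \<Longrightarrow> F a = 0 \<and> deriv F a \<noteq> 0"
  shows "\<exists>G. G holomorphic_on S \<and> (\<forall>t\<in>S. F t = (\<Prod>a\<in>Z. t - a) * G t) \<and> (\<forall>a\<in>Z. G a \<noteq> 0)"
  using assms(1,3-)
proof (induction Z arbitrary: F)
  case empty
  then show ?case by auto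
next
  case (insert a Z)
  define H where "H t = (if t = a then deriv F a else (F t - F a) / (t - a))" for t
  have a: "a \<in> S" "F a = 0" "deriv F a \<noteq> 0" using insert.prems by auto
  have H: "H holomorphic_on S"
    unfolding H_def[abs_def] using insert.prems a \<open>open S\<close>
    by (intro pole_lemma) (auto simp: interior_open)
  have FH: "F t = (t - a) * H t" for t using a by (auto simp: H_def)
  have "H b = 0 \<and> deriv H b \<noteq> 0" if b: "b \<in> Z" for b
  proof -
    have ba: "b \<noteq> a" using b insert.hyps by auto
    have "F b = 0" "deriv F b \<noteq> 0" using b insert.prems by auto
    then have Hb: "H b = 0" using ba FH[of b] by auto
    have "b \<in> S" using b insert.prems by auto
    then have "(H has_field_derivative deriv H b) (at b)"
      using H \<open>open S\<close> holomorphic_derivI by blast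
    then have "((\<lambda>t. (t - a) * H t) has_field_derivative (b - a) * deriv H b) (at b)"
      by (auto intro!: derivative_eq_intros simp: Hb)
    then have "deriv F b = (b - a) * deriv H b" unfolding FH[symmetric] by (rule DERIV_imp_deriv)
    then show ?thesis using Hb \<open>deriv F b \<noteq> 0\<close> by auto
  qed
  then obtain G where G: "G holomorphic_on S" "\<And>t. t \<in> S \<Longrightarrow> H t = (\<Prod>a\<in>Z. t - a) * G t" "\<And>a. a \<in> Z \<Longrightarrow> G a \<noteq> 0"
    using insert.IH[OF _ H] insert.prems by auto
  have "G a \<noteq> 0" using G(2)[OF a(1)] a(3) by (auto simp: H_def)
  then show ?case using G insert.hyps FH by (intro exI[of _ G]) (auto simp: mult.assoc)
qed

lemma poly_prod_linear: "poly (\<Prod>a\<in>Z. [:- a, 1:]) t = (\<Prod>a\<in>Z. t - a)" for t :: "'a::comm_ring_1"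
  by (simp add: poly_prod)

lemma norm_poly_le:
  fixes q :: "complex poly"
  obtains B where "\<And>t. norm t \<ge> 1 \<Longrightarrow> norm (poly q t) \<le> B * norm t ^ degree q"
    "\<And>t. norm t \<le> 1 \<Longrightarrow> norm (poly q t) \<le> B"
proof
  define B where "B = (\<Sum>i\<le>degree q. norm (coeff q i))"
  have *: "norm (poly q t) \<le> (\<Sum>i\<le>degree q. norm (coeff q i) * norm t ^ i)" for t
    unfolding poly_altdef by (rule order_trans[OF norm_sum]) (simp add: norm_mult norm_power)
  show "norm (poly q t) \<le> B * norm t ^ degree q" if "norm t \<ge> 1" for t
    unfolding B_def sum_distrib_right
    by (rule order_trans[OF *]) (intro sum_mono mult_left_mono power_increasing, use that in auto)
  show "norm (poly q t) \<le> B" if "norm t \<le> 1" for t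
    unfolding B_def
    by (rule order_trans[OF *]) (intro sum_mono mult_left_le power_le_one, use that in auto)
qed

text \<open>One power more than the bound asks for: \<open>t ^ Suc n * F t\<close> tends to 0, which
  is also its value at 0 whatever \<open>F 0\<close> is, so the singularity is removed without
  redefining the function.\<close>

lemma holomorphic_extension_at_0:
  fixes F :: "complex \<Rightarrow> complex"
  assumes F: "F holomorphic_on - {0}" and R: "R > 0"
    and bound: "\<And>t. t \<noteq> 0 \<Longrightarrow> norm t < R \<Longrightarrow> norm (F t) * norm t ^ n \<le> B"
  shows "(\<lambda>t. t ^ Suc n * F t) holomorphic_on UNIV"
proof -
  define H where "H t = t ^ Suc n * F t" for t
  have "H \<midarrow>0\<rightarrow> 0"
  proof (rule Lim_null_comparison)
    show "\<forall>\<^sub>F t in at 0. norm (H t) \<le> B * norm t"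
      unfolding eventually_at
    proof (intro exI conjI ballI impI)
      fix t :: complex assume "t \<noteq> 0 \<and> dist t 0 < R"
      then have "norm (F t) * norm t ^ n \<le> B" by (intro bound) auto
      from mult_right_mono[OF this, of "norm t"]
      show "norm (H t) \<le> B * norm t" by (simp add: H_def norm_mult norm_power mult_ac)
    qed (rule R)
    show "(\<lambda>t. B * norm t) \<midarrow>0\<rightarrow> 0" by (auto intro!: tendsto_eq_intros)
  qed
  then have H0: "H \<midarrow>0\<rightarrow> H 0" by (simp add: H_def)
  have "H holomorphic_on UNIV - {0}" unfolding H_def[abs_def]
    using F by (intro holomorphic_intros) (auto simp: Compl_eq_Diff_UNIV)
  then have "H holomorphic_on UNIV"
    by (intro no_isolated_singularity'[of "{0}" H UNIV]) (use H0 in auto)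
  then show ?thesis unfolding H_def[abs_def] .
qed

lemma laurent_if_growth:
  fixes \<Lambda> :: "complex \<Rightarrow> complex"
  assumes hol: "\<Lambda> holomorphic_on - {0}"
    and out: "\<And>t. norm t \<ge> R \<Longrightarrow> norm (\<Lambda> t) \<le> B * norm t ^ n"
    and inn: "\<And>t. t \<noteq> 0 \<Longrightarrow> norm t \<le> 1 / R \<Longrightarrow> norm (\<Lambda> t) * norm t ^ n \<le> B" and R: "R > 0"
  obtains G where "\<And>t. t \<noteq> 0 \<Longrightarrow> t ^ Suc n * \<Lambda> t = poly G t"
proof -
  define H where "H t = t ^ Suc n * \<Lambda> t" for t
  have H: "H holomorphic_on UNIV"
    unfolding H_def[abs_def] by (rule holomorphic_extension_at_0[OF hol, of "1 / R" n B]) (use inn R in auto)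
  have "norm (H t) \<le> B * norm t ^ (n + n + 1)" if "norm t \<ge> R" for t
  proof -
    have "norm (H t) \<le> norm t ^ Suc n * (B * norm t ^ n)"
      unfolding H_def norm_mult norm_power using out[OF that] by (intro mult_left_mono) auto
    also have "\<dots> = B * norm t ^ (n + n + 1)" by (simp add: power_add mult_ac)
    finally show ?thesis .
  qed
  from Liouville_polynomial[OF H this]
  have "H t = poly (\<Sum>k\<le>n + n + 1. monom ((deriv ^^ k) H 0 / fact k) k) t" for t
    by (simp add: poly_sum poly_monom)
  then show ?thesis using that unfolding H_def by blast
qed

text \<open>The top index \<open>degree G\<close> overshoots the true top exponent, but the surplus
  coefficients vanish; the range stays valid when \<open>s\<close> exceeds the degree.\<close>

lemma poly_as_shifted_laurent_sum:
  fixes G :: "complex poly" and t :: complex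
  assumes "t \<noteq> 0"
  shows "poly G t = t ^ s * (\<Sum>i = - int s..int (degree G). coeff G (nat (i + int s)) * t powi i)"
proof -
  have "t ^ s * (\<Sum>i = - int s..int (degree G). coeff G (nat (i + int s)) * t powi i)
      = (\<Sum>i = - int s..int (degree G). coeff G (nat (i + int s)) * t ^ nat (i + int s))"
    unfolding sum_distrib_left
  proof (rule sum.cong)
    fix i assume "i \<in> {- int s..int (degree G)}"
    then have "t ^ nat (i + int s) = t powi (i + int s)" by (simp add: power_int_def)
    also have "\<dots> = t powi i * t ^ s" using assms by (simp add: power_int_add)
    finally show "t ^ s * (coeff G (nat (i + int s)) * t powi i) = coeff G (nat (i + int s)) * t ^ nat (i + int s)"
      by simp
  qed simp
  also have "\<dots> = (\<Sum>j\<le>degree G + s. coeff G j * t ^ j)"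
    by (rule sum.reindex_bij_witness[of _ "\<lambda>j. int j - int s" "\<lambda>i. nat (i + int s)"]) auto
  also have "\<dots> = (\<Sum>j\<le>degree G. coeff G j * t ^ j)"
    by (rule sum.mono_neutral_right) (auto simp: coeff_eq_0)
  also have "\<dots> = poly G t" by (simp add: poly_altdef)
  finally show ?thesis by simp
qed

text \<open>The term of order 1/t in t^{-s-1} G has no Laurent primitive. It is split off as
  \<open>\<mu>\<close> and later contributes the power t^\<mu>, that is, an exponential factor in
  z.\<close>

lemma laurent_primitive:
  fixes G :: "complex poly"
  obtains h h' \<mu> where "laurent_polynomial h"
    "\<And>t. t \<noteq> 0 \<Longrightarrow> (h has_field_derivative h' t) (at t)"
    "\<And>t. t \<noteq> 0 \<Longrightarrow> poly G t = t ^ s * (t * h' t + \<mu>)"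
proof -
  let ?I = "{- int s..int (degree G)}"
  define a where "a i = (if i = 0 then 0 else coeff G (nat (i + int s)) / of_int i)" for i :: int
  define h where "h t = (\<Sum>i\<in>?I. a i * t powi i)" for t
  define h' where "h' t = (\<Sum>i\<in>?I. a i * (of_int i * t powi (i - 1)))" for t
  show ?thesis
  proof (rule that[of h h' "coeff G s"])
    show "laurent_polynomial h"
      unfolding laurent_polynomial_def h_def by blast
    show "(h has_field_derivative h' t) (at t)" if "t \<noteq> 0" for t
      unfolding h_def[abs_def] h'_def using that by (auto intro!: derivative_eq_intros sum.cong)
    show "poly G t = t ^ s * (t * h' t + coeff G s)" if t: "t \<noteq> 0" for t
    proof -
      have "t * h' t = (\<Sum>i\<in>?I. if i = 0 then 0 else coeff G (nat (i + int s)) * t powi i)"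
        unfolding h'_def sum_distrib_left
        by (rule sum.cong) (use t in \<open>auto simp: a_def power_int_diff\<close>)
      moreover have "coeff G s = (\<Sum>i\<in>?I. if i = 0 then coeff G (nat (i + int s)) * t powi i else 0)"
        by (subst sum.delta) auto
      ultimately have "t * h' t + coeff G s =
          (\<Sum>i\<in>?I. if i = 0 then 0 else coeff G (nat (i + int s)) * t powi i)
          + (\<Sum>i\<in>?I. if i = 0 then coeff G (nat (i + int s)) * t powi i else 0)"
        by (rule arg_cong2)
      also have "\<dots> = (\<Sum>i\<in>?I. coeff G (nat (i + int s)) * t powi i)"
        unfolding sum.distrib[symmetric] by (rule sum.cong) auto
      finally have "t * h' t + coeff G s = (\<Sum>i\<in>?I. coeff G (nat (i + int s)) * t powi i)" .
      then show ?thesis using poly_as_shifted_laurent_sum[OF t, of G s] by simp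
    qed
  qed
qed

text \<open>\<open>\<gamma>\<close> is a Floquet exponent: dividing by
  \<open>exp (\<gamma> * z)\<close> cancels the multiplier \<open>c\<close> and leaves a periodic
  function.\<close>

lemma multiplicatively_periodic_factor:
  fixes f :: "complex \<Rightarrow> complex" and p :: nat
  assumes f: "f holomorphic_on UNIV" and nz: "f z0 \<noteq> 0" and p: "p > 0"
    and per: "\<And>z. f (z + of_real (2 * pi) * \<i> * of_nat p) = c * f z"
  obtains \<gamma> F where "F holomorphic_on - {0}" "\<And>z. f z = exp (\<gamma> * z) * F (exp (z / of_nat p))"
proof -
  define \<omega> where "\<omega> = of_real (2 * pi) * \<i> * of_nat p"
  have \<omega>: "\<omega> \<noteq> 0" using p by (simp add: \<omega>_def)
  have c: "c \<noteq> 0" using per[of "z0 - \<omega>"] nz by (auto simp: \<omega>_def)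
  define \<gamma> where "\<gamma> = Ln c / \<omega>"
  have \<gamma>: "exp (\<gamma> * \<omega>) = c" using c \<omega> by (simp add: \<gamma>_def)
  define E where "E z = f z * exp (- \<gamma> * z)" for z
  have E_per: "E (z + 2 * pi * \<i> * p) = E z" for z
  proof -
    have "f (z + \<omega>) = exp (\<gamma> * \<omega>) * f z" using per[of z] \<gamma> by (simp add: \<omega>_def)
    then have "E (z + \<omega>) = E z"
      by (simp add: E_def ring_distribs exp_add exp_diff exp_minus field_simps)
    then show ?thesis unfolding \<omega>_def by simp
  qed
  have E_hol: "E holomorphic_on UNIV"
    unfolding E_def[abs_def] by (intro holomorphic_intros f)
  obtain F where F: "F holomorphic_on - {0}" "\<And>z. E z = F (exp (z / of_nat p))"
    using periodic_factor[OF E_hol E_per p] by blast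
  have "f z = exp (\<gamma> * z) * F (exp (z / of_nat p))" for z
    unfolding F(2)[symmetric] E_def by (simp add: exp_minus)
  with F(1) show ?thesis using that by blast
qed

text \<open>The zeros of \<open>F\<close> are finite in number, by the bounds at both ends, and
  simple, by uniqueness. Once they are divided out, t G1'/G1 is holomorphic off 0 with polynomial
  growth at both ends, hence a Laurent polynomial, and can be integrated. \<open>M\<close> and
  \<open>N\<close> record \<open>f'/f\<close> as a rational function of t, the form that Kovacic's
  cases ask for.\<close>

lemma explicit_form_of_multiplicatively_periodic_solution:
  fixes f f' :: "complex \<Rightarrow> complex" and p n :: nat and B r :: real
  assumes sol: "ode_sol Q f f'" and Q: "continuous_on UNIV Q" and nz: "f z0 \<noteq> 0" and p: "p > 0"
    and per: "\<And>z. f (z + of_real (2 * pi) * \<i> * of_nat p) = c * f z"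
    and right: "\<And>z. Re z \<ge> r \<Longrightarrow> f z \<noteq> 0 \<and> norm (f' z) \<le> B * norm (exp (z / of_nat p)) ^ n * norm (f z)"
    and left: "\<And>z. Re z \<le> - r \<Longrightarrow> f z \<noteq> 0 \<and> norm (f' z) * norm (exp (z / of_nat p)) ^ n \<le> B * norm (f z)"
  obtains \<gamma> \<psi> h M N where "rsquarefree \<psi>" "laurent_polynomial h"
    "\<And>z. f z = poly \<psi> (exp (z / of_nat p)) * exp (\<gamma> * z) * exp (h (exp (z / of_nat p)))"
    "\<And>z. poly M (exp (z / of_nat p)) * f' z = poly N (exp (z / of_nat p)) * f z"
    "\<And>z. f z \<noteq> 0 \<Longrightarrow> poly M (exp (z / of_nat p)) \<noteq> 0"
proof -
  define T where "T z = exp (z / of_nat p)" for z :: complex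
  have T_nz [simp]: "T z \<noteq> 0" for z by (simp add: T_def)
  have T_Ln: "T (of_nat p * Ln t) = t" if "t \<noteq> 0" for t using that p by (simp add: T_def)
  have T': "(T has_field_derivative T z / of_nat p) (at z)" for z
    unfolding T_def[abs_def] using p by (auto intro!: derivative_eq_intros)
  obtain c0 F where F: "F holomorphic_on - {0}" and fF: "\<And>z. f z = exp (c0 * z) * F (T z)"
    using multiplicatively_periodic_factor[OF ode_sol_holomorphic(1)[OF sol] nz p per]
    unfolding T_def by blast
  have F': "(F has_field_derivative deriv F t) (at t)" if "t \<noteq> 0" for t
    using F that by (intro holomorphic_derivI[of F "- {0}"]) auto
  have f': "f' z = c0 * f z + exp (c0 * z) * (deriv F (T z) * (T z / of_nat p))" for z
  proof -
    have "((\<lambda>z. exp (c0 * z) * F (T z)) has_field_derivative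
        c0 * (exp (c0 * z) * F (T z)) + exp (c0 * z) * (deriv F (T z) * (T z / of_nat p))) (at z)"
      by (rule derivative_eq_intros DERIV_chain2[OF F' T'] T_nz refl | simp)+
    then show ?thesis
      using DERIV_unique[OF ode_solD(1)[OF sol]] unfolding fF[symmetric] by blast
  qed
  define Z where "Z = {t. t \<noteq> 0 \<and> F t = 0}"
  have F_zero_iff: "F (T z) = 0 \<longleftrightarrow> f z = 0" for z by (simp add: fF)
  have Re_Ln_p: "Re (of_nat p * Ln t) = p * ln (norm t)" if "t \<noteq> 0" for t using that by simp
  have normT: "norm (T z) = exp (Re z / p)" for z by (simp add: T_def norm_exp_eq_Re)
  have finZ: "finite Z"
  proof (cases "Z = {}")
    case False
    then obtain a where a: "a \<noteq> 0" "F a = 0" unfolding Z_def by blast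
    define K where "K = cball 0 (exp (r / p)) - ball (0 :: complex) (exp (- r / p))"
    have "Z \<subseteq> {t \<in> K. F t = 0}"
    proof
      fix t assume "t \<in> Z"
      then have t: "t \<noteq> 0" "F t = 0" unfolding Z_def by auto
      define z where "z = of_nat p * Ln t"
      have tz: "t = T z" using T_Ln[OF t(1)] z_def by simp
      have "f z = 0" using t F_zero_iff tz by simp
      then have "\<not> Re z \<ge> r" "\<not> Re z \<le> - r" using right left by blast+
      then have "Re z / p \<le> r / p" "- r / p \<le> Re z / p" using p by (auto simp: divide_right_mono field_simps)
      then show "t \<in> {t \<in> K. F t = 0}" using t unfolding K_def tz by (simp add: normT)
    qed
    moreover have "finite {t \<in> K. F t = 0}"
    proof (rule holomorphic_compact_finite_zeros[OF F])
      show "open (- {0 :: complex})" by auto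
      show "connected (- {0 :: complex})" by (intro connected_punctured_universe) simp
      show "compact K" unfolding K_def by (intro compact_diff) auto
      show "K \<subseteq> - {0}" unfolding K_def by auto
      show "\<not> F constant_on - {0}"
      proof
        assume "F constant_on - {0}"
        then have "F (T z0) = F a" using a by (force simp: constant_on_def)
        then show False using a nz F_zero_iff by simp
      qed
    qed
    ultimately show ?thesis by (rule finite_subset)
  qed simp
  have Z_simple: "F a = 0 \<and> deriv F a \<noteq> 0" if "a \<in> Z" for a
  proof -
    have a: "a \<noteq> 0" "F a = 0" using that by (auto simp: Z_def)
    define z where "z = of_nat p * Ln a"
    have az: "a = T z" using T_Ln[OF a(1)] z_def by simp
    have "f z = 0" using a F_zero_iff az by simp
    moreover have "f' z \<noteq> 0" using ode_unique[OF sol Q \<open>f z = 0\<close>] nz by blast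
    ultimately show ?thesis using a f'[of z] az by auto
  qed
  obtain G1 where G1: "G1 holomorphic_on - {0}"
    and FG: "\<And>t. t \<noteq> 0 \<Longrightarrow> F t = (\<Prod>a\<in>Z. t - a) * G1 t" and G1Z: "\<And>a. a \<in> Z \<Longrightarrow> G1 a \<noteq> 0"
  proof -
    have "Z \<subseteq> - {0}" by (auto simp: Z_def)
    from divide_out_simple_zeros[OF finZ open_Compl[OF closed_singleton] this F Z_simple] show ?thesis using that by auto
  qed
  define \<psi> where "\<psi> = (\<Prod>a\<in>Z. [:- a, 1:])"
  have \<psi>: "poly \<psi> t = (\<Prod>a\<in>Z. t - a)" for t unfolding \<psi>_def by (rule poly_prod_linear)
  have F\<psi>: "F t = poly \<psi> t * G1 t" if "t \<noteq> 0" for t using FG[OF that] \<psi> by simp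
  have \<psi>_zero: "poly \<psi> t = 0 \<longleftrightarrow> t \<in> Z" for t using finZ unfolding \<psi> by (auto simp: prod_zero_iff)
  have G1_nz: "G1 t \<noteq> 0" if "t \<noteq> 0" for t
    using G1Z[of t] F\<psi>[OF that] that by (cases "t \<in> Z") (auto simp: Z_def)
  have G1': "(G1 has_field_derivative deriv G1 t) (at t)" if "t \<noteq> 0" for t
    using G1 that by (intro holomorphic_derivI[of G1 "- {0}"]) auto
  have dF: "deriv F t = poly (pderiv \<psi>) t * G1 t + poly \<psi> t * deriv G1 t" if "t \<noteq> 0" for t
  proof -
    have "((\<lambda>t. poly \<psi> t * G1 t) has_field_derivative
            poly (pderiv \<psi>) t * G1 t + poly \<psi> t * deriv G1 t) (at t)"
      by (rule derivative_eq_intros G1'[OF that] poly_DERIV refl)+ simp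
    then have "(F has_field_derivative poly (pderiv \<psi>) t * G1 t + poly \<psi> t * deriv G1 t) (at t)"
      by (rule DERIV_cong_ev[THEN iffD1, rotated 3])
         (use that in \<open>auto simp: F\<psi> intro!: eventually_mono[OF t1_space_nhds[of t 0]]\<close>)
    then show ?thesis by (rule DERIV_imp_deriv)
  qed
  have sqf: "rsquarefree \<psi>"
    unfolding rsquarefree_roots
  proof (intro allI notI)
    fix a assume a: "poly \<psi> a = 0 \<and> poly (pderiv \<psi>) a = 0"
    then have "a \<in> Z" using \<psi>_zero by blast
    then show False using Z_simple[of a] dF[of a] a by (auto simp: Z_def)
  qed
  define \<Lambda> where "\<Lambda> t = t * deriv G1 t / G1 t" for t
  have \<Lambda>_hol: "\<Lambda> holomorphic_on - {0}"
    unfolding \<Lambda>_def[abs_def] using G1_nz by (intro holomorphic_intros G1) auto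
  have \<Lambda>: "\<Lambda> (T z) = of_nat p * (f' z / f z - c0) - T z * poly (pderiv \<psi>) (T z) / poly \<psi> (T z)"
    if "f z \<noteq> 0" for z
  proof -
    have nz: "poly \<psi> (T z) \<noteq> 0" "G1 (T z) \<noteq> 0" using that by (auto simp: fF F\<psi>)
    have "of_nat p * (f' z / f z - c0) = T z * deriv F (T z) / F (T z)"
      unfolding f' using that p by (simp add: fF add_divide_distrib)
    also have "\<dots> = T z * poly (pderiv \<psi>) (T z) / poly \<psi> (T z) + \<Lambda> (T z)"
      unfolding \<Lambda>_def using nz by (simp add: dF F\<psi> field_simps)
    finally show ?thesis by simp
  qed
  obtain B1 where B1: "\<And>t. norm t \<ge> 1 \<Longrightarrow> norm (poly (pderiv \<psi>) t) \<le> B1 * norm t ^ degree (pderiv \<psi>)"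
    "\<And>t. norm t \<le> 1 \<Longrightarrow> norm (poly (pderiv \<psi>) t) \<le> B1"
    using norm_poly_le by blast
  have B1_nn: "B1 \<ge> 0" using B1(2)[of 0] by (simp add: order_trans[OF norm_ge_zero])
  define d where "d = degree (pderiv \<psi>)"
  \<comment> \<open>\<open>n\<close> covers the growth of \<open>f'/f\<close> and
    \<open>Suc d\<close> that of t \<psi>'; one exponent serves both ends.\<close>
  define m where "m = n + Suc d"
  \<comment> \<open>The first entry puts t over the half-planes of \<open>right\<close> and
    \<open>left\<close>. The others give |t - a| \<ge> 1 for |t| \<ge> R and |t - a| \<ge> |a|/2 for
    |t| \<le> 1/R.\<close>
  define R where "R = Max (insert (exp (\<bar>r\<bar> / p)) ((\<lambda>a. norm a + 1) ` Z \<union> (\<lambda>a. 2 / norm a) ` Z))"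
  have R: "R \<ge> exp (\<bar>r\<bar> / p)" "\<And>a. a \<in> Z \<Longrightarrow> R \<ge> norm a + 1" "\<And>a. a \<in> Z \<Longrightarrow> R \<ge> 2 / norm a"
    unfolding R_def using finZ by (auto intro!: Max_ge)
  have R1: "R \<ge> 1" using R(1) by (rule order_trans[rotated]) simp
  have lnR: "ln R \<ge> \<bar>r\<bar> / p" using R(1) R1 by (simp add: ln_ge_iff)
  define \<delta> where "\<delta> = (\<Prod>a\<in>Z. norm a / 2)"
  have \<delta>: "\<delta> > 0" unfolding \<delta>_def by (intro prod_pos) (auto simp: Z_def)
  define C where "C = p * (\<bar>B\<bar> + norm c0) + B1 + B1 / \<delta>"
  have out: "norm (\<Lambda> t) \<le> C * norm t ^ m" if t: "norm t \<ge> R" for t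
  proof -
    have t1: "norm t \<ge> 1" "t \<noteq> 0" using t R1 by auto
    define z where "z = of_nat p * Ln t"
    have tz: "t = T z" using T_Ln[OF t1(2)] z_def by simp
    have "\<bar>r\<bar> / p \<le> ln (norm t)" using lnR t R1 by (smt (verit) ln_le_cancel_iff)
    then have "Re z \<ge> r" unfolding z_def Re_Ln_p[OF t1(2)] using p by (simp add: field_simps)
    from right[OF this] have fz: "f z \<noteq> 0" and v: "norm (f' z / f z) \<le> B * norm t ^ n"
      unfolding tz T_def by (auto simp: norm_divide field_simps)
    have "norm (poly \<psi> t) \<ge> 1"
      unfolding \<psi> prod_norm[symmetric]
    proof (rule prod_ge_1)
      fix a assume "a \<in> Z"
      then show "1 \<le> norm (t - a)" using R(2)[of a] t norm_triangle_ineq2[of t a] by linarith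
    qed
    then have "norm (t * poly (pderiv \<psi>) t / poly \<psi> t) \<le> norm t * norm (poly (pderiv \<psi>) t) / 1"
      unfolding norm_mult norm_divide by (intro divide_left_mono) auto
    also have "\<dots> \<le> norm t * (B1 * norm t ^ d)"
      using B1(1)[OF t1(1)] unfolding d_def by (simp add: mult_left_mono)
    also have "\<dots> = B1 * norm t ^ Suc d" by simp
    also have "\<dots> \<le> B1 * norm t ^ m"
      using t1 B1_nn by (intro mult_left_mono power_increasing) (auto simp: m_def)
    finally have 1: "norm (t * poly (pderiv \<psi>) t / poly \<psi> t) \<le> B1 * norm t ^ m" .
    have "norm (f' z / f z - c0) \<le> B * norm t ^ n + norm c0"
      using v norm_triangle_ineq4[of "f' z / f z" c0] by linarith
    also have "\<dots> \<le> \<bar>B\<bar> * norm t ^ m + norm c0 * norm t ^ m"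
    proof (rule add_mono)
      have "B * norm t ^ n \<le> \<bar>B\<bar> * norm t ^ n" by (simp add: mult_right_mono)
      also have "\<dots> \<le> \<bar>B\<bar> * norm t ^ m"
        using t1 by (intro mult_left_mono power_increasing) (auto simp: m_def)
      finally show "B * norm t ^ n \<le> \<bar>B\<bar> * norm t ^ m" .
      show "norm c0 \<le> norm c0 * norm t ^ m"
        using mult_left_mono[OF one_le_power[OF t1(1)], of "norm c0" m] by simp
    qed
    finally have "norm (f' z / f z - c0) \<le> (\<bar>B\<bar> + norm c0) * norm t ^ m" by (simp add: ring_distribs)
    from mult_left_mono[OF this, of "real p"]
    have 2: "norm (of_nat p * (f' z / f z - c0)) \<le> p * (\<bar>B\<bar> + norm c0) * norm t ^ m"
      by (simp add: norm_mult mult.assoc)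
    have "norm (\<Lambda> t) \<le> p * (\<bar>B\<bar> + norm c0) * norm t ^ m + B1 * norm t ^ m"
      unfolding tz \<Lambda>[OF fz] unfolding tz[symmetric]
      by (rule order_trans[OF norm_triangle_ineq4]) (use 1 2 in linarith)
    also have "\<dots> \<le> C * norm t ^ m"
      unfolding C_def using B1_nn \<delta> by (simp add: algebra_simps)
    finally show ?thesis .
  qed
  have inn: "norm (\<Lambda> t) * norm t ^ m \<le> C" if t: "t \<noteq> 0" "norm t \<le> 1 / R" for t
  proof -
    have "1 / R \<le> 1" using R1 by simp
    then have t1: "norm t \<le> 1" using t by linarith
    define z where "z = of_nat p * Ln t"
    have tz: "t = T z" using T_Ln[OF t(1)] z_def by simp
    have "ln (norm t) \<le> ln (1 / R)" using t R1 by (subst ln_le_cancel_iff) auto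
    also have "\<dots> = - ln R" using R1 by (simp add: ln_div)
    also have "\<dots> \<le> - (\<bar>r\<bar> / p)" using lnR by simp
    finally have "Re z \<le> - r" unfolding z_def Re_Ln_p[OF t(1)] using p by (simp add: field_simps)
    from left[OF this] have fz: "f z \<noteq> 0" and v: "norm (f' z / f z) * norm t ^ n \<le> B"
      unfolding tz T_def by (auto simp: norm_divide field_simps)
    have "norm (poly \<psi> t) \<ge> \<delta>"
      unfolding \<psi> prod_norm[symmetric] \<delta>_def
    proof (rule prod_mono)
      fix a assume a: "a \<in> Z"
      then have "norm a > 0" by (auto simp: Z_def)
      have "norm t * (2 / norm a) \<le> norm t * R" using R(3)[OF a] by (intro mult_left_mono) auto
      also have "\<dots> \<le> 1" using t R1 by (simp add: field_simps)
      finally have "norm t \<le> norm a / 2" using \<open>norm a > 0\<close> by (simp add: field_simps)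
      then show "0 \<le> norm a / 2 \<and> norm a / 2 \<le> norm (t - a)"
        using norm_triangle_ineq2[of a t] by (auto simp: norm_minus_commute)
    qed
    then have "norm (t * poly (pderiv \<psi>) t / poly \<psi> t) \<le> norm t * norm (poly (pderiv \<psi>) t) / \<delta>"
      unfolding norm_mult norm_divide using \<delta> by (intro divide_left_mono mult_pos_pos) auto
    also have "\<dots> \<le> 1 * B1 / \<delta>"
      using B1(2)[OF t1] t1 \<delta> by (intro divide_right_mono mult_mono) auto
    finally have 1: "norm (t * poly (pderiv \<psi>) t / poly \<psi> t) \<le> B1 / \<delta>" by simp
    have tm: "norm t ^ m \<le> norm t ^ n" "norm t ^ m \<le> 1"
      by (rule power_decreasing; use t1 in \<open>simp add: m_def\<close>) (rule power_le_one; use t1 in simp)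
    have v': "norm (f' z / f z) * norm t ^ m \<le> B"
      using v mult_left_mono[OF tm(1), of "norm (f' z / f z)"] by simp
    have "norm (f' z / f z - c0) * norm t ^ m \<le> (norm (f' z / f z) + norm c0) * norm t ^ m"
      by (intro mult_right_mono norm_triangle_ineq4) auto
    also have "\<dots> \<le> \<bar>B\<bar> + norm c0"
      using v' mult_left_mono[OF tm(2), of "norm c0"] by (simp add: ring_distribs)
    finally have 2: "norm (of_nat p * (f' z / f z - c0)) * norm t ^ m \<le> p * (\<bar>B\<bar> + norm c0)"
      unfolding norm_mult by (simp add: mult_left_mono mult.assoc)
    have "norm (\<Lambda> t) * norm t ^ m \<le>
        (norm (of_nat p * (f' z / f z - c0)) + norm (t * poly (pderiv \<psi>) t / poly \<psi> t)) * norm t ^ m"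
      unfolding tz \<Lambda>[OF fz] unfolding tz[symmetric]
      by (intro mult_right_mono norm_triangle_ineq4) auto
    also have "\<dots> \<le> p * (\<bar>B\<bar> + norm c0) + B1 / \<delta> * 1"
      unfolding ring_distribs(2) by (rule add_mono[OF 2 mult_mono[OF 1 tm(2)]]) (use B1_nn \<delta> in auto)
    also have "\<dots> \<le> C" unfolding C_def using B1_nn by simp
    finally show ?thesis .
  qed
  obtain G where G: "\<And>t. t \<noteq> 0 \<Longrightarrow> t ^ Suc m * \<Lambda> t = poly G t"
    using laurent_if_growth[OF \<Lambda>_hol out inn less_le_trans[OF zero_less_one R1]] by blast
  obtain h h' \<mu> where h: "laurent_polynomial h"
    and h': "\<And>t. t \<noteq> 0 \<Longrightarrow> (h has_field_derivative h' t) (at t)"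
    and Gh: "\<And>t. t \<noteq> 0 \<Longrightarrow> poly G t = t ^ Suc m * (t * h' t + \<mu>)"
    using laurent_primitive[of G "Suc m"] by blast
  have \<Lambda>h: "\<Lambda> t = t * h' t + \<mu>" if "t \<noteq> 0" for t
    using G[OF that] Gh[OF that] that by simp
  \<comment> \<open>\<open>Y\<close> divides \<open>G1\<close> by a function with the same
    logarithmic derivative; in the coordinate z the power t^\<mu> is single valued.\<close>
  define Y where "Y z = G1 (T z) * exp (- h (T z) - \<mu> * z / of_nat p)" for z
  have "(Y has_field_derivative 0) (at z)" for z
  proof -
    have D: "(Y has_field_derivative (deriv G1 (T z) * (T z / of_nat p)) * exp (- h (T z) - \<mu> * z / of_nat p)
        + (exp (- h (T z) - \<mu> * z / of_nat p) * (- (h' (T z) * (T z / of_nat p)) - \<mu> / of_nat p)) * G1 (T z)) (at z)"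
      unfolding Y_def[abs_def]
      by (rule derivative_eq_intros DERIV_chain2[OF G1' T'] DERIV_chain2[OF h' T'] T_nz refl | simp add: p)+
    have "T z * deriv G1 (T z) = (T z * h' (T z) + \<mu>) * G1 (T z)"
      unfolding \<Lambda>h[OF T_nz, symmetric] \<Lambda>_def using G1_nz[OF T_nz] by simp
    then have eq: "deriv G1 (T z) * (T z / of_nat p) = (T z * h' (T z) + \<mu>) * G1 (T z) / of_nat p"
      by (simp add: mult.commute)
    show ?thesis
      by (rule DERIV_cong[OF D], unfold eq) (use p in \<open>simp add: field_simps\<close>)
  qed
  then obtain c1 where c1: "\<And>z. Y z = c1"
    using has_field_derivative_zero_constant[of UNIV Y] by auto
  have G1_eq: "G1 (T z) = c1 * exp (h (T z)) * exp (\<mu> / of_nat p * z)" for z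
    using c1[of z] unfolding Y_def by (auto simp: exp_diff exp_minus field_simps)
  have c1_nz: "c1 \<noteq> 0" using G1_eq[of 0] G1_nz[OF T_nz, of 0] by auto
  \<comment> \<open>The constant \<open>c1\<close> goes into the polynomial. \<open>M\<close> and
    \<open>N\<close> come from p f'/f = p c0 + t \<psi>'/\<psi> + \<Lambda>, multiplied by t^{m+1}
    \<psi>, where t^{m+1} \<Lambda> = G.\<close>
  show ?thesis
  proof (rule that[of "smult c1 \<psi>" h "c0 + \<mu> / of_nat p" "smult (of_nat p) (monom 1 (Suc m) * \<psi>)"
        "smult (c0 * of_nat p) (monom 1 (Suc m) * \<psi>) + monom 1 (Suc (Suc m)) * pderiv \<psi> + G * \<psi>"])
    show "rsquarefree (smult c1 \<psi>)"
      using sqf c1_nz unfolding rsquarefree_roots by (simp add: pderiv_smult)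
    show "laurent_polynomial h" by (rule h)
    show "f z = poly (smult c1 \<psi>) (exp (z / of_nat p)) * exp ((c0 + \<mu> / of_nat p) * z) * exp (h (exp (z / of_nat p)))" for z
      unfolding T_def[symmetric] fF F\<psi>[OF T_nz] G1_eq by (simp add: exp_add ring_distribs)
    show "poly (smult (of_nat p) (monom 1 (Suc m) * \<psi>)) (exp (z / of_nat p)) \<noteq> 0" if "f z \<noteq> 0" for z
      using that p F\<psi>[OF T_nz] unfolding T_def[symmetric] fF by (auto simp: poly_monom)
    show "poly (smult (of_nat p) (monom 1 (Suc m) * \<psi>)) (exp (z / of_nat p)) * f' z =
      poly (smult (c0 * of_nat p) (monom 1 (Suc m) * \<psi>) + monom 1 (Suc (Suc m)) * pderiv \<psi> + G * \<psi>) (exp (z / of_nat p)) * f z" for z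
    proof -
      let ?t = "T z"
      have "f' z = c0 * f z + exp (c0 * z) * ((poly (pderiv \<psi>) ?t * G1 ?t + poly \<psi> ?t * deriv G1 ?t) * (?t / of_nat p))"
        unfolding f' dF[OF T_nz] ..
      then have A: "of_nat p * f' z = c0 * of_nat p * f z
          + exp (c0 * z) * (?t * poly (pderiv \<psi>) ?t * G1 ?t + poly \<psi> ?t * (?t * deriv G1 ?t))"
        using p by (simp add: field_simps)
      have Bq: "?t ^ Suc m * (?t * deriv G1 ?t) = poly G ?t * G1 ?t"
        using G[OF T_nz, of z] G1_nz[OF T_nz, of z] unfolding \<Lambda>_def by (simp add: field_simps)
      have "?t ^ Suc m * poly \<psi> ?t * (of_nat p * f' z) = ?t ^ Suc m * poly \<psi> ?t * (c0 * of_nat p * f z)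
          + exp (c0 * z) * poly \<psi> ?t * (?t ^ Suc m * ?t * poly (pderiv \<psi>) ?t * G1 ?t + poly \<psi> ?t * (?t ^ Suc m * (?t * deriv G1 ?t)))"
        unfolding A by (simp only: ring_distribs mult_ac)
      also have "\<dots> = (c0 * of_nat p * (?t ^ Suc m * poly \<psi> ?t) + ?t ^ Suc m * ?t * poly (pderiv \<psi>) ?t + poly G ?t * poly \<psi> ?t) * f z"
        unfolding Bq fF F\<psi>[OF T_nz] by (simp only: ring_distribs mult_ac add_ac)
      finally show ?thesis
        unfolding T_def[symmetric] by (simp add: poly_monom mult_ac)
    qed
  qed
qed

text \<open>Bounded coefficients near \<open>Re z = - \<infinity>\<close> mean a regular singular point at \<open>t = 0\<close>:
  \<open>F\<close> has at most polynomial growth there, hence no essential singularity.\<close>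

lemma regular_end_bounds:
  fixes f f' :: "complex \<Rightarrow> complex" and p :: nat and M :: real
  assumes sol: "ode_sol Q f f'" and nz: "f z0 \<noteq> 0" and p: "p > 0"
    and per: "\<And>z. f (z + of_real (2 * pi) * \<i> * of_nat p) = c * f z"
    and M: "\<And>z. Re z \<le> 0 \<Longrightarrow> norm (Q z) \<le> M"
  obtains r B where "\<And>z. Re z \<le> - r \<Longrightarrow> f z \<noteq> 0 \<and> norm (f' z) \<le> B * norm (f z)"
proof -
  define T where "T z = exp (z / of_nat p)" for z :: complex
  have T_nz [simp]: "T z \<noteq> 0" for z by (simp add: T_def)
  have T_Ln: "T (of_nat p * Ln t) = t" if "t \<noteq> 0" for t using that p by (simp add: T_def)
  have T': "(T has_field_derivative T z / of_nat p) (at z)" for z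
    unfolding T_def[abs_def] using p by (auto intro!: derivative_eq_intros)
  have normT: "norm (T z) = exp (Re z / p)" for z by (simp add: T_def norm_exp_eq_Re)
  obtain \<gamma> F where F: "F holomorphic_on - {0}" and fF: "\<And>z. f z = exp (\<gamma> * z) * F (T z)"
    unfolding T_def by (rule multiplicatively_periodic_factor[OF ode_sol_holomorphic(1)[OF sol] nz p per]) blast
  have M0: "0 \<le> M" using M[of 0] by (simp add: order_trans[OF norm_ge_zero])
  define A where "A = sqrt ((norm (f 0))\<^sup>2 + (norm (f' 0))\<^sup>2)"
  define \<beta> where "\<beta> = (1 + M) / 2 + norm \<gamma>"
  have \<beta>: "\<beta> > 0" unfolding \<beta>_def using M0 by (intro add_pos_nonneg) auto
  have growth: "norm (F (T z)) \<le> A * exp (\<beta> * norm z)" if z: "Re z \<le> 0" for z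
  proof -
    have "norm (Q s) \<le> M" if "s \<in> closed_segment 0 z" for s
      using that z by (intro M) (auto simp: closed_segment_def mult_nonneg_nonpos)
    from ode_growth[OF sol this, of 0 z]
    have "(norm (f z))\<^sup>2 + (norm (f' z))\<^sup>2 \<le> A\<^sup>2 * exp ((1 + M) * norm z)"
      unfolding A_def by simp
    then have "(norm (f z))\<^sup>2 \<le> A\<^sup>2 * exp ((1 + M) * norm z)"
      using zero_le_power2[of "norm (f' z)"] by linarith
    also have "\<dots> = (A * exp ((1 + M) / 2 * norm z))\<^sup>2"
      by (simp add: power_mult_distrib exp_double[symmetric])
    finally have fz: "norm (f z) \<le> A * exp ((1 + M) / 2 * norm z)"
      by (rule power2_le_imp_le) (simp add: A_def)
    have "F (T z) = f z * exp (- \<gamma> * z)" by (simp add: fF exp_minus)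
    also have "norm \<dots> \<le> (A * exp ((1 + M) / 2 * norm z)) * exp (norm \<gamma> * norm z)"
      unfolding norm_mult
    proof (rule mult_mono[OF fz])
      have "Re (- \<gamma> * z) \<le> norm (- \<gamma> * z)" by (rule complex_Re_le_cmod)
      then show "norm (exp (- \<gamma> * z)) \<le> exp (norm \<gamma> * norm z)"
        by (simp add: norm_exp_eq_Re norm_mult)
    qed (auto simp: A_def)
    also have "\<dots> = A * exp (\<beta> * norm z)" unfolding \<beta>_def by (simp add: ring_distribs exp_add)
    finally show ?thesis .
  qed
  \<comment> \<open>For z = p Ln t with the principal logarithm, |z| \<le> - p log|t| + p pi, so
    growth e^{\<beta>|z|} is of order |t|^{-\<beta> p}.\<close>
  obtain n :: nat where n: "real n \<ge> \<beta> * p" using real_arch_simple by blast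
  define B0 where "B0 = A * exp (\<beta> * (p * pi))"
  have bound: "norm (F t) * norm t ^ n \<le> B0" if t: "t \<noteq> 0" "norm t \<le> 1" for t
  proof -
    define z where "z = of_nat p * Ln t"
    have Re_z: "Re z = p * ln (norm t)" using t by (simp add: z_def)
    have ln0: "ln (norm t) \<le> 0" using t by simp
    have "Re z \<le> 0" unfolding Re_z using ln0 by (simp add: mult_nonneg_nonpos)
    have "\<bar>Im (Ln t)\<bar> \<le> pi" using Im_Ln_le_pi[OF t(1)] mpi_less_Im_Ln[OF t(1)] by linarith
    then have "\<bar>Im z\<bar> \<le> p * pi" unfolding z_def by (simp add: abs_mult mult_left_mono)
    then have "norm z \<le> - (p * ln (norm t)) + p * pi"
      using cmod_le[of z] \<open>Re z \<le> 0\<close> Re_z by linarith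
    then have "\<beta> * norm z \<le> \<beta> * (- (p * ln (norm t)) + p * pi)" using \<beta> by (intro mult_left_mono) auto
    also have "\<dots> = (\<beta> * p) * (- ln (norm t)) + \<beta> * (p * pi)" by (simp add: algebra_simps)
    also have "\<dots> \<le> n * (- ln (norm t)) + \<beta> * (p * pi)"
      using ln0 n by (intro add_right_mono mult_right_mono) auto
    finally have e: "\<beta> * norm z \<le> - (n * ln (norm t)) + \<beta> * (p * pi)" by simp
    have "norm (F t) \<le> A * exp (\<beta> * norm z)"
      using growth[OF \<open>Re z \<le> 0\<close>] T_Ln[OF t(1)] unfolding z_def by simp
    also have "\<dots> \<le> A * exp (- (n * ln (norm t)) + \<beta> * (p * pi))"
      using e by (intro mult_left_mono) (auto simp: A_def)
    also have "\<dots> = B0 / norm t ^ n"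
    proof -
      have "exp (n * ln (norm t)) = norm t ^ n" using t by (simp add: exp_of_nat_mult)
      then show ?thesis unfolding B0_def by (simp add: exp_diff)
    qed
    finally show ?thesis using t by (simp add: field_simps)
  qed
  define H where "H t = t ^ Suc n * F t" for t
  have H: "H holomorphic_on UNIV"
    unfolding H_def[abs_def] by (rule holomorphic_extension_at_0[OF F zero_less_one, of n B0]) (use bound in auto)
  have "H 0 = 0" by (simp add: H_def)
  have nonconst: "\<not> H constant_on UNIV"
  proof
    assume "H constant_on UNIV"
    then have "H (T z0) = H 0" by (force simp: constant_on_def)
    then show False using nz by (simp add: H_def fF)
  qed
  \<comment> \<open>With the zero of \<open>H\<close> at 0 factored out, \<open>f\<close> is
    e^{\<eta> z} times a function of t that is holomorphic and nonzero at 0, so \<open>f'/f\<close>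
    stays bounded at the left end.\<close>
  obtain G d m where d: "0 < d" and G: "G holomorphic_on ball 0 d"
    and HG: "\<And>w. w \<in> ball 0 d \<Longrightarrow> H w = (w - 0) ^ m * G w" and G_nz: "\<And>w. w \<in> ball 0 d \<Longrightarrow> G w \<noteq> 0"
    by (rule holomorphic_factor_zero_nonconstant[OF H open_UNIV connected_UNIV UNIV_I \<open>H 0 = 0\<close> nonconst]) metis
  define \<eta> where "\<eta> = \<gamma> + (of_nat m - of_nat (Suc n)) / of_nat p"
  have f_eq: "f z = exp (\<eta> * z) * G (T z)" if "T z \<in> ball 0 d" for z
  proof -
    have "T z ^ Suc n * F (T z) = T z ^ m * G (T z)" using HG[OF that] by (simp add: H_def)
    then have "F (T z) = T z ^ m / T z ^ Suc n * G (T z)" by (simp add: field_simps)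
    also have "T z ^ m / T z ^ Suc n = exp ((of_nat m - of_nat (Suc n)) / of_nat p * z)"
      unfolding T_def exp_of_nat_mult[symmetric] exp_diff[symmetric] using p
      by (simp add: field_simps)
    finally have F_eq: "F (T z) = exp ((of_nat m - of_nat (Suc n)) / of_nat p * z) * G (T z)" .
    show ?thesis unfolding fF F_eq \<eta>_def ring_distribs exp_add by simp
  qed
  have G': "(G has_field_derivative deriv G t) (at t)" if "t \<in> ball 0 d" for t
    using G that by (intro holomorphic_derivI[of G "ball 0 d"]) auto
  have f'_eq: "f' z = (\<eta> + T z * deriv G (T z) / (of_nat p * G (T z))) * f z" if tz: "T z \<in> ball 0 d" for z
  proof -
    have D: "((\<lambda>z. exp (\<eta> * z) * G (T z)) has_field_derivative
        \<eta> * exp (\<eta> * z) * G (T z) + deriv G (T z) * (T z / of_nat p) * exp (\<eta> * z)) (at z)"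
      by (rule derivative_eq_intros DERIV_chain2[OF G' T'] tz refl | simp)+
    have ev: "\<forall>\<^sub>F w in nhds z. exp (\<eta> * w) * G (T w) = f w"
    proof -
      have "open (T -` ball 0 d)"
        unfolding T_def[abs_def] using p by (intro open_vimage continuous_intros) auto
      then have "\<forall>\<^sub>F w in nhds z. w \<in> T -` ball 0 d" using tz by (intro eventually_nhds_in_open) auto
      then show ?thesis by eventually_elim (simp add: f_eq)
    qed
    have e1: "f' z = \<eta> * exp (\<eta> * z) * G (T z) + deriv G (T z) * (T z / of_nat p) * exp (\<eta> * z)"
      by (rule DERIV_unique[OF ode_solD(1)[OF sol] DERIV_cong_ev[OF refl ev refl, THEN iffD1, OF D]])
    show ?thesis unfolding e1 f_eq[OF tz] using G_nz[OF tz] p by (simp add: field_simps)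
  qed
  have sub: "cball 0 (d / 2) \<subseteq> ball (0 :: complex) d" using d by auto
  have "continuous_on (cball 0 (d / 2)) G" "continuous_on (cball 0 (d / 2)) (deriv G)"
    using continuous_on_subset[OF holomorphic_on_imp_continuous_on sub] G holomorphic_deriv[OF G]
    by auto
  then have "continuous_on (cball 0 (d / 2)) (\<lambda>t. \<eta> + t * deriv G t / (of_nat p * G t))"
    using G_nz sub p by (intro continuous_intros) auto
  then have "compact ((\<lambda>t. \<eta> + t * deriv G t / (of_nat p * G t)) ` cball 0 (d / 2))"
    by (intro compact_continuous_image) auto
  then obtain B where B: "\<And>t. t \<in> cball 0 (d / 2) \<Longrightarrow> norm (\<eta> + t * deriv G t / (of_nat p * G t)) \<le> B"
    by (meson bounded_iff compact_imp_bounded imageI)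
  show ?thesis
  proof (rule that)
    fix z assume z: "Re z \<le> - (p * \<bar>ln (d / 2)\<bar>)"
    have "Re z / p \<le> - \<bar>ln (d / 2)\<bar>" using z p by (simp add: field_simps)
    then have "Re z / p \<le> ln (d / 2)" by linarith
    then have "norm (T z) \<le> d / 2" unfolding normT using d by (subst ln_ge_iff[symmetric]) auto
    then have t: "T z \<in> cball 0 (d / 2)" "T z \<in> ball 0 d" using d by auto
    show "f z \<noteq> 0 \<and> norm (f' z) \<le> B * norm (f z)"
    proof
      show "f z \<noteq> 0" using f_eq[OF t(2)] G_nz[OF t(2)] by simp
      show "norm (f' z) \<le> B * norm (f z)"
        unfolding f'_eq[OF t(2)] norm_mult by (intro mult_right_mono B t) auto
    qed
  qed
qed

section \<open>Non-oscillatory solutions of the Hill equation\<close>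

definition hillQ :: "nat \<Rightarrow> nat \<Rightarrow> (int \<Rightarrow> complex) \<Rightarrow> complex \<Rightarrow> complex" where
  "hillQ k l b z = K k l b (exp z) (exp (- z))"

lemma hillQ_holomorphic: "hillQ k l b holomorphic_on S"
  unfolding hillQ_def[abs_def] K_def by (intro holomorphic_intros)

lemma hillQ_cont: "continuous_on S (hillQ k l b)"
  by (rule holomorphic_on_imp_continuous_on[OF hillQ_holomorphic])

lemma hillQ_periodic: "hillQ k l b (z + of_real (2 * pi) * \<i> * of_nat p) = hillQ k l b z"
proof -
  have "exp (of_real (2 * pi) * \<i> * of_nat p :: complex) = 1"
    using exp_eq_1 by (auto simp: exp_eq_1 intro!: exI[of _ "int p"])
  then have e: "exp (z + of_real (2 * pi) * \<i> * of_nat p) = exp z" by (simp add: exp_add)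
  show ?thesis unfolding hillQ_def exp_minus e ..
qed

text \<open>The constant term \<open>b 0\<close> sits in the first sum only and has to change sides.
  This is the symmetry behind z -> - z, which exchanges the two ends.\<close>

lemma K_swap: "K k l b x y = K l k (\<lambda>i. b (- i)) y x"
proof -
  have 1: "(\<Sum>j=0..k. b (int j) * x ^ j) = b 0 + (\<Sum>j=1..k. b (int j) * x ^ j)"
    by (simp add: sum.atLeast_Suc_atMost)
  have 2: "(\<Sum>j=0..l. b (- int j) * y ^ j) = b 0 + (\<Sum>j=1..l. b (- int j) * y ^ j)"
    by (simp add: sum.atLeast_Suc_atMost)
  show ?thesis unfolding K_def 1 2 by simp
qed

lemma hillQ_reflect: "hillQ k l b (- z) = hillQ l k (\<lambda>i. b (- i)) z"
  unfolding hillQ_def by (subst K_swap) simp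

lemma K_bounded:
  assumes "norm x \<le> 1" "norm y \<le> 1"
  shows "norm (K k l b x y) \<le> (\<Sum>j=0..k. norm (b (int j))) + (\<Sum>j=1..l. norm (b (- int j)))"
  unfolding K_def using assms
  by (intro order_trans[OF norm_triangle_ineq] add_mono order_trans[OF norm_sum] sum_mono)
     (auto simp: norm_mult norm_power intro!: mult_left_le power_le_one)

text \<open>All terms except the leading one are bounded by C |x|^{k-1} once |x| \<ge> 1, so the
  relative error is O(1/|x|), uniformly in the imaginary part.\<close>

lemma hillQ_asymptotic:
  assumes k: "k \<ge> 1" and bk: "b (int k) \<noteq> 0" and \<epsilon>: "\<epsilon> > 0"
  shows "\<exists>r. \<forall>z. Re z \<ge> r \<longrightarrow>
    norm (hillQ k l b z / (csqrt (b (int k)) * exp (of_real (real k / 2) * z))\<^sup>2 - 1) \<le> \<epsilon>"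
proof -
  define C where "C = (\<Sum>j<k. norm (b (int j))) + (\<Sum>j=1..l. norm (b (- int j)))"
  have C: "C \<ge> 0" unfolding C_def by (intro add_nonneg_nonneg sum_nonneg) auto
  define r where "r = max 0 (ln ((C + 1) / (\<epsilon> * norm (b (int k)))))"
  show ?thesis
  proof (intro exI allI impI)
    fix z :: complex assume z: "Re z \<ge> r"
    define x where "x = exp z"
    have x: "x \<noteq> 0" "norm x = exp (Re z)" by (auto simp: x_def norm_exp_eq_Re)
    have x1: "norm x \<ge> 1" using z unfolding x r_def by simp
    have pos: "(C + 1) / (\<epsilon> * norm (b (int k))) > 0" using C \<epsilon> bk by simp
    have "ln ((C + 1) / (\<epsilon> * norm (b (int k)))) \<le> Re z" using z unfolding r_def by simp
    then have "(C + 1) / (\<epsilon> * norm (b (int k))) \<le> norm x"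
      unfolding x(2) using pos by (metis exp_le_cancel_iff exp_ln)
    then have xC: "C + 1 \<le> \<epsilon> * norm (b (int k)) * norm x" using \<epsilon> bk by (simp add: field_simps)
    have den: "(csqrt (b (int k)) * exp (of_real (real k / 2) * z))\<^sup>2 = b (int k) * x ^ k"
      unfolding power_mult_distrib x_def exp_of_nat_mult[symmetric] exp_double[symmetric] by simp
    have xk: "norm x ^ k = norm x * norm x ^ (k - 1)" using k by (metis Suc_diff_1 less_le_trans power_Suc zero_less_one)
    have "hillQ k l b z = b (int k) * x ^ k + ((\<Sum>j<k. b (int j) * x ^ j) + (\<Sum>j=1..l. b (- int j) * exp (- z) ^ j))"
    proof -
      have "{0..k} = insert k {..<k}" by auto
      then show ?thesis unfolding hillQ_def K_def x_def[symmetric] by simp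
    qed
    then have "hillQ k l b z / (b (int k) * x ^ k) - 1
        = ((\<Sum>j<k. b (int j) * x ^ j) + (\<Sum>j=1..l. b (- int j) * exp (- z) ^ j)) / (b (int k) * x ^ k)"
      using bk x by (simp add: field_simps)
    also have "norm \<dots> \<le> C * norm x ^ (k - 1) / (norm (b (int k)) * norm x ^ k)"
      unfolding norm_divide norm_mult norm_power
    proof (rule divide_right_mono)
      have "norm (\<Sum>j<k. b (int j) * x ^ j) \<le> (\<Sum>j<k. norm (b (int j)) * norm x ^ (k - 1))"
        using x1 by (intro order_trans[OF norm_sum] sum_mono)
           (auto simp: norm_mult norm_power intro!: mult_left_mono power_increasing)
      moreover have "norm (\<Sum>j=1..l. b (- int j) * exp (- z) ^ j) \<le> (\<Sum>j=1..l. norm (b (- int j)) * norm x ^ (k - 1))"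
      proof (intro order_trans[OF norm_sum] sum_mono)
        fix j
        have "norm (exp (- z) ^ j) \<le> 1" using x1 unfolding x(2) norm_power
          by (intro power_le_one) (auto simp: norm_exp_eq_Re)
        also have "1 \<le> norm x ^ (k - 1)" using x1 by (rule one_le_power)
        finally show "norm (b (- int j) * exp (- z) ^ j) \<le> norm (b (- int j)) * norm x ^ (k - 1)"
          unfolding norm_mult by (intro mult_left_mono) auto
      qed
      ultimately show "norm ((\<Sum>j<k. b (int j) * x ^ j) + (\<Sum>j=1..l. b (- int j) * exp (- z) ^ j)) \<le> C * norm x ^ (k - 1)"
        unfolding C_def ring_distribs sum_distrib_right by (rule norm_triangle_le[OF add_mono])
    qed simp
    also have "\<dots> = C / (norm (b (int k)) * norm x)" unfolding xk using x by simp
    also have "\<dots> \<le> \<epsilon>" using xC x bk by (simp add: field_simps)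
    finally show "norm (hillQ k l b z / (csqrt (b (int k)) * exp (of_real (real k / 2) * z))\<^sup>2 - 1) \<le> \<epsilon>"
      unfolding den .
  qed
qed

lemma hill_wkb:
  assumes "ode_sol (hillQ k l b) f f'" "f z0 \<noteq> 0" "k \<ge> 1" "b (int k) \<noteq> 0"
  shows "wkb (hillQ k l b) f f' (csqrt (b (int k))) (real k)"
  using assms hillQ_asymptotic[of k b] by unfold_locales (auto simp: hillQ_cont)

text \<open>The parity conditions originate here: the half in the exponent of \<open>g\<close> turns
  a full period of the potential into the sign (-1)^k.\<close>

lemma wkb_g_translate:
  assumes "wkb Q f f' a (real k)"
  shows "wkb.g a (real k) (z + of_real (2 * pi) * \<i> * of_nat p) = (- 1) ^ (k * p) * wkb.g a (real k) z"
proof -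
  have "exp (of_real (real k / 2) * (of_real (2 * pi) * \<i> * of_nat p)) = exp (of_nat (k * p) * (of_real pi * \<i>))"
    by (simp add: mult_ac)
  also have "\<dots> = (- 1) ^ (k * p)" unfolding exp_of_nat_mult by simp
  finally show ?thesis unfolding wkb.g_add[OF assms] by (simp add: mult.commute)
qed

lemma non_oscillatory_summable:
  assumes f: "f holomorphic_on UNIV" "f z0 \<noteq> 0" and no: "non_oscillatory f"
  obtains s where "s > 0" "(\<lambda>z. 1 / norm z powr s) summable_on {z. z \<noteq> 0 \<and> f z = 0}"
proof -
  obtain s where s: "s > 0" and summ: "(\<lambda>z. real_of_int (zorder f z) / norm z powr s) summable_on {z. z \<noteq> 0 \<and> f z = 0}"
    using no unfolding non_oscillatory_def exponent_of_convergence_def Inf_less_iff by blast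
  have "(\<lambda>z. 1 / norm z powr s) summable_on {z. z \<noteq> 0 \<and> f z = 0}"
  proof (rule summable_on_comparison_test[OF summ])
    fix z assume "z \<in> {z. z \<noteq> 0 \<and> f z = 0}"
    then have z: "z \<noteq> 0" "f z = 0" by auto
    have "zorder f z > 0"
    proof (rule zorder_pos_iff'[THEN iffD2])
      show "f analytic_on {z}" using f(1) analytic_at by blast
      have "\<forall>\<^sub>F w in at z. f w \<noteq> 0 \<and> w \<in> UNIV"
        by (rule non_zero_neighbour_alt[OF f(1) open_UNIV connected_UNIV UNIV_I UNIV_I f(2)])
      then show "\<exists>\<^sub>F w in at z. f w \<noteq> 0"
        by (intro eventually_frequently) (auto elim: eventually_mono)
      show "f z = 0" by (rule z)
    qed
    then show "1 / norm z powr s \<le> real_of_int (zorder f z) / norm z powr s"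
      by (intro divide_right_mono) auto
  qed auto
  then show ?thesis using s that by blast
qed

lemma ode_sol_translate_deriv:
  assumes sol: "ode_sol Q f f'" and per: "\<And>z. f (z + w) = c * f z"
  shows "f' (z + w) = c * f' z"
proof -
  have s: "((\<lambda>z. z + w) has_field_derivative 1) (at z)"
    by (auto intro!: derivative_eq_intros)
  have "((\<lambda>z. f (z + w)) has_field_derivative f' (z + w)) (at z)"
    using DERIV_chain2[OF ode_solD(1)[OF sol] s] by simp
  moreover have "((\<lambda>z. f (z + w)) has_field_derivative c * f' z) (at z)"
    unfolding per by (rule DERIV_cmult[OF ode_solD(1)[OF sol]])
  ultimately show ?thesis by (rule DERIV_unique)
qed

context wkb
begin

text \<open>\<open>f'/f\<close> is invariant under the translation while \<open>g\<close> changes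
  sign, so the quotient would have to be near both \<sigma> and -\<sigma>.\<close>

lemma no_antiperiodic_translate:
  assumes \<sigma>: "\<sigma> = 1 \<or> \<sigma> = - 1" and f_nz: "\<And>z. Re z \<ge> r \<Longrightarrow> f z \<noteq> 0"
    and asy: "\<And>z. Re z \<ge> r \<Longrightarrow> norm (f' z / (f z * g z) - \<sigma>) < 1 / 2"
    and per: "\<And>z. f (z + w) = c * f z" and w: "Re w = 0" and gw: "\<And>z. g (z + w) = - g z"
  shows False
proof -
  define z where "z = complex_of_real r"
  have z: "Re z \<ge> r" "Re (z + w) \<ge> r" using w by (auto simp: z_def)
  have c: "c \<noteq> 0" using f_nz[OF z(2)] per by auto
  define \<phi> where "\<phi> = f' z / (f z * g z)"
  have "f' (z + w) / (f (z + w) * g (z + w)) = - \<phi>"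
    unfolding per gw ode_sol_translate_deriv[OF sol per] \<phi>_def using c by simp
  then have "norm (- \<phi> - \<sigma>) < 1 / 2" using asy[OF z(2)] by simp
  moreover have "norm (\<phi> - \<sigma>) < 1 / 2" using asy[OF z(1)] unfolding \<phi>_def .
  ultimately have "norm ((- \<phi> - \<sigma>) + (\<phi> - \<sigma>)) < 1"
    using norm_triangle_ineq[of "- \<phi> - \<sigma>" "\<phi> - \<sigma>"] by linarith
  then show False using \<sigma> by auto
qed

end

lemma norm_exp_power: "norm (exp (z / of_nat p)) ^ n = exp (real n * (Re z / real p))"
proof -
  have "Re (z / of_nat p) = Re z / real p" by simp
  then show ?thesis by (simp only: norm_exp_eq_Re exp_of_nat_mult)
qed

text \<open>\<open>l\<close> is the largest index of a negative power that really occurs. So either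
  the left end is regular, with \<open>l = 0\<close>, or the reflected equation satisfies the same
  assumptions with \<open>k\<close> and \<open>l\<close> exchanged.\<close>

locale nonosc_hill =
  fixes k l :: nat and b :: "int \<Rightarrow> complex" and f f' :: "complex \<Rightarrow> complex" and z0 :: complex and s :: real
  assumes sol: "ode_sol (hillQ k l b) f f'" and nz: "f z0 \<noteq> 0"
    and k: "k \<ge> 1" "b (int k) \<noteq> 0" and l: "l = 0 \<or> b (- int l) \<noteq> 0"
    and s: "s > 0" and summ: "(\<lambda>z. 1 / norm z powr s) summable_on {z. z \<noteq> 0 \<and> f z = 0}"
begin

definition shift :: "nat \<Rightarrow> complex" where "shift p = of_real (2 * pi) * \<i> * of_nat p"

lemma Re_shift [simp]: "Re (shift p) = 0" by (simp add: shift_def)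

sublocale R: wkb "hillQ k l b" f f' "csqrt (b (int k))" "real k"
  by (rule hill_wkb[OF sol nz k])

lemma reflected:
  assumes "l \<ge> 1"
  shows "nonosc_hill l k (\<lambda>i. b (- i)) (\<lambda>z. f (- z)) (\<lambda>z. - f' (- z)) (- z0) s"
proof
  show "ode_sol (hillQ l k (\<lambda>i. b (- i))) (\<lambda>z. f (- z)) (\<lambda>z. - f' (- z))"
    using ode_sol_reflect[OF sol] unfolding hillQ_reflect .
  have "(\<lambda>z. 1 / norm z powr s) summable_on uminus ` {z. z \<noteq> 0 \<and> f (- z) = 0}"
    by (rule summable_on_subset_banach[OF summ]) auto
  then show "(\<lambda>z. 1 / norm z powr s) summable_on {z. z \<noteq> 0 \<and> f (- z) = 0}"
    by (subst (asm) summable_on_reindex) (auto simp: o_def inj_on_def)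
qed (use assms nz k l s in auto)

lemma g_shift: "R.g (z + shift p) = (- 1) ^ (k * p) * R.g z"
  unfolding shift_def by (rule wkb_g_translate[OF R.wkb_axioms])

lemma hillQ_shift: "hillQ k l b (z + shift p) = hillQ k l b z"
  unfolding shift_def by (rule hillQ_periodic)

lemma right_end:
  obtains r \<sigma> where "\<sigma> = 1 \<or> \<sigma> = - 1" "\<And>z. Re z \<ge> r \<Longrightarrow> f z \<noteq> 0"
    "\<And>z. Re z \<ge> r \<Longrightarrow> norm (f' z / (f z * R.g z) - \<sigma>) < 1 / 2"
  by (rule R.wkb_asymptotics[OF s summ]) (rule that)

lemma translate_multiple:
  assumes "even (k * p)"
  obtains c where "\<And>z. f (z + shift p) = c * f z"
proof -
  obtain r \<sigma> where *: "\<sigma> = 1 \<or> \<sigma> = - 1" "\<And>z. Re z \<ge> r \<Longrightarrow> f z \<noteq> 0"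
    "\<And>z. Re z \<ge> r \<Longrightarrow> norm (f' z / (f z * R.g z) - \<sigma>) < 1 / 2"
    by (rule right_end) (rule that)
  have g: "R.g (z + shift p) = R.g z" for z using g_shift[of z p] assms by simp
  show ?thesis
    by (rule R.translate_multiple[OF * hillQ_shift g Re_shift], assumption, assumption, rule that)
qed

text \<open>Reflection reverses the translation, so the multiplier found at the left end has to be
  inverted.\<close>

lemma translate_multiple_left:
  assumes l1: "l \<ge> 1" and ev: "even (l * p)"
  obtains c where "\<And>z. f (z + shift p) = c * f z"
proof -
  interpret L: nonosc_hill l k "\<lambda>i. b (- i)" "\<lambda>z. f (- z)" "\<lambda>z. - f' (- z)" "- z0" s
    by (rule reflected[OF l1])
  obtain c where c: "\<And>z. f (- (z + shift p)) = c * f (- z)"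
    by (rule L.translate_multiple[OF ev]) (rule that)
  have inv: "f z = c * f (z + shift p)" for z
  proof -
    have "- (- (z + shift p) + shift p) = z" by simp
    then show ?thesis using c[of "- (z + shift p)"] by (metis minus_minus)
  qed
  have "c \<noteq> 0" using inv[of z0] nz by auto
  then have "f (z + shift p) = inverse c * f z" for z by (subst inv[of z]) simp
  then show ?thesis by (rule that)
qed

lemma even_right:
  assumes "\<And>z. f (z + shift 1) = c * f z"
  shows "even k"
proof (rule ccontr)
  assume "odd k"
  then have g: "R.g (z + shift 1) = - R.g z" for z using g_shift[of z 1] by simp
  obtain r \<sigma> where "\<sigma> = 1 \<or> \<sigma> = - 1" "\<And>z. Re z \<ge> r \<Longrightarrow> f z \<noteq> 0"
    "\<And>z. Re z \<ge> r \<Longrightarrow> norm (f' z / (f z * R.g z) - \<sigma>) < 1 / 2"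
    by (rule right_end) (rule that)
  then show False by (rule R.no_antiperiodic_translate[OF _ _ _ assms Re_shift g])
qed

lemma even_left:
  assumes per: "\<And>z. f (z + shift 1) = c * f z"
  shows "even l"
proof (cases "l = 0")
  case False
  then have l1: "l \<ge> 1" by simp
  interpret L: nonosc_hill l k "\<lambda>i. b (- i)" "\<lambda>z. f (- z)" "\<lambda>z. - f' (- z)" "- z0" s
    by (rule reflected[OF l1])
  have "c \<noteq> 0" using per[of "z0 - shift 1"] nz by auto
  then have "f (- (z + shift 1)) = inverse c * f (- z)" for z
    using per[of "- (z + shift 1)"] by simp
  then show ?thesis by (rule L.even_right)
qed simp

text \<open>|f'/f| is at most 2|g|, and |g| is a constant times |t|^{kp/2} for t = e^{z/p}. The
  generous exponent avoids half-integers and lets both ends share one \<open>n\<close>.\<close>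

lemma right_bound:
  assumes p: "p > 0" and n: "n \<ge> k * p"
  obtains r B where "\<And>z. Re z \<ge> r \<Longrightarrow> f z \<noteq> 0 \<and> norm (f' z) \<le> B * norm (exp (z / of_nat p)) ^ n * norm (f z)"
proof -
  obtain r \<sigma> where *: "\<sigma> = 1 \<or> \<sigma> = - 1" "\<And>z. Re z \<ge> r \<Longrightarrow> f z \<noteq> 0"
    "\<And>z. Re z \<ge> r \<Longrightarrow> norm (f' z / (f z * R.g z) - \<sigma>) < 1 / 2"
    by (rule right_end) (rule that)
  let ?a = "norm (csqrt (b (int k)))"
  show ?thesis
  proof (rule that)
    fix z assume z: "Re z \<ge> max 0 r"
    then have z': "Re z \<ge> r" "Re z \<ge> 0" by auto
    have fz: "f z \<noteq> 0" by (rule *(2)[OF z'(1)])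
    define \<phi> where "\<phi> = f' z / (f z * R.g z)"
    have "norm \<phi> \<le> norm (\<phi> - \<sigma>) + norm \<sigma>" using norm_triangle_sub[of \<phi> \<sigma>] by simp
    also have "\<dots> \<le> 2" using *(1) *(3)[OF z'(1)] unfolding \<phi>_def by auto
    finally have \<phi>: "norm \<phi> \<le> 2" .
    have "norm (R.g z) = ?a * exp (real k / 2 * Re z)" by (rule R.norm_g)
    also have "\<dots> \<le> ?a * exp (real n * (Re z / real p))"
    proof (intro mult_left_mono)
      have "real k * real p \<le> real n" using n by (metis of_nat_le_iff of_nat_mult)
      then have "real k / 2 * real p \<le> real n" using zero_le_mult_iff[of "real k" "real p"] by simp
      then have "real k / 2 \<le> real n / real p" using p by (simp add: field_simps)
      from mult_right_mono[OF this z'(2)]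
      show "exp (real k / 2 * Re z) \<le> exp (real n * (Re z / real p))" by simp
    qed simp
    also have "exp (real n * (Re z / real p)) = norm (exp (z / of_nat p)) ^ n"
      by (rule norm_exp_power[symmetric])
    finally have g: "norm (R.g z) \<le> ?a * norm (exp (z / of_nat p)) ^ n" .
    have "f' z = \<phi> * R.g z * f z" unfolding \<phi>_def using fz by simp
    then have "norm (f' z) = norm \<phi> * norm (R.g z) * norm (f z)" by (simp add: norm_mult)
    also have "\<dots> \<le> 2 * (?a * norm (exp (z / of_nat p)) ^ n) * norm (f z)"
      using \<phi> g by (intro mult_right_mono mult_mono) auto
    finally show "f z \<noteq> 0 \<and> norm (f' z) \<le> (2 * ?a) * norm (exp (z / of_nat p)) ^ n * norm (f z)"
      using fz by (simp add: mult.assoc)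
  qed
qed

text \<open>For \<open>l = 0\<close> the potential is bounded on the left and \<open>f'/f\<close>
  itself is bounded there, which is stronger than required since |e^{z/p}| \<le> 1. Otherwise the
  right bound is applied to the reflected equation.\<close>

lemma left_bound:
  assumes p: "p > 0" and n: "n \<ge> l * p" and per: "\<And>z. f (z + shift p) = c * f z"
  obtains r B where "\<And>z. Re z \<le> - r \<Longrightarrow> f z \<noteq> 0 \<and> norm (f' z) * norm (exp (z / of_nat p)) ^ n \<le> B * norm (f z)"
proof (cases "l = 0")
  case True
  define M where "M = (\<Sum>j=0..k. norm (b (int j)))"
  have M: "norm (hillQ k l b z) \<le> M" if "Re z \<le> 0" for z
  proof -
    have "norm (K k 0 b (exp z) 0) \<le> (\<Sum>j=0..k. norm (b (int j))) + (\<Sum>j=1..0. norm (b (- int j)))"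
      by (rule K_bounded) (use that in \<open>auto simp: norm_exp_eq_Re\<close>)
    moreover have "hillQ k l b z = K k 0 b (exp z) 0" unfolding hillQ_def True K_def by simp
    ultimately show ?thesis unfolding M_def by simp
  qed
  obtain r B where rB: "\<And>z. Re z \<le> - r \<Longrightarrow> f z \<noteq> 0 \<and> norm (f' z) \<le> B * norm (f z)"
    by (rule regular_end_bounds[OF sol nz p per[unfolded shift_def] M], assumption, rule that)
  show ?thesis
  proof (rule that)
    fix z :: complex assume z: "Re z \<le> - max 0 r"
    then have z': "Re z \<le> - r" "Re z \<le> 0" by auto
    have "norm (exp (z / of_nat p)) \<le> 1"
      using z'(2) p by (simp add: norm_exp_eq_Re divide_nonpos_pos)
    then have "norm (exp (z / of_nat p)) ^ n \<le> 1" by (intro power_le_one) auto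
    then have "norm (f' z) * norm (exp (z / of_nat p)) ^ n \<le> norm (f' z) * 1" by (intro mult_left_mono) auto
    also have "\<dots> \<le> B * norm (f z)" using rB[OF z'(1)] by simp
    finally show "f z \<noteq> 0 \<and> norm (f' z) * norm (exp (z / of_nat p)) ^ n \<le> B * norm (f z)"
      using rB[OF z'(1)] by simp
  qed
next
  case False
  then have l1: "l \<ge> 1" by simp
  interpret L: nonosc_hill l k "\<lambda>i. b (- i)" "\<lambda>z. f (- z)" "\<lambda>z. - f' (- z)" "- z0" s
    by (rule reflected[OF l1])
  obtain r B where rB: "\<And>z. Re z \<ge> r \<Longrightarrow> f (- z) \<noteq> 0 \<and>
      norm (- f' (- z)) \<le> B * norm (exp (z / of_nat p)) ^ n * norm (f (- z))"
    by (rule L.right_bound[OF p n]) (rule that)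
  show ?thesis
  proof (rule that)
    fix z :: complex assume z: "Re z \<le> - r"
    let ?e = "norm (exp (z / of_nat p)) ^ n"
    have *: "f z \<noteq> 0" "norm (f' z) \<le> B * norm (exp (- z / of_nat p)) ^ n * norm (f z)"
      using rB[of "- z"] z by auto
    have "norm (exp (- z / of_nat p)) ^ n * ?e = 1"
      unfolding power_mult_distrib[symmetric] norm_mult[symmetric] mult_exp_exp by simp
    then have eq: "B * norm (exp (- z / of_nat p)) ^ n * norm (f z) * ?e = B * norm (f z)"
      by (metis mult.assoc mult.commute mult_1)
    have "norm (f' z) * ?e \<le> B * norm (exp (- z / of_nat p)) ^ n * norm (f z) * ?e"
      by (rule mult_right_mono[OF *(2)]) simp
    then show "f z \<noteq> 0 \<and> norm (f' z) * ?e \<le> B * norm (f z)"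
      unfolding eq using *(1) by blast
  qed
qed

lemma explicit_form:
  assumes p: "p > 0" and per: "\<And>z. f (z + shift p) = c * f z"
  obtains \<gamma> \<psi> h M N where "rsquarefree \<psi>" "laurent_polynomial h"
    "\<And>z. f z = poly \<psi> (exp (z / of_nat p)) * exp (\<gamma> * z) * exp (h (exp (z / of_nat p)))"
    "\<And>z. poly M (exp (z / of_nat p)) * f' z = poly N (exp (z / of_nat p)) * f z"
    "\<And>z. f z \<noteq> 0 \<Longrightarrow> poly M (exp (z / of_nat p)) \<noteq> 0"
proof -
  define n where "n = max (k * p) (l * p)"
  obtain r1 B1 where 1: "\<And>z. Re z \<ge> r1 \<Longrightarrow> f z \<noteq> 0 \<and> norm (f' z) \<le> B1 * norm (exp (z / of_nat p)) ^ n * norm (f z)"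
    by (rule right_bound[OF p, of n]) (auto simp: n_def intro: that)
  obtain r2 B2 where 2: "\<And>z. Re z \<le> - r2 \<Longrightarrow> f z \<noteq> 0 \<and> norm (f' z) * norm (exp (z / of_nat p)) ^ n \<le> B2 * norm (f z)"
    by (rule left_bound[OF p _ per, of n]) (auto simp: n_def intro: that)
  define r where "r = max r1 r2"
  define B where "B = max B1 B2"
  have right: "f z \<noteq> 0 \<and> norm (f' z) \<le> B * norm (exp (z / of_nat p)) ^ n * norm (f z)" if "Re z \<ge> r" for z
  proof -
    have *: "f z \<noteq> 0" "norm (f' z) \<le> B1 * norm (exp (z / of_nat p)) ^ n * norm (f z)"
      using 1[of z] that by (auto simp: r_def)
    have "B1 * norm (exp (z / of_nat p)) ^ n * norm (f z) \<le> B * norm (exp (z / of_nat p)) ^ n * norm (f z)"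
      by (intro mult_right_mono) (auto simp: B_def)
    then show ?thesis using * by linarith
  qed
  have left: "f z \<noteq> 0 \<and> norm (f' z) * norm (exp (z / of_nat p)) ^ n \<le> B * norm (f z)" if "Re z \<le> - r" for z
  proof -
    have *: "f z \<noteq> 0" "norm (f' z) * norm (exp (z / of_nat p)) ^ n \<le> B2 * norm (f z)"
      using 2[of z] that by (auto simp: r_def)
    have "B2 * norm (f z) \<le> B * norm (f z)" by (intro mult_right_mono) (auto simp: B_def)
    then show ?thesis using * by linarith
  qed
  show ?thesis
    by (rule explicit_form_of_multiplicatively_periodic_solution[OF sol hillQ_cont nz p per[unfolded shift_def] right left],
        assumption, assumption, rule that)
qed

text \<open>If \<open>k\<close> and \<open>l\<close> are both odd, then \<open>f'/f\<close> changes sign under translation by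
  \<open>2 \<pi> i\<close> at both ends, so the product of \<open>f\<close> with its translate tends to \<open>0\<close> at both ends.
  Its square is bounded, hence constant by Liouville, hence zero.\<close>

lemma not_both_odd: "\<not> (odd k \<and> odd l)"
proof
  assume odd: "odd k \<and> odd l"
  then have l1: "l \<ge> 1" by (cases l) auto
  interpret L: nonosc_hill l k "\<lambda>i. b (- i)" "\<lambda>z. f (- z)" "\<lambda>z. - f' (- z)" "- z0" s
    by (rule reflected[OF l1])
  obtain r1 \<sigma>1 where R: "\<sigma>1 = 1 \<or> \<sigma>1 = - 1" "\<And>z. Re z \<ge> r1 \<Longrightarrow> f z \<noteq> 0"
    "\<And>z. Re z \<ge> r1 \<Longrightarrow> norm (f' z / (f z * R.g z) - \<sigma>1) < 1 / 2"
    by (rule right_end) (rule that)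
  obtain r2 \<sigma>2 where Lf: "\<sigma>2 = 1 \<or> \<sigma>2 = - 1" "\<And>z. Re z \<ge> r2 \<Longrightarrow> f (- z) \<noteq> 0"
    "\<And>z. Re z \<ge> r2 \<Longrightarrow> norm (- f' (- z) / (f (- z) * L.R.g z) - \<sigma>2) < 1 / 2"
    by (rule L.right_end) (rule that)
  define w where "w = shift 1"
  have w: "Re w = 0" by (simp add: w_def)
  define f2 where "f2 z = f (z + w)" for z
  define f2' where "f2' z = f' (z + w)" for z
  have sol2: "ode_sol (hillQ k l b) f2 f2'"
    unfolding f2_def[abs_def] f2'_def[abs_def] w_def by (rule ode_sol_shift[OF sol hillQ_shift])
  define C where "C = f 0 * f2' 0 - f' 0 * f2 0"
  have W: "f z * f2' z - f' z * f2 z = C" for z unfolding C_def by (rule wronskian_const[OF sol sol2])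
  obtain c where c: "\<And>z. f (z + shift 2) = c * f z" by (rule translate_multiple[of 2]) auto
  have w2: "z + w + w = z + shift 2" for z by (simp add: w_def shift_def)
  have c': "f' (z + shift 2) = c * f' z" for z by (rule ode_sol_translate_deriv[OF sol c])
  have C_nz: "C \<noteq> 0"
  proof
    assume "C = 0"
    then obtain c1 where "\<And>z. f2 z = c1 * f z"
      using wronskian_zero_imp_multiple[OF sol sol2 hillQ_cont _ nz, of 0] unfolding C_def by metis
    then have "even k" using even_right unfolding f2_def w_def by blast
    then show False using odd by simp
  qed
  \<comment> \<open>Evaluated at \<open>w\<close> instead of 0, the Wronskian picks up the factor
    \<open>- c\<close>, where \<open>c\<close> is the multiplier for two periods. As it is constant
    and nonzero, c = -1.\<close>
  have "C = f w * f2' w - f' w * f2 w" by (rule W[symmetric])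
  also have "\<dots> = c * (f2 0 * f' 0 - f2' 0 * f 0)"
    using c[of 0] c'[of 0] w2[of 0] by (simp add: f2_def f2'_def algebra_simps)
  also have "\<dots> = - c * C" unfolding C_def by (simp add: algebra_simps)
  finally have "C + c * C = 0" by (simp add: eq_neg_iff_add_eq_0)
  then have "C * (1 + c) = 0" by (simp add: algebra_simps)
  then have c_eq: "c = - 1" using C_nz by (simp add: add_eq_0_iff)
  \<comment> \<open>Because c = -1, the product \<open>f * f2\<close> changes sign under translation
    by \<open>w\<close>; squaring makes it periodic.\<close>
  define E where "E z = (f z * f2 z)\<^sup>2" for z
  have E_per: "E (z + 2 * pi * \<i> * 1) = E z" for z
  proof -
    have "f2 (z + w) = - f z" unfolding f2_def w2 c c_eq by simp
    then have "E (z + w) = E z" by (simp add: E_def f2_def power_mult_distrib)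
    then show ?thesis by (simp add: w_def shift_def)
  qed
  have E_hol: "E holomorphic_on UNIV"
    unfolding E_def[abs_def] by (intro holomorphic_intros ode_sol_holomorphic[OF sol] ode_sol_holomorphic[OF sol2])
  \<comment> \<open>The Wronskian is - f f2 G times a sum of two quantities within 1/2 of the same
    \<sigma>, and that sum has modulus at least 1. The minus sign in the condition on
    \<open>f2\<close> reflects the sign change of \<open>g\<close>.\<close>
  have Eb: "norm (f z * f2 z) * norm G \<le> norm C"
    if fz: "f z \<noteq> 0" "f2 z \<noteq> 0" and s: "\<sigma> = 1 \<or> \<sigma> = - 1" and 1: "norm (f' z / (f z * G) - \<sigma>) < 1 / 2"
      and 2: "norm (- (f2' z / (f2 z * G)) - \<sigma>) < 1 / 2" and G: "G \<noteq> 0" for z G and \<sigma> :: complex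
  proof -
    define \<phi> where "\<phi> = f' z / (f z * G)"
    define \<phi>2 where "\<phi>2 = - (f2' z / (f2 z * G))"
    have "C = - (f z * f2 z * G * (\<phi> + \<phi>2))"
      unfolding W[symmetric, of z] \<phi>_def \<phi>2_def using fz G by (simp add: field_simps)
    then have "norm C = norm (f z * f2 z) * norm G * norm (\<phi> + \<phi>2)" by (simp add: norm_mult)
    moreover have "norm (\<phi> + \<phi>2) \<ge> 1"
    proof -
      have "norm (2 * \<sigma>) \<le> norm (\<phi> + \<phi>2) + norm (\<phi> - \<sigma>) + norm (\<phi>2 - \<sigma>)"
        using norm_triangle_ineq4[of "\<phi> + \<phi>2" "(\<phi> - \<sigma>) + (\<phi>2 - \<sigma>)"] norm_triangle_ineq[of "\<phi> - \<sigma>" "\<phi>2 - \<sigma>"]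
        by (simp add: algebra_simps)
      then show ?thesis using 1 2 s unfolding \<phi>_def \<phi>2_def by auto
    qed
    ultimately show ?thesis using mult_left_mono[of 1 "norm (\<phi> + \<phi>2)" "norm (f z * f2 z) * norm G"] by simp
  qed
  have right: "norm (f z * f2 z) * norm (R.g z) \<le> norm C" if z: "Re z \<ge> r1" for z
  proof (rule Eb[OF _ _ R(1) R(3)[OF z]])
    have z2: "Re (z + w) \<ge> r1" using z w by simp
    show "f z \<noteq> 0" "f2 z \<noteq> 0" using R(2) z z2 unfolding f2_def by auto
    have "R.g (z + w) = - R.g z" using g_shift[of z 1] odd unfolding w_def by simp
    then show "norm (- (f2' z / (f2 z * R.g z)) - \<sigma>1) < 1 / 2"
      using R(3)[OF z2] unfolding f2_def f2'_def by simp
  qed simp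
  have left: "norm (f z * f2 z) * norm (L.R.g (- z)) \<le> norm C" if z: "Re (- z) \<ge> r2" for z
  proof -
    have "norm (f z * f2 z) * norm (- L.R.g (- z)) \<le> norm C"
    proof (rule Eb[OF _ _ Lf(1)])
      have z2: "Re (- (z + w)) \<ge> r2" using z w by simp
      show "f z \<noteq> 0" "f2 z \<noteq> 0" 
        using Lf(2)[OF z] Lf(2)[OF z2] unfolding f2_def minus_minus by blast+
      show "norm (f' z / (f z * - L.R.g (- z)) - \<sigma>2) < 1 / 2" using Lf(3)[OF z] by simp
      have "L.R.g (- z) = L.R.g (- (z + w) + w)" by simp
      also have "\<dots> = - L.R.g (- (z + w))"
        using L.g_shift[of "- (z + w)" 1] odd unfolding w_def by simp
      finally have "- L.R.g (- z) = L.R.g (- (z + w))" by simp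
      then show "norm (- (f2' z / (f2 z * - L.R.g (- z))) - \<sigma>2) < 1 / 2"
        using Lf(3)[OF z2] unfolding f2_def f2'_def minus_minus by (simp only: minus_divide_left)
    qed simp
    then show ?thesis by simp
  qed
  obtain F where F: "F holomorphic_on - {0}" and EF: "\<And>z. E z = F (exp (z / of_nat 1))"
    by (rule periodic_factor[OF E_hol, of 1]) (use E_per in \<open>auto intro: that\<close>)
  obtain x1 where x1: "\<And>z. Re z \<ge> x1 \<Longrightarrow> norm (R.g z) \<ge> 1" using R.g_large[of 1] by blast
  obtain x2 where x2: "\<And>z. Re z \<ge> x2 \<Longrightarrow> norm (L.R.g z) \<ge> 1" using L.R.g_large[of 1] by blast
  define \<rho> where "\<rho> = max (max r1 r2) (max x1 x2)"
  have E_ends: "norm (E z) \<le> (norm C)\<^sup>2" if "\<bar>Re z\<bar> \<ge> \<rho>" for z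
  proof -
    have "norm (f z * f2 z) \<le> norm C"
    proof (cases "Re z \<ge> \<rho>")
      case True
      then have "Re z \<ge> r1" "norm (R.g z) \<ge> 1" using x1 by (auto simp: \<rho>_def)
      from right[OF this(1)] this(2) show ?thesis
        using mult_left_mono[of 1 "norm (R.g z)" "norm (f z * f2 z)"] by simp
    next
      case False
      then have "Re (- z) \<ge> \<rho>" using that by auto
      then have "Re (- z) \<ge> r2" "norm (L.R.g (- z)) \<ge> 1" using x2[of "- z"] by (auto simp: \<rho>_def)
      from left[OF this(1)] this(2) show ?thesis
        using mult_left_mono[of 1 "norm (L.R.g (- z))" "norm (f z * f2 z)"] by simp
    qed
    then show ?thesis unfolding E_def norm_power by (intro power_mono) auto
  qed
  define A where "A = cball 0 (exp \<rho>) - ball (0 :: complex) (exp (- \<rho>))"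
  have "compact (F ` A)"
  proof (rule compact_continuous_image)
    show "compact A" unfolding A_def by (intro compact_diff) auto
    have "A \<subseteq> - {0}" unfolding A_def by auto
    then show "continuous_on A F"
      using holomorphic_on_imp_continuous_on[OF F] continuous_on_subset by blast
  qed
  then obtain B where B: "\<And>t. t \<in> A \<Longrightarrow> norm (F t) \<le> B"
    by (meson bounded_iff compact_imp_bounded imageI)
  have "norm (E z) \<le> max B ((norm C)\<^sup>2)" for z
  proof (cases "\<bar>Re z\<bar> \<ge> \<rho>")
    case True
    then show ?thesis using E_ends[of z] by simp
  next
    case False
    then have "exp z \<in> A" unfolding A_def by (auto simp: norm_exp_eq_Re)
    then show ?thesis using B[of "exp z"] EF[of z] by simp
  qed
  then have "bounded (range E)" by (auto simp: bounded_iff)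
  then obtain e where e: "\<And>z. E z = e"
    using Liouville_theorem[OF E_hol] unfolding constant_on_def by auto
  have e_nz: "e \<noteq> 0"
  proof -
    have "f (of_real r1) \<noteq> 0" "f2 (of_real r1) \<noteq> 0"
      using R(2)[of "of_real r1"] R(2)[of "of_real r1 + w"] w by (auto simp: f2_def)
    then show ?thesis using e[of "of_real r1"] unfolding E_def by auto
  qed
  \<comment> \<open>|f f2| now has the constant positive value sqrt |e|, so the bound |f f2| |g|
    \<le> |C| fails as soon as |g| is large enough.\<close>
  obtain x3 where x3: "\<And>z. Re z \<ge> x3 \<Longrightarrow> norm (R.g z) \<ge> (norm C + 1) / sqrt (norm e)"
    using R.g_large by blast
  define z where "z = complex_of_real (max r1 x3)"
  have "norm (f z * f2 z) = sqrt (norm e)"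
    using e[of z] unfolding E_def by (metis norm_ge_zero norm_power real_sqrt_abs abs_of_nonneg)
  moreover have "norm (f z * f2 z) * norm (R.g z) \<le> norm C" by (rule right) (simp add: z_def)
  moreover have "norm (R.g z) \<ge> (norm C + 1) / sqrt (norm e)" by (rule x3) (simp add: z_def)
  moreover have "sqrt (norm e) > 0" using e_nz by simp
  ultimately show False
    by (smt (verit) divide_le_eq mult.commute)
qed

text \<open>An even positive \<open>l\<close> gives \<open>f\<close> a multiplier for one period
  through the left end, which the right end forbids for odd \<open>k\<close>.\<close>

lemma odd_imp_l_zero:
  assumes "odd k"
  shows "l = 0"
proof (rule ccontr)
  assume "l \<noteq> 0"
  then have l1: "l \<ge> 1" by simp
  show False
  proof (cases "odd l")
    case True
    then show False using not_both_odd assms by blast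
  next
    case False
    then obtain c where "\<And>z. f (z + shift 1) = c * f z"
      using translate_multiple_left[OF l1, of 1] by auto
    then show False using even_right assms by blast
  qed
qed

lemma even_imp_even_l:
  assumes "even k"
  shows "even l"
proof -
  obtain c where "\<And>z. f (z + shift 1) = c * f z"
    using translate_multiple[of 1] assms by auto
  then show ?thesis by (rule even_left)
qed

end

section \<open>Existence of entire solutions\<close>

text \<open>Taylor coefficients at 0 of the solution of f'' = Q f with f(0) = \<alpha> and f'(0) =
  \<beta>, where \<open>q\<close> are those of \<open>Q\<close>.\<close>

fun ode_coeff :: "(nat \<Rightarrow> complex) \<Rightarrow> complex \<Rightarrow> complex \<Rightarrow> nat \<Rightarrow> complex" where
  "ode_coeff q \<alpha> \<beta> 0 = \<alpha>"
| "ode_coeff q \<alpha> \<beta> (Suc 0) = \<beta>"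
| "ode_coeff q \<alpha> \<beta> (Suc (Suc n)) =
     (\<Sum>j\<le>n. q j * ode_coeff q \<alpha> \<beta> (n - j)) / (of_nat (Suc n) * of_nat (Suc (Suc n)))"

text \<open>The recursion sums n + 1 products and divides by (n + 1)(n + 2). The surplus factor n +
  2 eventually exceeds \<rho>^2 M; from there on the weighted coefficients cannot exceed their
  earlier maximum.\<close>

lemma ode_coeff_bound:
  assumes M: "\<And>j. norm (q j) * \<rho> ^ j \<le> M" and \<rho>: "\<rho> > 0"
  shows "\<exists>B. \<forall>n. norm (ode_coeff q \<alpha> \<beta> n) * \<rho> ^ n \<le> B"
proof -
  define c where "c n = norm (ode_coeff q \<alpha> \<beta> n) * \<rho> ^ n" for n
  have c0: "c n \<ge> 0" for n using \<rho> by (simp add: c_def)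
  have M0: "M \<ge> 0" using M[of 0] by (simp add: order_trans[OF norm_ge_zero])
  obtain N :: nat where N: "real N \<ge> \<rho>\<^sup>2 * M" using real_arch_simple by blast
  define B where "B = Max (c ` {..Suc (Suc N)})"
  have Bn: "c n \<le> B" if "n \<le> Suc (Suc N)" for n unfolding B_def using that by (intro Max_ge) auto
  have "c n \<le> B" for n
  proof (induction n rule: less_induct)
    case (less n)
    show ?case
    proof (cases "n \<le> Suc (Suc N)")
      case False
      then obtain m where n: "n = Suc (Suc m)" "m \<ge> N" by (cases n; cases "n - 1") auto
      have "norm (\<Sum>j\<le>m. q j * ode_coeff q \<alpha> \<beta> (m - j)) * \<rho> ^ m
          \<le> (\<Sum>j\<le>m. norm (q j * ode_coeff q \<alpha> \<beta> (m - j))) * \<rho> ^ m"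
        using \<rho> by (intro mult_right_mono norm_sum) auto
      also have "\<dots> = (\<Sum>j\<le>m. (norm (q j) * \<rho> ^ j) * c (m - j))"
        unfolding sum_distrib_right c_def
        by (intro sum.cong) (auto simp: norm_mult power_add[symmetric])
      also have "\<dots> \<le> (\<Sum>j\<le>m. M * B)"
        using M M0 c0 by (intro sum_mono mult_mono less) (auto simp: n)
      finally have S: "norm (\<Sum>j\<le>m. q j * ode_coeff q \<alpha> \<beta> (m - j)) * \<rho> ^ m \<le> real (Suc m) * (M * B)" by simp
      have "c n = \<rho>\<^sup>2 * (norm (\<Sum>j\<le>m. q j * ode_coeff q \<alpha> \<beta> (m - j)) * \<rho> ^ m) / (real (Suc m) * real (Suc (Suc m)))"
        unfolding c_def n by (simp add: norm_divide norm_mult power2_eq_square mult_ac del: of_nat_Suc)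
      also have "\<dots> \<le> \<rho>\<^sup>2 * (real (Suc m) * (M * B)) / (real (Suc m) * real (Suc (Suc m)))"
        using S by (intro divide_right_mono mult_left_mono) auto
      also have "\<dots> = (\<rho>\<^sup>2 * M) / real (Suc (Suc m)) * B" by (simp del: of_nat_Suc)
      also have "\<dots> \<le> 1 * B"
      proof (rule mult_right_mono)
        show "(\<rho>\<^sup>2 * M) / real (Suc (Suc m)) \<le> 1" using N n by (simp add: divide_le_eq)
        show "0 \<le> B" using Bn[of 0] c0[of 0] by simp
      qed
      finally show ?thesis by simp
    qed (rule Bn)
  qed
  then show ?thesis unfolding c_def by blast
qed

lemma entire_ode_solution_exists:
  assumes Q: "Q holomorphic_on UNIV"
  obtains f f' where "ode_sol Q f f'" "f 0 = \<alpha>" "f' 0 = \<beta>"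
proof -
  define q where "q n = (deriv ^^ n) Q 0 / fact n" for n
  define A where "A = Abs_fps q"
  define F where "F = Abs_fps (ode_coeff q \<alpha> \<beta>)"
  have Q_sums: "(\<lambda>n. q n * z ^ n) sums Q z" for z
    using holomorphic_power_series[of Q 0 "norm z + 1" z] Q holomorphic_on_subset
    unfolding q_def by auto
  have A_rad: "norm z < fps_conv_radius A" for z :: complex
  proof -
    have "ereal (norm z) < norm (of_real (norm z + 1) :: complex)" by simp
    also have "\<dots> \<le> conv_radius q"
      by (intro conv_radius_geI sums_summable[OF Q_sums])
    finally show ?thesis by (simp add: fps_conv_radius_def A_def)
  qed
  have F_rad: "norm z < fps_conv_radius F" for z :: complex
  proof -
    \<comment> \<open>Coefficient bounds at radius 2r give a geometric series of ratio 1/2 at radius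
      r > |z|.\<close>
    define r where "r = norm z + 1"
    have r: "r > 0" by (simp add: r_def add_nonneg_pos)
    have "summable (\<lambda>n. q n * (of_real (2 * r)) ^ n)" by (rule sums_summable[OF Q_sums])
    then have "(\<lambda>n. q n * (of_real (2 * r)) ^ n) \<longlonglongrightarrow> 0" by (rule summable_LIMSEQ_zero)
    then have "Bseq (\<lambda>n. q n * (of_real (2 * r)) ^ n)" by (rule convergentI[THEN convergent_imp_Bseq])
    then obtain M where "\<And>n. norm (q n * (of_real (2 * r)) ^ n) \<le> M" unfolding Bseq_def by blast
    then have M: "norm (q n) * (2 * r) ^ n \<le> M" for n using r by (simp add: norm_mult norm_power)
    have "2 * r > 0" using r by simp
    from ode_coeff_bound[OF M this] obtain B where
      B: "\<And>n. norm (ode_coeff q \<alpha> \<beta> n) * (2 * r) ^ n \<le> B" by blast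
    have "summable (\<lambda>n. ode_coeff q \<alpha> \<beta> n * of_real r ^ n)"
    proof (rule summable_comparison_test'[of "\<lambda>n. B * (1 / 2) ^ n" 0])
      show "summable (\<lambda>n. B * (1 / 2 :: real) ^ n)" by (intro summable_mult summable_geometric) auto
      show "norm (ode_coeff q \<alpha> \<beta> n * of_real r ^ n) \<le> B * (1 / 2) ^ n" for n
        using B[of n] r by (simp add: norm_mult norm_power power_mult_distrib power_divide field_simps)
    qed
    then have rad: "norm (of_real r :: complex) \<le> conv_radius (ode_coeff q \<alpha> \<beta>)" by (rule conv_radius_geI)
    have "ereal (norm z) < norm (of_real r :: complex)" by (simp add: r_def)
    also note rad
    finally show ?thesis by (simp add: fps_conv_radius_def F_def)
  qed
  have F'_rad: "norm z < fps_conv_radius (fps_deriv F)" for z :: complex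
    using F_rad[of z] fps_conv_radius_deriv[of F] by (rule less_le_trans)
  have eq: "fps_deriv (fps_deriv F) = A * F"
  proof (rule fps_ext)
    fix n
    have "of_nat (Suc n) * (of_nat (Suc (Suc n)) * ode_coeff q \<alpha> \<beta> (Suc (Suc n)))
        = (\<Sum>j\<le>n. q j * ode_coeff q \<alpha> \<beta> (n - j))"
      by (simp del: of_nat_Suc)
    then show "fps_nth (fps_deriv (fps_deriv F)) n = fps_nth (A * F) n"
      by (simp add: F_def A_def fps_mult_nth atLeast0AtMost del: of_nat_Suc ode_coeff.simps)
  qed
  have AQ: "eval_fps A z = Q z" for z
    using Q_sums[of z] unfolding eval_fps_def A_def by (simp add: sums_iff)
  have "ode_sol Q (eval_fps F) (eval_fps (fps_deriv F))"
    unfolding ode_sol_def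
  proof (intro allI conjI)
    fix z
    show "(eval_fps F has_field_derivative eval_fps (fps_deriv F) z) (at z)"
      by (rule has_field_derivative_eval_fps[OF F_rad])
    have "(eval_fps (fps_deriv F) has_field_derivative eval_fps (fps_deriv (fps_deriv F)) z) (at z)"
      by (rule has_field_derivative_eval_fps[OF F'_rad])
    then show "(eval_fps (fps_deriv F) has_field_derivative Q z * eval_fps F z) (at z)"
      unfolding eq eval_fps_mult[OF A_rad F_rad] AQ .
  qed
  moreover have "eval_fps F 0 = \<alpha>" "eval_fps (fps_deriv F) 0 = \<beta>"
    by (simp_all add: eval_fps_at_0 F_def)
  ultimately show ?thesis by (rule that)
qed

section \<open>The correspondence between the two equations\<close>

lemma hill_solution_iff: "hill_solution k l b f \<longleftrightarrow> ode_sol (hillQ k l b) f (deriv f)"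
proof
  assume h: "hill_solution k l b f"
  then have hol: "f holomorphic_on UNIV" unfolding hill_solution_def by blast
  have hol': "deriv f holomorphic_on UNIV" by (rule holomorphic_deriv[OF hol open_UNIV])
  show "ode_sol (hillQ k l b) f (deriv f)"
    unfolding ode_sol_def
  proof (intro allI conjI)
    fix z
    show "(f has_field_derivative deriv f z) (at z)" by (rule holomorphic_derivI[OF hol]) auto
    have "(deriv f has_field_derivative deriv (deriv f) z) (at z)" by (rule holomorphic_derivI[OF hol']) auto
    moreover have "deriv (deriv f) z - hillQ k l b z * f z = 0"
      using h unfolding hill_solution_def hillQ_def by blast
    then have "deriv (deriv f) z = hillQ k l b z * f z" by simp
    ultimately show "(deriv f has_field_derivative hillQ k l b z * f z) (at z)" by simp
  qed
next
  assume s: "ode_sol (hillQ k l b) f (deriv f)"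
  then show "hill_solution k l b f"
    unfolding hill_solution_def
    using ode_sol_holomorphic[OF s] DERIV_imp_deriv[OF ode_solD(2)[OF s]] by (simp add: hillQ_def)
qed

lemma ode_sol_deriv_eq: "ode_sol Q f f' \<Longrightarrow> f' = deriv f"
  by (rule ext) (rule DERIV_imp_deriv[OF ode_solD(1), symmetric])

locale log_branch =
  fixes D :: "complex set" and L :: "complex \<Rightarrow> complex"
  assumes D: "open D" "connected D" "D \<noteq> {}" and L_hol: "L holomorphic_on D"
    and exp_L: "\<And>x. x \<in> D \<Longrightarrow> exp (L x) = x"
begin

lemma D_nz: "x \<in> D \<Longrightarrow> x \<noteq> 0" using exp_L by (metis exp_not_eq_zero)

lemma L_deriv: "x \<in> D \<Longrightarrow> (L has_field_derivative 1 / x) (at x)"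
proof -
  assume x: "x \<in> D"
  have 1: "(L has_field_derivative deriv L x) (at x)" by (rule holomorphic_derivI[OF L_hol D(1) x])
  have "((\<lambda>x. exp (L x)) has_field_derivative exp (L x) * deriv L x) (at x)"
    using 1 by (auto intro!: derivative_eq_intros)
  moreover have "\<forall>\<^sub>F y in nhds x. exp (L y) = y"
    using eventually_nhds_in_open[OF D(1) x] by eventually_elim (rule exp_L)
  ultimately have "((\<lambda>x. x) has_field_derivative exp (L x) * deriv L x) (at x)"
    using DERIV_cong_ev[OF refl _ refl, of "\<lambda>x. exp (L x)" "\<lambda>x. x" x] by blast
  then have "exp (L x) * deriv L x = 1" using DERIV_ident DERIV_unique by blast
  then have "deriv L x = 1 / x" using exp_L[OF x] D_nz[OF x] by (simp add: field_simps)
  with 1 show ?thesis by simp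
qed

lemma exp_half_square: "x \<in> D \<Longrightarrow> exp (L x / 2) * exp (L x / 2) = x"
  using exp_L by (simp add: mult_exp_exp)

text \<open>The factor x^{1/2} removes the first-order term that the substitution x = e^z creates,
  and it produces the constant -1/4.\<close>

definition lift :: "(complex \<Rightarrow> complex) \<Rightarrow> complex \<Rightarrow> complex" where
  "lift f x = exp (L x / 2) * f (L x)"

lemma exp_half_deriv:
  "x \<in> D \<Longrightarrow> ((\<lambda>x. exp (L x / 2)) has_field_derivative exp (L x / 2) * (1 / x / 2)) (at x)"
  by (rule DERIV_chain2[OF DERIV_exp DERIV_cdivide[OF L_deriv]])

lemma comp_L_deriv:
  "x \<in> D \<Longrightarrow> (h has_field_derivative h') (at (L x)) \<Longrightarrow>
     ((\<lambda>x. h (L x)) has_field_derivative h' * (1 / x)) (at x)"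
  by (rule DERIV_chain2[OF _ L_deriv])

lemma lift_deriv:
  assumes sol: "ode_sol Q f f'" and x: "x \<in> D"
  shows "(lift f has_field_derivative exp (L x / 2) * (f (L x) / 2 + f' (L x)) / x) (at x)"
  unfolding lift_def[abs_def]
  by (rule DERIV_cong[OF DERIV_mult[OF exp_half_deriv[OF x] comp_L_deriv[OF x ode_solD(1)[OF sol]]]])
     (use D_nz[OF x] in \<open>simp add: field_simps\<close>)

lemma lift_deriv2:
  assumes sol: "ode_sol Q f f'" and x: "x \<in> D"
  shows "((\<lambda>x. exp (L x / 2) * (f (L x) / 2 + f' (L x)) / x) has_field_derivative
     (Q (L x) - 1 / 4) * lift f x / x\<^sup>2) (at x)"
  unfolding lift_def
  by (rule DERIV_cong[OF DERIV_divide[OF DERIV_mult[OF exp_half_deriv[OF x]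
        DERIV_add[OF DERIV_cdivide[OF comp_L_deriv[OF x ode_solD(1)[OF sol]]] comp_L_deriv[OF x ode_solD(2)[OF sol]]]]
        DERIV_ident D_nz[OF x]]])
     (use D_nz[OF x] in \<open>simp add: field_simps power2_eq_square\<close>)

lemma lift_solution:
  assumes sol: "ode_sol (hillQ k l b) f f'"
  shows "rational_ode_solution k l b D (lift f)"
  unfolding rational_ode_solution_def
proof (intro conjI ballI)
  show "lift f holomorphic_on D"
    unfolding holomorphic_on_def field_differentiable_def
    using lift_deriv[OF sol] has_field_derivative_at_within by blast
  fix x assume x: "x \<in> D"
  have ev: "\<forall>\<^sub>F y in nhds x. exp (L y / 2) * (f (L y) / 2 + f' (L y)) / y = deriv (lift f) y"
    using eventually_nhds_in_open[OF D(1) x] by eventually_elim (simp add: DERIV_imp_deriv[OF lift_deriv[OF sol]])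
  have "(deriv (lift f) has_field_derivative (hillQ k l b (L x) - 1 / 4) * lift f x / x\<^sup>2) (at x)"
    by (rule DERIV_cong_ev[OF refl ev refl, THEN iffD1, OF lift_deriv2[OF sol x]])
  then have "deriv (deriv (lift f)) x = (hillQ k l b (L x) - 1 / 4) * lift f x / x\<^sup>2"
    by (rule DERIV_imp_deriv)
  moreover have "hillQ k l b (L x) = K k l b x (inverse x)"
    unfolding hillQ_def using exp_L[OF x] by (simp add: exp_minus)
  ultimately show "x\<^sup>2 * deriv (deriv (lift f)) x - (K k l b x (inverse x) - 1 / 4) * lift f x = 0"
    using D_nz[OF x] by simp
qed

text \<open>The Wronskians of \<open>u\<close> with the lifts of an entire fundamental system are
  constant on the connected \<open>D\<close>, and Cramer's rule recovers \<open>u\<close> from them.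
  Thus a solution known only on \<open>D\<close> comes from an entire function.\<close>

lemma solution_is_lift:
  assumes u: "rational_ode_solution k l b D u"
  obtains f f' where "ode_sol (hillQ k l b) f f'" "\<And>x. x \<in> D \<Longrightarrow> u x = lift f x"
proof -
  obtain f1 f1' where 1: "ode_sol (hillQ k l b) f1 f1'" "f1 0 = 1" "f1' 0 = 0"
    by (rule entire_ode_solution_exists[OF hillQ_holomorphic])
  obtain f2 f2' where 2: "ode_sol (hillQ k l b) f2 f2'" "f2 0 = 0" "f2' 0 = 1"
    by (rule entire_ode_solution_exists[OF hillQ_holomorphic])
  have u_hol: "u holomorphic_on D" using u unfolding rational_ode_solution_def by blast
  have u': "(u has_field_derivative deriv u x) (at x)" if "x \<in> D" for x
    by (rule holomorphic_derivI[OF u_hol D(1) that])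
  have u'': "(deriv u has_field_derivative (hillQ k l b (L x) - 1 / 4) * u x / x\<^sup>2) (at x)" if x: "x \<in> D" for x
  proof -
    have "hillQ k l b (L x) = K k l b x (inverse x)"
      unfolding hillQ_def using exp_L[OF x] by (simp add: exp_minus)
    then have "deriv (deriv u) x = (hillQ k l b (L x) - 1 / 4) * u x / x\<^sup>2"
      using u x D_nz[OF x] unfolding rational_ode_solution_def by (auto simp: field_simps)
    then show ?thesis
      using holomorphic_derivI[OF holomorphic_deriv[OF u_hol D(1)] D(1) x] by simp
  qed
  define G where "G f f' x = exp (L x / 2) * (f (L x) / 2 + f' (L x)) / x" for f f' :: "complex \<Rightarrow> complex" and x
  have const: "\<exists>c. \<forall>x\<in>D. u x * G f f' x - deriv u x * lift f x = c"
    if sol: "ode_sol (hillQ k l b) f f'" for f f'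
  proof -
    define H where "H x = u x * G f f' x - deriv u x * lift f x" for x
    have H': "(H has_field_derivative 0) (at x)" if x: "x \<in> D" for x
      unfolding H_def[abs_def] G_def
      by (rule DERIV_cong[OF DERIV_diff[OF DERIV_mult[OF u'[OF x] lift_deriv2[OF sol x]]
            DERIV_mult[OF u''[OF x] lift_deriv[OF sol x]]]])
         (simp add: lift_def field_simps)
    have "H constant_on D" by (rule has_field_derivative_0_imp_constant_on[OF H' D(2,1)])
    then show ?thesis unfolding H_def constant_on_def .
  qed
  obtain c1 where c1: "\<And>x. x \<in> D \<Longrightarrow> u x * G f1 f1' x - deriv u x * lift f1 x = c1" using const[OF 1(1)] by blast
  obtain c2 where c2: "\<And>x. x \<in> D \<Longrightarrow> u x * G f2 f2' x - deriv u x * lift f2 x = c2" using const[OF 2(1)] by blast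
  define f where "f z = c2 * f1 z - c1 * f2 z" for z
  define f' where "f' z = c2 * f1' z - c1 * f2' z" for z
  have sol: "ode_sol (hillQ k l b) f f'"
    unfolding ode_sol_def f_def[abs_def] f'_def[abs_def]
    by (intro allI conjI; (rule derivative_eq_intros ode_solD[OF 1(1)] ode_solD[OF 2(1)] refl)+)
       (simp_all add: algebra_simps)
  have "u x = lift f x" if x: "x \<in> D" for x
  proof -
    have W: "f1 z * f2' z - f1' z * f2 z = 1" for z
      using wronskian_const[OF 1(1) 2(1), of z] 1 2 by simp
    have "lift f1 x * G f2 f2' x - G f1 f1' x * lift f2 x
        = (exp (L x / 2) * exp (L x / 2)) / x * (f1 (L x) * f2' (L x) - f1' (L x) * f2 (L x))"
      unfolding lift_def G_def using D_nz[OF x] by (simp add: field_simps)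
    also have "\<dots> = 1" unfolding W exp_half_square[OF x] using D_nz[OF x] by simp
    finally have W1: "lift f1 x * G f2 f2' x - G f1 f1' x * lift f2 x = 1" .
    have "lift f x = c2 * lift f1 x - c1 * lift f2 x" by (simp add: lift_def f_def algebra_simps)
    also have "\<dots> = u x * (lift f1 x * G f2 f2' x - G f1 f1' x * lift f2 x)"
      unfolding c1[OF x, symmetric] c2[OF x, symmetric] by (simp add: algebra_simps)
    finally show ?thesis unfolding W1 by simp
  qed
  with sol show ?thesis by (rule that)
qed

text \<open>\<open>L\<close> is injective because \<open>exp\<close> inverts it, so the image of
  \<open>S\<close> is open and the identity theorem applies.\<close>

lemma entire_identity:
  assumes g: "g holomorphic_on UNIV" and S: "open S" "S \<noteq> {}" "S \<subseteq> D" and zero: "\<And>x. x \<in> S \<Longrightarrow> g (L x) = 0"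
  shows "g z = 0"
proof -
  have inj: "inj_on L S" using exp_L S(3) by (intro inj_onI) (metis subsetD)
  have op: "open (L ` S)"
    by (rule open_mapping_thm3[OF holomorphic_on_subset[OF L_hol S(3)] S(1) inj])
  obtain x where "x \<in> S" using S(2) by blast
  then have "L x islimpt (L ` S)" using op by (intro open_imp_islimpt) auto
  then show ?thesis
    by (rule analytic_continuation[OF g open_UNIV connected_UNIV subset_UNIV UNIV_I _ _ UNIV_I])
       (use zero in auto)
qed

lemma nonzero_locus_open:
  assumes "u holomorphic_on D"
  shows "open (nonzero_locus D u)"
proof -
  have "nonzero_locus D u = D \<inter> u -` (- {0})" unfolding nonzero_locus_def by auto
  then show ?thesis
    using continuous_on_open_vimage[OF D(1), of u] holomorphic_on_imp_continuous_on[OF assms]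
    by (metis Int_commute open_Compl closed_singleton)
qed

lemma lift_locus_nonempty:
  assumes "ode_sol Q f f'" "f z0 \<noteq> 0"
  shows "nonzero_locus D (lift f) \<noteq> {}"
proof
  assume "nonzero_locus D (lift f) = {}"
  then have "f (L x) = 0" if "x \<in> D" for x using that unfolding nonzero_locus_def lift_def by auto
  then have "f z0 = 0"
    by (rule entire_identity[OF ode_sol_holomorphic(1)[OF assms(1)] D(1,3) subset_refl])
  then show False using assms by simp
qed

end

section \<open>Zeros lying over finitely many values of the exponential\<close>

lemma summable_on_arithmetic_progression:
  fixes a :: complex
  shows "(\<lambda>n. 1 / norm (a + of_int n * (of_real (2 * pi) * \<i>)) powr 2) summable_on (UNIV :: int set)"
proof -
  define F where "F n = 1 / norm (a + of_int n * (of_real (2 * pi) * \<i>)) powr 2" for n :: int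
  have F0: "F n \<ge> 0" for n unfolding F_def by simp
  obtain N :: nat where N: "real N \<ge> \<bar>Im a\<bar>" using real_arch_simple by blast
  \<comment> \<open>|2 pi n| is at least 2|n|, and |Im a| \<le> N < |n| costs at most one
    |n|.\<close>
  have bound: "F n \<le> inverse (real_of_int \<bar>n\<bar> ^ 2)" if n: "\<bar>n\<bar> > int N" for n
  proof -
    have n1: "real_of_int \<bar>n\<bar> > real N" using n by (metis of_int_less_iff of_int_of_nat_eq)
    have "\<bar>real_of_int n\<bar> * 2 \<le> \<bar>real_of_int n\<bar> * (2 * pi)" using pi_ge_two by (intro mult_left_mono) auto
    then have "\<bar>real_of_int n * (2 * pi)\<bar> \<ge> 2 * real_of_int \<bar>n\<bar>" by (simp add: abs_mult mult_ac)
    then have "\<bar>Im a + real_of_int n * (2 * pi)\<bar> \<ge> real_of_int \<bar>n\<bar>" using N n1 by linarith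
    then have "norm (a + of_int n * (of_real (2 * pi) * \<i>)) \<ge> real_of_int \<bar>n\<bar>"
      using abs_Im_le_cmod[of "a + of_int n * (of_real (2 * pi) * \<i>)"] by simp
    moreover have "real_of_int \<bar>n\<bar> > 0" using n1 by linarith
    ultimately have "inverse (norm (a + of_int n * (of_real (2 * pi) * \<i>)) ^ 2) \<le> inverse (real_of_int \<bar>n\<bar> ^ 2)"
      by (intro le_imp_inverse_le power_mono) auto
    then show ?thesis unfolding F_def by (simp add: inverse_eq_divide)
  qed
  have half: "(\<lambda>m. F (h m)) summable_on (UNIV :: nat set)" if h: "\<And>m. \<bar>h m\<bar> \<ge> int m" for h
  proof -
    have "summable (\<lambda>m. F (h m))"
    proof (rule summable_comparison_test'[OF inverse_power_summable[of 2]])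
      fix m assume m: "m \<ge> Suc N"
      then have "\<bar>h m\<bar> > int N" using h[of m] by linarith
      then have "F (h m) \<le> inverse (real_of_int \<bar>h m\<bar> ^ 2)" by (rule bound)
      also have "\<dots> \<le> inverse (real m ^ 2)"
      proof (rule le_imp_inverse_le)
        have "real m \<le> real_of_int \<bar>h m\<bar>" using h[of m] by (metis of_int_le_iff of_int_of_nat_eq)
        then show "real m ^ 2 \<le> real_of_int \<bar>h m\<bar> ^ 2" by (intro power_mono) auto
        show "0 < real m ^ 2" using m by simp
      qed
      finally show "norm (F (h m)) \<le> inverse (of_nat m ^ 2)" using F0 by simp
    qed simp
    then show ?thesis using F0 by (simp add: summable_on_UNIV_nonneg_real_iff)
  qed
  have "F summable_on range int"
    by (subst summable_on_reindex) (use half[of int] in \<open>auto simp: o_def\<close>)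
  \<comment> \<open>\<open>Suc\<close> keeps 0 out of the negative half, so that the two ranges are
    disjoint.\<close>
  moreover have "F summable_on range (\<lambda>m. - int (Suc m))"
    by (subst summable_on_reindex) (use half[of "\<lambda>m. - int (Suc m)"] in \<open>auto simp: o_def inj_on_def\<close>)
  moreover have "range int \<inter> range (\<lambda>m. - int (Suc m)) = {}" by auto
  moreover have "range int \<union> range (\<lambda>m. - int (Suc m)) = UNIV"
  proof -
    have "n \<in> range int \<union> range (\<lambda>m. - int (Suc m))" for n
      by (cases n) auto
    then show ?thesis by blast
  qed
  ultimately have "F summable_on UNIV" by (metis summable_on_Un_disjoint)
  then show ?thesis unfolding F_def .
qed

lemma summable_on_exp_preimage:
  assumes "finite R"
  shows "(\<lambda>z. 1 / norm z powr 2) summable_on {z :: complex. exp z \<in> R}"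
  using assms
proof (induction R)
  case (insert t R)
  have "(\<lambda>z. 1 / norm z powr 2) summable_on {z :: complex. exp z = t}"
  proof (cases "t = 0")
    case False
    define h where "h n = Ln t + of_int n * (of_real (2 * pi) * \<i>)" for n :: int
    have "inj h" by (auto simp: h_def inj_on_def)
    then have "(\<lambda>z. 1 / norm z powr 2) summable_on range h"
      using summable_on_arithmetic_progression[of "Ln t"]
      by (subst summable_on_reindex) (auto simp: o_def h_def)
    moreover have "{z. exp z = t} \<subseteq> range h"
    proof
      fix z assume "z \<in> {z. exp z = t}"
      then have "exp z = exp (Ln t)" using False by simp
      then obtain n :: int where "z = Ln t + (of_int (2 * n) * pi) * \<i>" unfolding exp_eq by blast
      then show "z \<in> range h" by (auto simp: h_def intro!: image_eqI[of _ _ n])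
    qed
    ultimately show ?thesis by (rule summable_on_subset_banach)
  qed simp
  moreover have "{z :: complex. exp z = t} \<inter> {z. exp z \<in> R} = {}" using insert.hyps by auto
  ultimately have "(\<lambda>z. 1 / norm z powr 2) summable_on {z :: complex. exp z = t} \<union> {z. exp z \<in> R}"
    using insert.IH by (intro summable_on_Un_disjoint)
  moreover have "{z :: complex. exp z = t} \<union> {z. exp z \<in> R} = {z. exp z \<in> insert t R}" by auto
  ultimately show ?case by simp
qed simp

text \<open>The zeros are simple by uniqueness, so multiplicities drop out. They lie on finitely
  many arithmetic progressions, for which the exponent 2 gives convergence.\<close>

lemma non_oscillatory_if_zeros_algebraic:
  assumes sol: "ode_sol Q f f'" and Q: "continuous_on UNIV Q" and nz: "f z0 \<noteq> 0"
    and C: "C \<noteq> 0" and zeros: "\<And>z. f z = 0 \<Longrightarrow> poly C (exp z) = 0"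
  shows "non_oscillatory f"
proof -
  have fhol: "f holomorphic_on UNIV" by (rule ode_sol_holomorphic(1)[OF sol])
  have simple: "zorder f z = 1" if z: "f z = 0" for z
  proof (rule zorder_zero_eqI[OF fhol open_UNIV UNIV_I])
    have "f' z \<noteq> 0" using ode_unique[OF sol Q z] nz by blast
    then show "(deriv ^^ nat 1) f z \<noteq> 0" using DERIV_imp_deriv[OF ode_solD(1)[OF sol]] by simp
  qed (use z in auto)
  have "(\<lambda>z. 1 / norm z powr 2) summable_on {z :: complex. exp z \<in> {t. poly C t = 0}}"
    by (rule summable_on_exp_preimage[OF poly_roots_finite[OF C]])
  then have "(\<lambda>z. 1 / norm z powr 2) summable_on {z. z \<noteq> 0 \<and> f z = 0}"
    by (rule summable_on_subset_banach) (use zeros in auto)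
  moreover have "(\<lambda>z. 1 / norm z powr 2) summable_on {z. z \<noteq> 0 \<and> f z = 0} \<longleftrightarrow>
      (\<lambda>z. real_of_int (zorder f z) / norm z powr 2) summable_on {z. z \<noteq> 0 \<and> f z = 0}"
    by (rule summable_on_cong) (simp add: simple)
  ultimately have "exponent_of_convergence f \<le> ereal 2"
    unfolding exponent_of_convergence_def by (intro Inf_lower) auto
  then show ?thesis unfolding non_oscillatory_def by (rule le_less_trans) simp
qed

text \<open>The translate by 2 pi i satisfies the same first-order relation, so the Wronskian of the
  two vanishes at a point where \<open>M\<close> does not, hence everywhere.\<close>

lemma rational_logderiv_imp_multiplicatively_periodic:
  assumes sol: "ode_sol (hillQ k l b) f f'" and nz: "f z0 \<noteq> 0" and M: "M \<noteq> 0"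
    and rel: "\<And>z. poly M (exp z) * f' z = poly N (exp z) * f z"
  obtains c where "\<And>z. f (z + of_real (2 * pi) * \<i> * of_nat 1) = c * f z"
proof -
  define w where "w = of_real (2 * pi) * \<i> * (of_nat 1 :: complex)"
  define f2 where "f2 z = f (z + w)" for z
  define f2' where "f2' z = f' (z + w)" for z
  have sol2: "ode_sol (hillQ k l b) f2 f2'"
    unfolding f2_def[abs_def] f2'_def[abs_def] w_def by (rule ode_sol_shift[OF sol hillQ_periodic])
  have "infinite (- {0 :: complex})" by (simp add: Compl_eq_Diff_UNIV infinite_UNIV_char_0)
  then have "\<not> - {0} \<subseteq> {t. poly M t = 0}" using poly_roots_finite[OF M] finite_subset by blast
  then obtain t where t: "t \<noteq> 0" "poly M t \<noteq> 0" by blast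
  define a where "a = Ln t"
  have a: "exp a = t" "exp (a + w) = t" using t by (simp_all add: a_def w_def exp_add)
  have "poly M t * (f a * f2' a - f' a * f2 a) = f a * (poly M t * f2' a) - (poly M t * f' a) * f2 a"
    by (simp add: algebra_simps)
  also have "\<dots> = 0" using rel[of a] rel[of "a + w"] unfolding a f2_def f2'_def by simp
  finally have W: "f a * f2' a - f' a * f2 a = 0" using t by simp
  obtain c where "\<And>z. f2 z = c * f z"
    by (rule wronskian_zero_imp_multiple[OF sol sol2 hillQ_cont W nz]) (rule that)
  then show ?thesis unfolding f2_def w_def by (rule that)
qed

section \<open>Algebraic logarithmic derivatives\<close>

context log_branch
begin

text \<open>Here w = (f/2 + f')/(x f). Multiplying P(x, w) = 0 by (x f)^n clears denominators and
  leaves an identity between entire functions, which therefore also holds at the zeros of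
  \<open>f\<close> and away from the image of \<open>D\<close>.\<close>

lemma annihilator_identity:
  assumes sol: "ode_sol Q f f'" and u: "\<And>x. x \<in> D \<Longrightarrow> u x = lift f x"
    and w: "is_exp_integral_on D w u" and P: "annihilates_on (nonzero_locus D u) P w"
  shows "(\<Sum>i\<le>degree P. poly (coeff P i) (exp z) * exp z ^ (degree P - i) * (f z / 2 + f' z) ^ i * f z ^ (degree P - i)) = 0"
proof (rule entire_identity[where S = "nonzero_locus D u" and
      g = "\<lambda>z. \<Sum>i\<le>degree P. poly (coeff P i) (exp z) * exp z ^ (degree P - i) * (f z / 2 + f' z) ^ i * f z ^ (degree P - i)"])
  let ?n = "degree P"
  show "(\<lambda>z. \<Sum>i\<le>?n. poly (coeff P i) (exp z) * exp z ^ (?n - i) * (f z / 2 + f' z) ^ i * f z ^ (?n - i)) holomorphic_on UNIV"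
    by (intro holomorphic_intros holomorphic_on_compose[of exp UNIV "poly _", unfolded o_def] ode_sol_holomorphic[OF sol]) auto
  have "u holomorphic_on D"
    by (rule holomorphic_transform[of "lift f"])
       (use u lift_deriv[OF sol] in \<open>auto simp: holomorphic_on_def field_differentiable_def intro: has_field_derivative_at_within\<close>)
  then show "open (nonzero_locus D u)" by (rule nonzero_locus_open)
  show "nonzero_locus D u \<noteq> {}" using w unfolding is_exp_integral_on_def by blast
  show "nonzero_locus D u \<subseteq> D" unfolding nonzero_locus_def by auto
  fix x assume x: "x \<in> nonzero_locus D u"
  then have xD: "x \<in> D" unfolding nonzero_locus_def by auto
  define z where "z = L x"
  have ez: "exp z = x" using exp_L[OF xD] unfolding z_def .
  have "\<forall>\<^sub>F y in nhds x. u y = lift f y"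
    using eventually_nhds_in_open[OF D(1) xD] by eventually_elim (rule u)
  then have "deriv u x = deriv (lift f) x" by (rule deriv_cong_ev) simp
  also have "\<dots> = exp (L x / 2) * (f z / 2 + f' z) / x"
    unfolding z_def by (rule DERIV_imp_deriv[OF lift_deriv[OF sol xD]])
  finally have "w x * u x = exp (L x / 2) * (f z / 2 + f' z) / x"
    using w x unfolding is_exp_integral_on_def by simp
  then have "w x * (x * f z) * exp (L x / 2) = (f z / 2 + f' z) * exp (L x / 2)"
    unfolding u[OF xD] lift_def z_def[symmetric] using D_nz[OF xD] by (simp add: field_simps)
  then have wx: "w x * (x * f z) = f z / 2 + f' z" by simp
  have "0 = poly (poly P [:w x:]) x" using P x unfolding annihilates_on_def by simp
  also have "\<dots> = (\<Sum>i\<le>?n. poly (coeff P i) x * w x ^ i)"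
    by (simp add: poly_altdef[of P] poly_sum)
  finally have "0 = (\<Sum>i\<le>?n. poly (coeff P i) x * w x ^ i) * (x * f z) ^ ?n" by simp
  also have "\<dots> = (\<Sum>i\<le>?n. poly (coeff P i) x * x ^ (?n - i) * (f z / 2 + f' z) ^ i * f z ^ (?n - i))"
    unfolding sum_distrib_right
  proof (rule sum.cong)
    fix i assume "i \<in> {..?n}"
    then have "(x * f z) ^ ?n = (x * f z) ^ i * (x * f z) ^ (?n - i)" by (simp add: power_add[symmetric])
    then show "poly (coeff P i) x * w x ^ i * (x * f z) ^ ?n
        = poly (coeff P i) x * x ^ (?n - i) * (f z / 2 + f' z) ^ i * f z ^ (?n - i)"
      unfolding wx[symmetric] power_mult_distrib by (simp add: mult_ac)
  qed simp
  finally show "(\<Sum>i\<le>?n. poly (coeff P i) (exp (L x)) * exp (L x) ^ (?n - i) * (f (L x) / 2 + f' (L x)) ^ i * f (L x) ^ (?n - i)) = 0"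
    unfolding z_def[symmetric] ez by simp
qed

text \<open>At a zero of \<open>f\<close> only the top term of the identity survives, and
  \<open>f'\<close> is nonzero there; hence the leading coefficient of \<open>P\<close> vanishes at
  e^z.\<close>

lemma annihilated_imp_non_oscillatory:
  assumes sol: "ode_sol (hillQ k l b) f f'" and nz: "f z0 \<noteq> 0" and u: "\<And>x. x \<in> D \<Longrightarrow> u x = lift f x"
    and w: "is_exp_integral_on D w u" and P: "annihilates_on (nonzero_locus D u) P w" "P \<noteq> 0"
  shows "non_oscillatory f"
proof (rule non_oscillatory_if_zeros_algebraic[OF sol hillQ_cont nz])
  show "lead_coeff P \<noteq> 0" using P by simp
  fix z assume z: "f z = 0"
  then have f'z: "f' z \<noteq> 0" using ode_unique[OF sol hillQ_cont z] nz by blast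
  have "(\<Sum>i\<le>degree P. poly (coeff P i) (exp z) * exp z ^ (degree P - i) * (f z / 2 + f' z) ^ i * f z ^ (degree P - i))
      = (\<Sum>i\<in>{degree P}. poly (coeff P i) (exp z) * exp z ^ (degree P - i) * (f z / 2 + f' z) ^ i * f z ^ (degree P - i))"
    by (rule sum.mono_neutral_right) (auto simp: z)
  then show "poly (lead_coeff P) (exp z) = 0"
    using annihilator_identity[OF sol u w P(1), of z] f'z z by simp
qed

text \<open>A nonzero polynomial in x alone cannot vanish at all e^z, so \<open>P\<close> is linear
  and can be solved for \<open>f'/f\<close>.\<close>

lemma annihilated_by_degree_less_2:
  assumes sol: "ode_sol Q f f'" and u: "\<And>x. x \<in> D \<Longrightarrow> u x = lift f x"
    and w: "is_exp_integral_on D w u" and P: "annihilates_on (nonzero_locus D u) P w" "P \<noteq> 0" "degree P < 2"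
  obtains M N where "M \<noteq> 0" "\<And>z. poly M (exp z) * f' z = poly N (exp z) * f z"
proof -
  note id = annihilator_identity[OF sol u w P(1)]
  consider "degree P = 0" | "degree P = 1" using P(3) by linarith
  then show ?thesis
  proof cases
    case 1
    have "poly (coeff P 0) t = 0" if "t \<noteq> 0" for t
      using id[of "Ln t"] that by (simp add: 1)
    then have "- {0} \<subseteq> {t. poly (coeff P 0) t = 0}" by auto
    moreover have "infinite (- {0 :: complex})" by (simp add: Compl_eq_Diff_UNIV infinite_UNIV_char_0)
    ultimately have "coeff P 0 = 0" using poly_roots_finite finite_subset by blast
    then show ?thesis using 1 P(2) by (metis leading_coeff_0_iff)
  next
    case 2
    show ?thesis
    proof (rule that[of "coeff P 1" "- (monom 1 1 * coeff P 0) - smult (1 / 2) (coeff P 1)"])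
      show "coeff P 1 \<noteq> 0" using 2 P(2) by (metis leading_coeff_0_iff)
      fix z
      have "poly (coeff P 0) (exp z) * exp z * f z + poly (coeff P 1) (exp z) * (f z / 2 + f' z) = 0"
        using id[of z] by (simp add: 2)
      moreover have "B * f' z = (A * exp z * f z + B * (f z / 2 + f' z)) - A * exp z * f z - 1 / 2 * B * f z" for A B
        by (simp add: algebra_simps)
      ultimately have "poly (coeff P 1) (exp z) * f' z
          = 0 - poly (coeff P 0) (exp z) * exp z * f z - 1 / 2 * poly (coeff P 1) (exp z) * f z" by metis
      then show "poly (coeff P 1) (exp z) * f' z =
          poly (- (monom 1 1 * coeff P 0) - smult (1 / 2) (coeff P 1)) (exp z) * f z"
        by (simp add: poly_monom algebra_simps)
    qed
  qed
qed

end

lemma effective_l_props: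
  shows "effective_l l b \<le> l" "effective_l l b = 0 \<or> b (- int (effective_l l b)) \<noteq> 0"
    "\<And>j. effective_l l b < j \<Longrightarrow> j \<le> l \<Longrightarrow> b (- int j) = 0"
proof -
  let ?S = "{j. j \<le> l \<and> (j = 0 \<or> b (- int j) \<noteq> 0)}"
  have S: "finite ?S" "?S \<noteq> {}" by auto
  have "effective_l l b \<in> ?S" unfolding effective_l_def by (rule Max_in[OF S])
  then show "effective_l l b \<le> l" "effective_l l b = 0 \<or> b (- int (effective_l l b)) \<noteq> 0" by auto
  show "b (- int j) = 0" if "effective_l l b < j" "j \<le> l" for j
  proof (rule ccontr)
    assume "b (- int j) \<noteq> 0"
    then have "j \<le> effective_l l b" unfolding effective_l_def using that S(1) by (intro Max_ge) auto
    then show False using that by simp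
  qed
qed

lemma hillQ_effective: "hillQ k (effective_l l b) b = hillQ k l b"
proof
  fix z
  have "(\<Sum>j=1..effective_l l b. b (- int j) * exp (- z) ^ j) = (\<Sum>j=1..l. b (- int j) * exp (- z) ^ j)"
    by (rule sum.mono_neutral_left) (use effective_l_props[of l b] in auto)
  then show "hillQ k (effective_l l b) b z = hillQ k l b z" unfolding hillQ_def K_def by simp
qed

lemma nonosc_hillI:
  assumes sol: "ode_sol (hillQ k l b) f f'" and nz: "f z0 \<noteq> 0" and k: "k \<ge> 1" "b (int k) \<noteq> 0"
    and no: "non_oscillatory f"
  obtains s where "nonosc_hill k (effective_l l b) b f f' z0 s"
proof -
  obtain s where s: "s > 0" "(\<lambda>z. 1 / norm z powr s) summable_on {z. z \<noteq> 0 \<and> f z = 0}"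
    by (rule non_oscillatory_summable[OF ode_sol_holomorphic(1)[OF sol] nz no]) (rule that)
  show ?thesis
    by (rule that[of s], unfold_locales)
       (use sol nz k s effective_l_props(2)[of l b] in \<open>simp_all add: hillQ_effective\<close>)
qed

lemma poly_even_odd_parts:
  fixes p :: "'a :: comm_ring_1 poly"
  shows "\<exists>p0 p1. \<forall>t. poly p t = poly p0 (t\<^sup>2) + t * poly p1 (t\<^sup>2)"
proof (induction p)
  case 0
  show ?case by (rule exI[of _ 0], rule exI[of _ 0]) simp
next
  case (pCons a q)
  then obtain q0 q1 where "\<And>t. poly q t = poly q0 (t\<^sup>2) + t * poly q1 (t\<^sup>2)" by blast
  then have "\<forall>t. poly (pCons a q) t = poly (pCons a q1) (t\<^sup>2) + t * poly q0 (t\<^sup>2)"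
    by (simp add: algebra_simps power2_eq_square)
  then show ?case by blast
qed

text \<open>x is not the square of a rational function: the two sides have degrees of different
  parity.\<close>

lemma square_neq_X_times_square:
  fixes p q :: "'a :: idom poly"
  assumes "p \<noteq> 0 \<or> q \<noteq> 0"
  shows "p * p \<noteq> [:0, 1:] * (q * q)"
proof (cases "q = 0")
  case False
  then have "degree ([:0, 1:] * (q * q)) = 1 + 2 * degree q" by (simp add: degree_mult_eq)
  moreover have "degree (p * p) = 2 * degree p" by (cases "p = 0") (simp_all add: degree_mult_eq)
  moreover have "2 * degree p \<noteq> 1 + 2 * degree q" by presburger
  ultimately show ?thesis by metis
qed (use assms in simp)

section \<open>From entire solutions to Kovacic's forms\<close>

context log_branch
begin

lemma explicit_form_lift:
  assumes "\<And>x. x \<in> D \<Longrightarrow> u x = lift f x" "rsquarefree \<psi>" "laurent_polynomial h"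
    and "\<And>z. f z = poly \<psi> (exp (z / of_nat p)) * exp (\<gamma> * z) * exp (h (exp (z / of_nat p)))"
  shows "has_explicit_form D p u"
  unfolding has_explicit_form_def
  by (rule exI[of _ L], rule exI[of _ \<gamma>], rule exI[of _ \<psi>], rule exI[of _ h])
     (use assms exp_L in \<open>simp add: L_hol lift_def\<close>)

lemma lift_logderiv:
  assumes sol: "ode_sol Q f f'" and nz: "f z0 \<noteq> 0"
  shows "is_exp_integral_on D (\<lambda>x. (1 / 2 + f' (L x) / f (L x)) / x) (lift f)"
  unfolding is_exp_integral_on_def
proof (intro conjI ballI)
  show "nonzero_locus D (lift f) \<noteq> {}" by (rule lift_locus_nonempty[OF sol nz])
  fix x assume "x \<in> nonzero_locus D (lift f)"
  then have x: "x \<in> D" "f (L x) \<noteq> 0" unfolding nonzero_locus_def lift_def by auto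
  show "deriv (lift f) x = (1 / 2 + f' (L x) / f (L x)) / x * lift f x"
    unfolding DERIV_imp_deriv[OF lift_deriv[OF sol x(1)]] lift_def using x D_nz[OF x(1)]
    by (simp add: field_simps)
qed

lemma case_I_form_lift:
  assumes sol: "ode_sol (hillQ k l b) f f'" and nz: "f z0 \<noteq> 0"
    and rel: "\<And>z. poly M (exp z) * f' z = poly N (exp z) * f z"
    and M: "\<And>z. f z \<noteq> 0 \<Longrightarrow> poly M (exp z) \<noteq> 0"
  shows "case_I_form D (rational_ode_solution k l b D) (lift f)"
proof -
  have "rational_on (nonzero_locus D (lift f)) (\<lambda>x. (1 / 2 + f' (L x) / f (L x)) / x)"
    unfolding rational_on_def
  proof (rule exI[of _ "smult (1 / 2) M + N"], rule exI[of _ "[:0, 1:] * M"], intro conjI ballI)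
    show "[:0, 1:] * M \<noteq> 0" using M[OF nz] by auto
    fix x assume "x \<in> nonzero_locus D (lift f)"
    then have x: "x \<in> D" "f (L x) \<noteq> 0" unfolding nonzero_locus_def lift_def by auto
    have Mx: "poly M x \<noteq> 0" and rx: "poly M x * f' (L x) = poly N x * f (L x)"
      using M[OF x(2)] rel[of "L x"] exp_L[OF x(1)] by auto
    show "poly ([:0, 1:] * M) x \<noteq> 0" using Mx D_nz[OF x(1)] by simp
    have eq: "f' (L x) / f (L x) = poly N x / poly M x" using rx Mx x(2) by (simp add: field_simps)
    show "(1 / 2 + f' (L x) / f (L x)) / x = poly (smult (1 / 2) M + N) x / poly ([:0, 1:] * M) x"
      unfolding eq using Mx D_nz[OF x(1)] by (simp add: field_simps)
  qed
  then show ?thesis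
    unfolding case_I_form_def using lift_solution[OF sol] lift_logderiv[OF sol nz] by blast
qed

text \<open>Eliminating the square root of x gives an annihilator of degree 2, whose leading
  coefficient is nonzero because x is not a square. A smaller degree would make \<open>f'/f\<close>
  rational in e^z, which \<open>no\<close> excludes.\<close>

lemma case_II_form_lift:
  assumes sol: "ode_sol (hillQ k l b) f f'" and nz: "f z0 \<noteq> 0" and M: "M \<noteq> 0"
    and rel: "\<And>z. poly M (exp (z / 2)) * f' z = poly N (exp (z / 2)) * f z"
    and no: "\<And>M N. M \<noteq> 0 \<Longrightarrow> (\<And>z. poly M (exp z) * f' z = poly N (exp z) * f z) \<Longrightarrow> False"
  shows "case_II_form D (rational_ode_solution k l b D) (lift f)"
proof -
  let ?A = "nonzero_locus D (lift f)"
  define w where "w x = (1 / 2 + f' (L x) / f (L x)) / x" for x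
  have w: "is_exp_integral_on D w (lift f)" unfolding w_def[abs_def] by (rule lift_logderiv[OF sol nz])
  obtain M0 M1 where M01: "\<And>t. poly M t = poly M0 (t\<^sup>2) + t * poly M1 (t\<^sup>2)" using poly_even_odd_parts by blast
  obtain N0 N1 where N01: "\<And>t. poly N t = poly N0 (t\<^sup>2) + t * poly N1 (t\<^sup>2)" using poly_even_odd_parts by blast
  have M01_nz: "M0 \<noteq> 0 \<or> M1 \<noteq> 0"
  proof (rule ccontr)
    assume "\<not> ?thesis"
    then have "poly M t = 0" for t using M01 by simp
    then show False using M poly_all_0_iff_0 by blast
  qed
  define X :: "complex poly" where "X = [:0, 1:]"
  define a0 where "a0 = - smult (1 / 2) M0 - N0"
  define b0 where "b0 = - smult (1 / 2) M1 - N1"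
  \<comment> \<open>With \<open>t\<^sup>2 = x\<close>, the relation \<open>M(t) v = N(t)\<close> reads
    \<open>M0(x) v - N0(x) = - t (M1(x) v - N1(x))\<close>.  Squaring eliminates \<open>t\<close>, and \<open>v = x w - 1/2\<close>.\<close>
  define P where "P = [:a0 * a0 - X * (b0 * b0), 2 * (a0 * (X * M0) - X * (b0 * (X * M1))),
      X * X * (M0 * M0 - X * (M1 * M1)):]"
  have top: "X * X * (M0 * M0 - X * (M1 * M1)) \<noteq> 0"
    using square_neq_X_times_square[OF M01_nz] by (simp add: X_def)
  have degP: "degree P = 2" unfolding P_def using top by simp
  have "annihilates_on ?A P w"
    unfolding annihilates_on_def
  proof
    fix x assume "x \<in> ?A"
    then have x: "x \<in> D" "f (L x) \<noteq> 0" unfolding nonzero_locus_def lift_def by auto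
    define t where "t = exp (L x / 2)"
    have t2: "t\<^sup>2 = x" using exp_half_square[OF x(1)] by (simp add: t_def power2_eq_square)
    define v where "v = f' (L x) / f (L x)"
    have wv: "x * w x = 1 / 2 + v" unfolding w_def v_def using D_nz[OF x(1)] by simp
    have "poly M t * v = poly N t" unfolding v_def t_def using rel[of "L x"] x(2) by (simp add: field_simps)
    then have "poly M0 x * v - poly N0 x = - (t * (poly M1 x * v - poly N1 x))"
      unfolding M01 N01 t2 by (simp add: algebra_simps)
    then have "(poly M0 x * v - poly N0 x)\<^sup>2 = x * (poly M1 x * v - poly N1 x)\<^sup>2"
      by (simp add: power_mult_distrib t2)
    moreover have "poly (poly P [:w x:]) x =
        (poly a0 x + (x * w x) * poly M0 x)\<^sup>2 - x * (poly b0 x + (x * w x) * poly M1 x)\<^sup>2"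
      unfolding P_def X_def by (simp add: algebra_simps power2_eq_square)
    moreover have "poly a0 x + (x * w x) * poly M0 x = poly M0 x * v - poly N0 x"
      "poly b0 x + (x * w x) * poly M1 x = poly M1 x * v - poly N1 x"
      unfolding wv a0_def b0_def by (simp_all add: algebra_simps)
    ultimately show "poly (poly P [:w x:]) x = 0" by simp
  qed
  moreover have "\<not> annihilates_on ?A P' w" if P': "P' \<noteq> 0" "degree P' < 2" for P'
  proof
    assume ann: "annihilates_on ?A P' w"
    obtain M' N' where "M' \<noteq> 0" "\<And>z. poly M' (exp z) * f' z = poly N' (exp z) * f z"
      by (rule annihilated_by_degree_less_2[OF sol refl w ann P']) (rule that)
    then show False by (rule no)
  qed
  ultimately have "algebraic_of_degree_on ?A 2 w"
    unfolding algebraic_of_degree_on_def using degP by (metis degree_0 zero_neq_numeral)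
  then show ?thesis unfolding case_II_form_def using lift_solution[OF sol] w by blast
qed

text \<open>Common entry to cases I and II: both supply an annihilating polynomial, which makes the
  entire function behind \<open>u\<close> non-oscillatory.\<close>

lemma liouvillian_solution_lift:
  assumes k: "k \<ge> 1" "b (int k) \<noteq> 0" and E: "rational_ode_solution k l b D u"
    and w: "is_exp_integral_on D w u" and P: "annihilates_on (nonzero_locus D u) P w" "P \<noteq> 0"
  obtains f f' z0 s where "nonosc_hill k (effective_l l b) b f f' z0 s" "\<And>x. x \<in> D \<Longrightarrow> u x = lift f x"
    "non_oscillatory f"
proof -
  obtain f f' where sol: "ode_sol (hillQ k l b) f f'" and u: "\<And>x. x \<in> D \<Longrightarrow> u x = lift f x"
    by (rule solution_is_lift[OF E]) (rule that)
  obtain x where "x \<in> nonzero_locus D u" using w unfolding is_exp_integral_on_def by blast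
  then have nz: "f (L x) \<noteq> 0" using u unfolding nonzero_locus_def lift_def by auto
  have no: "non_oscillatory f" by (rule annihilated_imp_non_oscillatory[OF sol nz u w P])
  obtain s where "nonosc_hill k (effective_l l b) b f f' (L x) s"
    by (rule nonosc_hillI[OF sol nz k no]) (rule that)
  from that[OF this u no] show ?thesis by blast
qed

end

context nonosc_hill
begin

text \<open>Serves twice: it yields even \<open>k\<close> in case I, and for odd \<open>k\<close> it
  makes degree 2 minimal in case II.\<close>

lemma rational_logderiv_imp_even:
  assumes "M \<noteq> 0" "\<And>z. poly M (exp z) * f' z = poly N (exp z) * f z"
  shows "even k"
proof -
  obtain c where c: "\<And>z. f (z + of_real (2 * pi) * \<i> * of_nat 1) = c * f z"
    by (rule rational_logderiv_imp_multiplicatively_periodic[OF sol nz assms]) (rule that)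
  show ?thesis by (rule even_right[of c]) (use c in \<open>simp add: shift_def\<close>)
qed

lemma explicit_form_even:
  assumes "even k"
  obtains \<gamma> \<psi> h M N where "rsquarefree \<psi>" "laurent_polynomial h"
    "\<And>z. f z = poly \<psi> (exp (z / of_nat 1)) * exp (\<gamma> * z) * exp (h (exp (z / of_nat 1)))"
    "\<And>z. poly M (exp z) * f' z = poly N (exp z) * f z"
    "\<And>z. f z \<noteq> 0 \<Longrightarrow> poly M (exp z) \<noteq> 0"
proof -
  obtain c where c: "\<And>z. f (z + shift 1) = c * f z"
    by (rule translate_multiple[of 1]) (use assms in \<open>auto intro: that\<close>)
  obtain \<gamma> \<psi> h M N where 1: "rsquarefree \<psi>" "laurent_polynomial h"
    "\<And>z. f z = poly \<psi> (exp (z / of_nat 1)) * exp (\<gamma> * z) * exp (h (exp (z / of_nat 1)))"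
    "\<And>z. poly M (exp (z / of_nat 1)) * f' z = poly N (exp (z / of_nat 1)) * f z"
    "\<And>z. f z \<noteq> 0 \<Longrightarrow> poly M (exp (z / of_nat 1)) \<noteq> 0"
    by (rule explicit_form[OF zero_less_one c]) (rule that)
  show ?thesis
    by (rule that[OF 1(1,2,3)]) (use 1(4,5) in simp_all)
qed

lemma explicit_form_2:
  obtains \<gamma> \<psi> h M N where "rsquarefree \<psi>" "laurent_polynomial h"
    "\<And>z. f z = poly \<psi> (exp (z / of_nat 2)) * exp (\<gamma> * z) * exp (h (exp (z / of_nat 2)))"
    "M \<noteq> 0" "\<And>z. poly M (exp (z / 2)) * f' z = poly N (exp (z / 2)) * f z"
proof -
  obtain c where c: "\<And>z. f (z + shift 2) = c * f z"
    by (rule translate_multiple[of 2]) (auto intro: that)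
  obtain \<gamma> \<psi> h M N where 1: "rsquarefree \<psi>" "laurent_polynomial h"
    "\<And>z. f z = poly \<psi> (exp (z / of_nat 2)) * exp (\<gamma> * z) * exp (h (exp (z / of_nat 2)))"
    "\<And>z. poly M (exp (z / of_nat 2)) * f' z = poly N (exp (z / of_nat 2)) * f z"
    "\<And>z. f z \<noteq> 0 \<Longrightarrow> poly M (exp (z / of_nat 2)) \<noteq> 0"
    by (rule explicit_form[OF pos2 c]) (rule that)
  have "M \<noteq> 0" using 1(5)[OF nz] by auto
  moreover have "poly M (exp (z / 2)) * f' z = poly N (exp (z / 2)) * f z" for z
    using 1(4)[of z] by simp
  ultimately show ?thesis by (rule that[OF 1(1,2,3)])
qed

end

theorem proposition1p1:
  fixes k l :: nat and b :: "int \<Rightarrow> complex" and D :: "complex set"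
  assumes "k \<ge> 1" and "b (int k) \<noteq> 0"
    and "open D" and "simply_connected D" and "D \<noteq> {}" and "0 \<notin> D"
  shows
    "((\<exists>f. hill_solution k l b f \<and> (\<exists>z. f z \<noteq> 0) \<and> non_oscillatory f) \<longleftrightarrow>
      (\<exists>u. liouvillian_solution_I D (rational_ode_solution k l b D) u \<or>
           liouvillian_solution_II D (rational_ode_solution k l b D) u)) \<and>
     (\<forall>u. liouvillian_solution_I D (rational_ode_solution k l b D) u \<longrightarrow>
        even k \<and> even (effective_l l b) \<and> has_explicit_form D 1 u) \<and>
     (\<forall>u. liouvillian_solution_II D (rational_ode_solution k l b D) u \<longrightarrow>
        odd k \<and> (\<forall>j\<in>{1..l}. b (- int j) = 0) \<and> has_explicit_form D 2 u)"
proof -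
  let ?E = "rational_ode_solution k l b D"
  let ?l = "effective_l l b"
  have "connected D" "\<forall>f. f holomorphic_on D \<and> (\<forall>z\<in>D. f z \<noteq> 0) \<longrightarrow> (\<exists>g. g holomorphic_on D \<and> (\<forall>z\<in>D. f z = exp (g z)))"
    using simply_connected_eq_holomorphic_log[OF \<open>open D\<close>] \<open>simply_connected D\<close> by auto
  then obtain L where "L holomorphic_on D" "\<And>z. z \<in> D \<Longrightarrow> z = exp (L z)"
    using \<open>0 \<notin> D\<close> by (metis holomorphic_on_ident)
  then interpret log_branch D L
    using \<open>open D\<close> \<open>connected D\<close> \<open>D \<noteq> {}\<close> by unfold_locales auto
  have sol_eff: "ode_sol (hillQ k l b) f f'" if "nonosc_hill k ?l b f f' z0 s" for f f' z0 s
    using nonosc_hill.sol[OF that] by (simp add: hillQ_effective)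
  have caseI: "case_I_form D ?E (lift f)" if nh: "nonosc_hill k ?l b f f' z0 s" and "even k" for f f' z0 s
  proof -
    interpret nonosc_hill k ?l b f f' z0 s by (rule nh)
    show ?thesis
      by (rule explicit_form_even[OF \<open>even k\<close>]) (rule case_I_form_lift[OF sol_eff[OF nh] nz])
  qed
  have I: "even k \<and> even ?l \<and> has_explicit_form D 1 u \<and>
      (\<exists>f. hill_solution k l b f \<and> (\<exists>z. f z \<noteq> 0) \<and> non_oscillatory f)"
    if u: "case_I_form D ?E u" for u
  proof -
    obtain w where w: "?E u" "is_exp_integral_on D w u" "rational_on (nonzero_locus D u) w"
      using u unfolding case_I_form_def by blast
    obtain p q where q: "q \<noteq> 0" "\<And>x. x \<in> nonzero_locus D u \<Longrightarrow> poly q x \<noteq> 0 \<and> w x = poly p x / poly q x"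
      using w(3) unfolding rational_on_def by blast
    \<comment> \<open>\<open>[:- p, q:]\<close> is q Y - p, so case I becomes annihilation by a
      polynomial of degree 1.\<close>
    have P: "annihilates_on (nonzero_locus D u) [:- p, q:] w" "[:- p, q:] \<noteq> 0"
      using q by (auto simp: annihilates_on_def)
    obtain f f' z0 s where nh: "nonosc_hill k ?l b f f' z0 s"
      and uf: "\<And>x. x \<in> D \<Longrightarrow> u x = lift f x" and no: "non_oscillatory f"
      by (rule liouvillian_solution_lift[OF assms(1,2) w(1,2) P]) (rule that)
    interpret nonosc_hill k ?l b f f' z0 s by (rule nh)
    have "degree [:- p, q:] < 2" using q(1) by simp
    then obtain M N where "M \<noteq> 0" "\<And>z. poly M (exp z) * f' z = poly N (exp z) * f z"
      using annihilated_by_degree_less_2[OF sol uf w(2) P] by metis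
    then have ev: "even k" by (rule rational_logderiv_imp_even)
    have "has_explicit_form D 1 u"
      by (rule explicit_form_even[OF ev]) (rule explicit_form_lift[OF uf])
    moreover have "hill_solution k l b f"
      using sol_eff[OF nh] ode_sol_deriv_eq[OF sol] unfolding hill_solution_iff by simp
    ultimately show ?thesis using ev even_imp_even_l[OF ev] nz no by blast
  qed
  have II: "odd k \<and> ?l = 0 \<and> has_explicit_form D 2 u \<and>
      (\<exists>f. hill_solution k l b f \<and> (\<exists>z. f z \<noteq> 0) \<and> non_oscillatory f)"
    if u: "case_II_form D ?E u" and not_I: "\<not> kovacic_case_I D ?E" for u
  proof -
    obtain w P where w: "?E u" "is_exp_integral_on D w u"
      and P: "annihilates_on (nonzero_locus D u) P w" "P \<noteq> 0"
      using u unfolding case_II_form_def algebraic_of_degree_on_def by blast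
    obtain f f' z0 s where nh: "nonosc_hill k ?l b f f' z0 s"
      and uf: "\<And>x. x \<in> D \<Longrightarrow> u x = lift f x" and no: "non_oscillatory f"
      by (rule liouvillian_solution_lift[OF assms(1,2) w P]) (rule that)
    interpret nonosc_hill k ?l b f f' z0 s by (rule nh)
    \<comment> \<open>For even \<open>k\<close> the same entire function would produce a solution of
      case I.\<close>
    have odd: "odd k" using caseI[OF nh] not_I unfolding kovacic_case_I_def by blast
    have "has_explicit_form D 2 u"
      by (rule explicit_form_2) (rule explicit_form_lift[OF uf])
    moreover have "hill_solution k l b f"
      using sol_eff[OF nh] ode_sol_deriv_eq[OF sol] unfolding hill_solution_iff by simp
    ultimately show ?thesis using odd odd_imp_l_zero[OF odd] nz no by blast
  qed
  have forward: "\<exists>u. liouvillian_solution_I D ?E u \<or> liouvillian_solution_II D ?E u"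
    if h: "hill_solution k l b f" "f z0 \<noteq> 0" "non_oscillatory f" for f z0
  proof -
    have sol0: "ode_sol (hillQ k l b) f (deriv f)" using h(1) unfolding hill_solution_iff .
    obtain s where nh: "nonosc_hill k ?l b f (deriv f) z0 s"
      by (rule nonosc_hillI[OF sol0 h(2) assms(1,2) h(3)]) (rule that)
    interpret nonosc_hill k ?l b f "deriv f" z0 s by (rule nh)
    show ?thesis
    proof (cases "even k")
      case True
      then show ?thesis
        using caseI[OF nh] unfolding liouvillian_solution_I_def kovacic_case_I_def by blast
    next
      case False
      obtain M N where "M \<noteq> 0" "\<And>z. poly M (exp (z / 2)) * deriv f z = poly N (exp (z / 2)) * f z"
        by (rule explicit_form_2) (rule that)
      then have "case_II_form D ?E (lift f)"
        by (rule case_II_form_lift[OF sol_eff[OF nh] nz]) (use rational_logderiv_imp_even False in metis)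
      \<comment> \<open>If case I occurs, its own solution witnesses the first disjunct; otherwise
        \<open>lift f\<close> is a solution in case II.\<close>
      then show ?thesis
        unfolding liouvillian_solution_I_def liouvillian_solution_II_def kovacic_case_I_def kovacic_case_II_def
        by blast
    qed
  qed
  have l0: "\<forall>j\<in>{1..l}. b (- int j) = 0" if "?l = 0"
    using effective_l_props(3)[of l b] that by auto
  show ?thesis
  proof (intro conjI allI impI iffI)
    assume "\<exists>f. hill_solution k l b f \<and> (\<exists>z. f z \<noteq> 0) \<and> non_oscillatory f"
    then show "\<exists>u. liouvillian_solution_I D ?E u \<or> liouvillian_solution_II D ?E u" using forward by blast
  next
    assume "\<exists>u. liouvillian_solution_I D ?E u \<or> liouvillian_solution_II D ?E u"
    then show "\<exists>f. hill_solution k l b f \<and> (\<exists>z. f z \<noteq> 0) \<and> non_oscillatory f"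
      using I II unfolding liouvillian_solution_I_def liouvillian_solution_II_def kovacic_case_II_def by blast
  qed (use I II l0 in \<open>auto simp: liouvillian_solution_I_def liouvillian_solution_II_def kovacic_case_II_def\<close>)
qed

end
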